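(* Let $N\ge 2$ be an integer and let $\alpha_c(\beta)$ be the critical value, for $0<\beta<\infty$, of long-range percolation on the hierarchical lattice $\Omega_N$ of order $N$. Then the function $\beta\mapsto\alpha_c(\beta)$ is continuous on $(0,N^2)$ and strictly increasing on $[N,N^2)$. Moreover, $\alpha_c(\beta)\nearrow\infty$ as $\beta\nearrow N^2$.
   Context: For an integer $N\ge 2$, the hierarchical lattice of order $N$ is the countable set $\Omega_N=\{\mathbf x=(x_1,x_2,\ldots): x_i\in\{0,1,\ldots,N-1\},\ \sum_i x_i<\infty\}$ with the (ultra)metric $d(\mathbf x,\mathbf x)=0$ and $d(\mathbf x,\mathbf y)=\max\{i: x_i\ne y_i\}$ for $\mathbf x\ne \mathbf y$. Write $0$ for the all-zero sequence. Long-range percolation on $\Omega_N$ with parameters $0\le\alpha<\infty$ and $0<\beta<\infty$: each unordered pair of distinct vertices $x,y\in\Omega_N$ is, independently of all other pairs, joined by an (undirected) edge with probability $p_k=1-\exp(-\alpha/\beta^{k})$, where $k=d(x,y)$. The law is denoted $\mathbb P_{\alpha,\beta}$. The cluster $\mathcal C(x)$ is the connected component of $x$ in the resulting random graph (all vertices reachable from $x$ by finite paths of present edges). The percolation probability is $\theta(\alpha,\beta)=\mathbb P_{\alpha,\beta}(|\mathcal C(0)|=\infty)$, and the critical value is $\alpha_c(\beta)=\inf\{\alpha\ge 0:\theta(\alpha,\beta)>0\}$ (with $\inf\emptyset=\infty$). *)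

theory Defs
  imports "HOL-Probability.Probability"
begin

text \<open>Coordinates are indexed from 0, so \<open>x i\<close> is the coordinate usually written \<open>x\<^sub>i\<^sub>+\<^sub>1\<close>.
  This is why \<open>Suc\<close> appears in the distance below.\<close>

definition hlattice :: "nat \<Rightarrow> (nat \<Rightarrow> nat) set" where
  "hlattice N = {x. (\<forall>i. x i \<in> {0..<N}) \<and> summable (\<lambda>i. real (x i))}"

definition hdist :: "(nat \<Rightarrow> nat) \<Rightarrow> (nat \<Rightarrow> nat) \<Rightarrow> nat" where
  "hdist x y = (if x = y then 0 else Max (Suc ` {i. x i \<noteq> y i}))"

definition hpairs :: "nat \<Rightarrow> (nat \<Rightarrow> nat) set set" where
  "hpairs N = {{x, y} | x y. x \<in> hlattice N \<and> y \<in> hlattice N \<and> x \<noteq> y}"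

text \<open>The distance between the two endpoints of an unordered pair, written as the diameter of the
  pair so that no ordering of the endpoints has to be chosen.\<close>

definition pair_dist :: "(nat \<Rightarrow> nat) set \<Rightarrow> nat" where
  "pair_dist e = Max {hdist x y | x y. x \<in> e \<and> y \<in> e}"

lemma hdist_commute: "hdist x y = hdist y x"
  by (auto simp: hdist_def eq_commute)

lemma pair_dist_doubleton: "pair_dist {x, y} = hdist x y"
proof -
  have "{hdist u v | u v. u \<in> {x, y} \<and> v \<in> {x, y}} = {0, hdist x y}"
    using hdist_commute[of x y] by (auto simp: hdist_def)
  then show ?thesis
    by (simp add: pair_dist_def)
qed

definition edge_prob :: "real \<Rightarrow> real \<Rightarrow> (nat \<Rightarrow> nat) set \<Rightarrow> real" where
  "edge_prob \<alpha> \<beta> e = 1 - exp (- \<alpha> / \<beta> ^ pair_dist e)"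

text \<open>A configuration \<open>\<omega>\<close> assigns to every unordered pair whether the edge is present.\<close>

definition percolation ::
    "nat \<Rightarrow> real \<Rightarrow> real \<Rightarrow> ((nat \<Rightarrow> nat) set \<Rightarrow> bool) measure" where
  "percolation N \<alpha> \<beta> =
     (\<Pi>\<^sub>M e\<in>hpairs N. measure_pmf (bernoulli_pmf (edge_prob \<alpha> \<beta> e)))"

definition open_adj ::
    "nat \<Rightarrow> ((nat \<Rightarrow> nat) set \<Rightarrow> bool) \<Rightarrow> ((nat \<Rightarrow> nat) \<times> (nat \<Rightarrow> nat)) set" where
  "open_adj N \<omega> = {(x, y). {x, y} \<in> hpairs N \<and> \<omega> {x, y}}"

definition cluster ::
    "nat \<Rightarrow> ((nat \<Rightarrow> nat) set \<Rightarrow> bool) \<Rightarrow> (nat \<Rightarrow> nat) \<Rightarrow> (nat \<Rightarrow> nat) set" where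
  "cluster N \<omega> x = {y. (x, y) \<in> (open_adj N \<omega>)\<^sup>*}"

definition theta :: "nat \<Rightarrow> real \<Rightarrow> real \<Rightarrow> real" where
  "theta N \<alpha> \<beta> = measure (percolation N \<alpha> \<beta>)
     {\<omega> \<in> space (percolation N \<alpha> \<beta>). infinite (cluster N \<omega> (\<lambda>_. 0))}"

text \<open>Extended real valued: the infimum of the empty set is \<open>\<infinity>\<close>.\<close>

definition alpha_c :: "nat \<Rightarrow> real \<Rightarrow> ereal" where
  "alpha_c N \<beta> = Inf {ereal \<alpha> | \<alpha>. 0 \<le> \<alpha> \<and> theta N \<alpha> \<beta> > 0}"

end

(* All probabilities are reduced to expectations over the finitely many edges of a ball B n.  For
   beta > N the percolation probability is the decreasing limit of the probabilities escape_prob n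
   that the cluster of 0 within B n has an edge to the outside.  Since beta < N^2, clusters that fill
   a positive fraction of two subballs are linked with overwhelming probability, so percolation
   follows from a condition on one finite ball (renormalization), and conversely theta > 0 forces
   this condition, because a cluster of size O((beta/N)^n) in B n dies out with a probability bounded
   from below.  The condition is open in beta, which gives continuity from the right.  Continuity
   from the left and the divergence at N^2 come from the Duminil-Copin--Tassion criterion: if
   phi(S) < 1 for some finite S there is no percolation, otherwise there is percolation for every
   larger alpha; and phi(S) is continuous in beta.  Strict monotonicity holds because all distances
   are at least 1, so (alpha, beta2) is dominated by (alpha beta1 / beta2, beta1) for beta1 < beta2. *)

theory Submission
  imports Defs "HOL-Real_Asymp.Real_Asymp"
begin

section \<open>Expectations over finitely many independent edges\<close>

text \<open>Survival only forces the cluster of 0 in B n to exceed every multiple of (\<beta>/N)^n,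
  far below the positive fraction of N^n that the renormalization starts from. Comparing entropy
  with cost closes the gap: B n contains at most N^n/L clusters of size at least L = M
  (\<beta>/N)^n, so they split into two families in at most exp((N^2/\<beta>)^n / M) ways, whereas
  keeping two families of positive density unlinked costs a factor exp(- c (N^2/\<beta>)^n). For
  large M the cost wins; this is where \<beta> < N^2 enters. The reduction to finite balls rests on
  the ultrametric: all vertices of B n have the same distance to a given outside vertex, so as far
  as leaving B n is concerned the exterior acts exactly like one ghost vertex joined to each vertex
  with weight \<open>rho \<beta> n\<close>. Probabilities become polynomials in finitely many edge
  probabilities, and strict inequalities between them survive small changes of \<beta>. For \<beta>
  \<le> N the sum behind \<open>rho\<close> diverges. There theta = 1 for every \<alpha> > 0, and at
  \<beta> = N the renormalization is fed by cluster sizes tending to infinity instead.\<close>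

text \<open>A configuration is the set \<open>\<omega>\<close> of open edges.\<close>

definition EE :: "'e set \<Rightarrow> ('e \<Rightarrow> real) \<Rightarrow> ('e set \<Rightarrow> real) \<Rightarrow> real" where
  "EE E p F = (\<Sum>\<omega>\<in>Pow E. (\<Prod>e\<in>\<omega>. p e) * (\<Prod>e\<in>E - \<omega>. 1 - p e) * F \<omega>)"

lemma EE_empty [simp]: "EE {} p F = F {}"
  by (simp add: EE_def)

lemma EE_insert:
  assumes "finite E" "e \<notin> E"
  shows "EE (insert e E) p F
    = p e * EE E p (\<lambda>\<omega>. F (insert e \<omega>)) + (1 - p e) * EE E p F"
proof -
  have P: "Pow (insert e E) = Pow E \<union> insert e ` Pow E" by (simp add: Pow_insert)
  have inj: "inj_on (insert e) (Pow E)" using assms(2) by (auto simp: inj_on_def)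
  have d: "Pow E \<inter> insert e ` Pow E = {}" using assms(2) by auto
  have 1: "(\<Sum>\<omega>\<in>Pow E. (\<Prod>e\<in>\<omega>. p e) * (\<Prod>e\<in>insert e E - \<omega>. 1 - p e) * F \<omega>)
    = (1 - p e) * EE E p F"
    unfolding EE_def sum_distrib_left
  proof (rule sum.cong)
    fix \<omega> assume "\<omega> \<in> Pow E"
    then have "insert e E - \<omega> = insert e (E - \<omega>)" "e \<notin> E - \<omega>" using assms by auto
    then show "(\<Prod>e\<in>\<omega>. p e) * (\<Prod>e\<in>insert e E - \<omega>. 1 - p e) * F \<omega>
      = (1 - p e) * ((\<Prod>e\<in>\<omega>. p e) * (\<Prod>e\<in>E - \<omega>. 1 - p e) * F \<omega>)"
      using assms by simp
  qed simp
  have 2: "(\<Sum>\<omega>\<in>insert e ` Pow E. (\<Prod>e\<in>\<omega>. p e) * (\<Prod>e\<in>insert e E - \<omega>. 1 - p e) * F \<omega>)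
    = p e * EE E p (\<lambda>\<omega>. F (insert e \<omega>))"
    unfolding EE_def sum_distrib_left sum.reindex[OF inj] o_def
  proof (rule sum.cong)
    fix \<omega> assume w: "\<omega> \<in> Pow E"
    then have "insert e E - insert e \<omega> = E - \<omega>" "e \<notin> \<omega>" "finite \<omega>"
      using assms finite_subset by auto
    then show "(\<Prod>e\<in>insert e \<omega>. p e) * (\<Prod>e\<in>insert e E - insert e \<omega>. 1 - p e) * F (insert e \<omega>)
      = p e * ((\<Prod>e\<in>\<omega>. p e) * (\<Prod>e\<in>E - \<omega>. 1 - p e) * F (insert e \<omega>))"
      by simp
  qed simp
  show ?thesis
    unfolding EE_def[of "insert e E"] P
    using 1 2 assms by (subst sum.union_disjoint) (auto simp: d)
qed

lemma EE_cong:
  assumes "\<And>e. e \<in> E \<Longrightarrow> p e = q e" "\<And>\<omega>. \<omega> \<subseteq> E \<Longrightarrow> F \<omega> = G \<omega>"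
  shows "EE E p F = EE E q G"
  unfolding EE_def
proof (rule sum.cong)
  fix \<omega> assume w: "\<omega> \<in> Pow E"
  have "(\<Prod>e\<in>\<omega>. p e) = (\<Prod>e\<in>\<omega>. q e)" "(\<Prod>e\<in>E-\<omega>. 1 - p e) = (\<Prod>e\<in>E-\<omega>. 1 - q e)"
    using assms(1) w by (auto intro!: prod.cong)
  then show "(\<Prod>e\<in>\<omega>. p e) * (\<Prod>e\<in>E - \<omega>. 1 - p e) * F \<omega>
    = (\<Prod>e\<in>\<omega>. q e) * (\<Prod>e\<in>E - \<omega>. 1 - q e) * G \<omega>"
    using assms(2) w by simp
qed simp

lemma EE_add: "EE E p (\<lambda>\<omega>. F \<omega> + G \<omega>) = EE E p F + EE E p G"
  by (simp add: EE_def algebra_simps sum.distrib)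

lemma EE_diff: "EE E p (\<lambda>\<omega>. F \<omega> - G \<omega>) = EE E p F - EE E p G"
  by (simp add: EE_def algebra_simps sum_subtractf)

lemma EE_cmult: "EE E p (\<lambda>\<omega>. c * F \<omega>) = c * EE E p F"
  unfolding EE_def sum_distrib_left by (simp add: mult_ac)

lemma EE_cmult_right: "EE E p (\<lambda>\<omega>. F \<omega> * c) = EE E p F * c"
  unfolding EE_def sum_distrib_right by (simp add: mult_ac)

lemma EE_sum: "EE E p (\<lambda>\<omega>. \<Sum>i\<in>I. F i \<omega>) = (\<Sum>i\<in>I. EE E p (F i))"
  unfolding EE_def sum_distrib_left by (rule sum.swap)

lemma EE_const: "finite E \<Longrightarrow> EE E p (\<lambda>\<omega>. c) = c"
  by (induction rule: finite_induct) (auto simp: EE_insert algebra_simps)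

lemma EE_mono:
  assumes "\<And>e. e \<in> E \<Longrightarrow> 0 \<le> p e \<and> p e \<le> 1" "\<And>\<omega>. \<omega> \<subseteq> E \<Longrightarrow> F \<omega> \<le> G \<omega>"
  shows "EE E p F \<le> EE E p G"
  unfolding EE_def using assms
  by (intro sum_mono mult_left_mono mult_nonneg_nonneg prod_nonneg) auto

lemma EE_nonneg:
  assumes "\<And>e. e \<in> E \<Longrightarrow> 0 \<le> p e \<and> p e \<le> 1" "\<And>\<omega>. \<omega> \<subseteq> E \<Longrightarrow> 0 \<le> F \<omega>"
  shows "0 \<le> EE E p F"
  using EE_mono[of E p "\<lambda>_. 0" F] assms by (auto simp: EE_def)

lemma EE_le_const:
  assumes "finite E" "\<And>e. e \<in> E \<Longrightarrow> 0 \<le> p e \<and> p e \<le> 1" "\<And>\<omega>. \<omega> \<subseteq> E \<Longrightarrow> F \<omega> \<le> c"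
  shows "EE E p F \<le> c"
  using EE_mono[of E p F "\<lambda>_. c"] assms by (auto simp: EE_const)

lemma EE_union:
  assumes "finite J" "finite K" "J \<inter> K = {}"
  shows "EE (J \<union> K) p F = EE J p (\<lambda>a. EE K p (\<lambda>b. F (a \<union> b)))"
  using assms
proof (induction J arbitrary: F rule: finite_induct)
  case (insert e J)
  then have "EE (insert e J \<union> K) p F
    = p e * EE (J \<union> K) p (\<lambda>\<omega>. F (insert e \<omega>)) + (1 - p e) * EE (J \<union> K) p F"
    by (simp add: EE_insert)
  then show ?case using insert by (simp add: EE_insert)
qed simp

lemma EE_split:
  assumes "finite E" "J \<subseteq> E"
  shows "EE E p F = EE J p (\<lambda>a. EE (E - J) p (\<lambda>b. F (a \<union> b)))"
  using EE_union[of J "E - J" p F] assms finite_subset[OF assms(2,1)]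
  by (simp add: Un_absorb1)

lemma EE_marginal:
  assumes "finite E" "J \<subseteq> E"
  shows "EE E p (\<lambda>\<omega>. F (\<omega> \<inter> J)) = EE J p F"
proof -
  have "EE E p (\<lambda>\<omega>. F (\<omega> \<inter> J)) = EE J p (\<lambda>a. EE (E - J) p (\<lambda>b. F ((a \<union> b) \<inter> J)))"
    by (rule EE_split[OF assms])
  also have "\<dots> = EE J p (\<lambda>a. EE (E - J) p (\<lambda>b. F a))"
  proof (intro EE_cong refl)
    fix a b assume "a \<subseteq> J" "b \<subseteq> E - J"
    then have "(a \<union> b) \<inter> J = a" by auto
    then show "F ((a \<union> b) \<inter> J) = F a" by simp
  qed
  also have "\<dots> = EE J p F" using assms by (simp add: EE_const)
  finally show ?thesis .
qed

text \<open>Independence is read off from the form of the integrand. \<open>A\<close> and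
  \<open>B\<close> may reach beyond \<open>E\<close>, which admits complements such as
  \<open>- edges S\<close>.\<close>

lemma EE_indep:
  assumes "finite E" "A \<inter> B = {}"
  shows "EE E p (\<lambda>\<omega>. F (\<omega> \<inter> A) * G (\<omega> \<inter> B))
    = EE E p (\<lambda>\<omega>. F (\<omega> \<inter> A)) * EE E p (\<lambda>\<omega>. G (\<omega> \<inter> B))"
proof -
  let ?A = "E \<inter> A"
  have sub: "?A \<subseteq> E" by auto
  have "EE E p (\<lambda>\<omega>. F (\<omega> \<inter> A) * G (\<omega> \<inter> B))
    = EE ?A p (\<lambda>a. EE (E - ?A) p (\<lambda>b. F ((a \<union> b) \<inter> A) * G ((a \<union> b) \<inter> B)))"
    by (rule EE_split[OF assms(1) sub])
  also have "\<dots> = EE ?A p (\<lambda>a. EE (E - ?A) p (\<lambda>b. F a * G (b \<inter> B)))"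
  proof (intro EE_cong refl)
    fix a b assume "a \<subseteq> ?A" "b \<subseteq> E - ?A"
    then have "(a \<union> b) \<inter> A = a" "(a \<union> b) \<inter> B = b \<inter> B" using assms by auto
    then show "F ((a \<union> b) \<inter> A) * G ((a \<union> b) \<inter> B) = F a * G (b \<inter> B)" by simp
  qed
  also have "\<dots> = EE ?A p F * EE (E - ?A) p (\<lambda>b. G (b \<inter> B))"
    by (simp add: EE_cmult EE_cmult_right)
  also have "EE (E - ?A) p (\<lambda>b. G (b \<inter> B)) = EE E p (\<lambda>\<omega>. G ((\<omega> \<inter> (E - ?A)) \<inter> B))"
    using EE_marginal[OF assms(1), of "E - ?A" p "\<lambda>b. G (b \<inter> B)"] by auto
  also have "\<dots> = EE E p (\<lambda>\<omega>. G (\<omega> \<inter> B))"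
  proof (intro EE_cong refl)
    fix \<omega> assume "\<omega> \<subseteq> E"
    then have "\<omega> \<inter> (E - ?A) \<inter> B = \<omega> \<inter> B" using assms by auto
    then show "G (\<omega> \<inter> (E - ?A) \<inter> B) = G (\<omega> \<inter> B)" by simp
  qed
  also have "EE ?A p F = EE E p (\<lambda>\<omega>. F (\<omega> \<inter> ?A))"
    by (rule EE_marginal[OF assms(1) sub, symmetric])
  also have "\<dots> = EE E p (\<lambda>\<omega>. F (\<omega> \<inter> A))"
  proof (intro EE_cong refl)
    fix \<omega> assume "\<omega> \<subseteq> E"
    then have "\<omega> \<inter> (E \<inter> A) = \<omega> \<inter> A" by auto
    then show "F (\<omega> \<inter> (E \<inter> A)) = F (\<omega> \<inter> A)" by simp
  qed
  finally show ?thesis .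
qed

lemma EE_image:
  assumes "finite E" "inj_on h E"
  shows "EE (h ` E) p F = EE E (\<lambda>e. p (h e)) (\<lambda>\<omega>. F (h ` \<omega>))"
  using assms
proof (induction E arbitrary: F rule: finite_induct)
  case (insert e E)
  then have "h e \<notin> h ` E" "inj_on h E" by auto
  then show ?case using insert by (simp add: EE_insert)
qed simp

text \<open>Induction on the edges takes the place of a monotone coupling: the expectation is affine
  in the probability of each single edge, and its slope, the value with the edge open minus the
  value with it closed, is nonnegative for increasing \<open>F\<close>.\<close>

lemma EE_mono_prob:
  assumes "finite E" "\<And>e. e \<in> E \<Longrightarrow> 0 \<le> p e \<and> p e \<le> q e \<and> q e \<le> 1"
    "\<And>\<omega> \<omega>'. \<omega> \<subseteq> \<omega>' \<Longrightarrow> \<omega>' \<subseteq> E \<Longrightarrow> F \<omega> \<le> F \<omega>'"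
  shows "EE E p F \<le> EE E q F"
  using assms
proof (induction E arbitrary: F rule: finite_induct)
  case (insert e E)
  let ?A = "\<lambda>p. EE E p (\<lambda>\<omega>. F (insert e \<omega>))" and ?B = "\<lambda>p. EE E p F"
  have A: "?A p \<le> ?A q" by (rule insert.IH) (use insert.prems in \<open>auto intro!: insert.prems(2)\<close>)
  have B: "?B p \<le> ?B q" by (rule insert.IH) (use insert.prems(1) in \<open>auto intro!: insert.prems(2)\<close>)
  have AB: "?B q \<le> ?A q"
    by (rule EE_mono) (use insert.prems(1) in \<open>fastforce intro!: insert.prems(2)\<close>)+
  have pe: "0 \<le> p e" "p e \<le> q e" "q e \<le> 1" using insert.prems(1) by auto
  have "p e * ?A p + (1 - p e) * ?B p \<le> p e * ?A q + (1 - p e) * ?B q"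
    using A B pe by (intro add_mono mult_left_mono) auto
  also have "\<dots> = ?B q + p e * (?A q - ?B q)" by (simp add: algebra_simps)
  also have "\<dots> \<le> ?B q + q e * (?A q - ?B q)"
    using AB pe by (intro add_left_mono mult_right_mono) auto
  also have "\<dots> = q e * ?A q + (1 - q e) * ?B q" by (simp add: algebra_simps)
  finally show ?case using insert.hyps by (simp add: EE_insert)
qed simp

lemma EE_all_closed:
  assumes "finite E" "T \<subseteq> E"
  shows "EE E p (\<lambda>\<omega>. of_bool (\<omega> \<inter> T = {})) = (\<Prod>e\<in>T. 1 - p e)"
proof -
  have fT: "finite T" using assms finite_subset by auto
  have "EE E p (\<lambda>\<omega>. of_bool (\<omega> \<inter> T = {})) = EE T p (\<lambda>\<omega>. of_bool (\<omega> = {}))"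
    by (rule EE_marginal[OF assms])
  also have "\<dots> = (\<Prod>e\<in>T. 1 - p e)"
    using fT
  proof (induction T rule: finite_induct)
    case (insert e T)
    then show ?case using EE_const[of T p 0] by (simp add: EE_insert)
  qed simp
  finally show ?thesis .
qed

lemma EE_edge_open:
  assumes "finite E" "e \<in> E"
  shows "EE E p (\<lambda>\<omega>. of_bool (e \<in> \<omega>)) = p e"
proof -
  have "EE E p (\<lambda>\<omega>. of_bool (e \<in> \<omega>)) = EE E p (\<lambda>\<omega>. of_bool (e \<in> \<omega> \<inter> {e}))" by simp
  also have "\<dots> = EE {e} p (\<lambda>\<omega>. of_bool (e \<in> \<omega>))" by (rule EE_marginal) (use assms in auto)
  also have "\<dots> = p e" using EE_insert[of "{}" e p] by simp
  finally show ?thesis .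
qed

text \<open>Russo's formula; an edge contributes only where it is closed and pivotal.\<close>

lemma EE_has_derivative:
  fixes J :: "'e \<Rightarrow> real"
  assumes "finite E"
  shows "((\<lambda>a. EE E (\<lambda>e. 1 - exp (- a * J e)) F) has_real_derivative
     EE E (\<lambda>e. 1 - exp (- a * J e)) (\<lambda>\<omega>. \<Sum>e\<in>E. J e * (F (insert e \<omega>) - F \<omega>))) (at a)"
  using assms
proof (induction E arbitrary: F rule: finite_induct)
  case (insert x E)
  let ?p = "\<lambda>a e. 1 - exp (- a * J e)"
  define A where "A = (\<lambda>a. EE E (?p a) (\<lambda>\<omega>. F (insert x \<omega>)))"
  define B where "B = (\<lambda>a. EE E (?p a) F)"
  define A' where "A' = EE E (?p a) (\<lambda>\<omega>. \<Sum>e\<in>E. J e * (F (insert x (insert e \<omega>)) - F (insert x \<omega>)))"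
  define B' where "B' = EE E (?p a) (\<lambda>\<omega>. \<Sum>e\<in>E. J e * (F (insert e \<omega>) - F \<omega>))"
  have A: "(A has_real_derivative A') (at a)" unfolding A_def A'_def by (rule insert.IH)
  have B: "(B has_real_derivative B') (at a)" unfolding B_def B'_def by (rule insert.IH)
  have eq: "(\<lambda>a. EE (insert x E) (?p a) F) = (\<lambda>a. ?p a x * A a + (1 - ?p a x) * B a)"
    using insert.hyps by (simp add: EE_insert A_def B_def)
  \<comment> \<open>The derivative of \<open>1 - exp (- a * J x)\<close> is \<open>J x\<close> times
    the probability that \<open>x\<close> is closed, so no factor beyond \<open>J x\<close> survives
    in the formula.\<close>
  have "((\<lambda>a. ?p a x * A a + (1 - ?p a x) * B a) has_real_derivative
     (?p a x * A' + J x * exp (- a * J x) * A a) + (exp (- a * J x) * B' - J x * exp (- a * J x) * B a)) (at a)"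
    by (rule derivative_eq_intros A B refl | simp add: algebra_simps)+
  moreover have "EE (insert x E) (?p a) (\<lambda>\<omega>. \<Sum>e\<in>insert x E. J e * (F (insert e \<omega>) - F \<omega>))
    = (?p a x * A' + J x * exp (- a * J x) * A a) + (exp (- a * J x) * B' - J x * exp (- a * J x) * B a)"
  proof -
    have "EE E (?p a) (\<lambda>\<omega>. \<Sum>e\<in>insert x E. J e * (F (insert e (insert x \<omega>)) - F (insert x \<omega>))) = A'"
      unfolding A'_def using insert.hyps by (intro EE_cong) (auto simp: insert_commute)
    moreover have "EE E (?p a) (\<lambda>\<omega>. \<Sum>e\<in>insert x E. J e * (F (insert e \<omega>) - F \<omega>))
       = J x * (A a - B a) + B'"
      unfolding A_def B_def B'_def using insert.hyps by (simp add: EE_add EE_cmult EE_diff)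
    ultimately show ?thesis
      by (subst EE_insert[OF insert.hyps]) (simp only:, simp add: algebra_simps)
  qed
  ultimately show ?case unfolding eq by simp
qed simp

lemma EE_tendsto:
  assumes "\<And>e. e \<in> E \<Longrightarrow> ((\<lambda>t. p t e) \<longlongrightarrow> q e) \<F>"
  shows "((\<lambda>t. EE E (p t) F) \<longlongrightarrow> EE E q F) \<F>"
  unfolding EE_def by (intro tendsto_intros assms) auto

section \<open>Clusters\<close>

definition adj :: "'v set set \<Rightarrow> ('v \<times> 'v) set" where
  "adj \<omega> = {(x, y). {x, y} \<in> \<omega>}"

definition cl :: "'v set set \<Rightarrow> 'v \<Rightarrow> 'v set" where
  "cl \<omega> x = {y. (x, y) \<in> (adj \<omega>)\<^sup>*}"

definition edges :: "'v set \<Rightarrow> 'v set set" where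
  "edges V = {{x, y} | x y. x \<in> V \<and> y \<in> V \<and> x \<noteq> y}"

lemma finite_edges: "finite V \<Longrightarrow> finite (edges V)"
  by (rule finite_subset[of _ "Pow V"]) (auto simp: edges_def)

lemma edges_mono: "V \<subseteq> W \<Longrightarrow> edges V \<subseteq> edges W"
  by (auto simp: edges_def)

lemma edges_subset_Pow: "edges V \<subseteq> Pow V"
  by (auto simp: edges_def)

lemma doubleton_in_edges [simp]: "{x, y} \<in> edges V \<longleftrightarrow> x \<in> V \<and> y \<in> V \<and> x \<noteq> y"
  by (auto simp: edges_def doubleton_eq_iff)

lemma edges_disjoint: "V \<inter> W = {} \<Longrightarrow> edges V \<inter> edges W = {}"
  by (auto simp: edges_def doubleton_eq_iff)

lemma edges_image: "inj_on h V \<Longrightarrow> edges (h ` V) = (`) h ` edges V"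
proof (intro equalityI subsetI)
  fix e assume inj: "inj_on h V" and "e \<in> edges (h ` V)"
  then obtain x y where "x \<in> V" "y \<in> V" "h x \<noteq> h y" "e = {h x, h y}" by (auto simp: edges_def)
  then have "e = h ` {x, y}" "{x, y} \<in> edges V" by auto
  then show "e \<in> (`) h ` edges V" by blast
next
  fix e assume inj: "inj_on h V" and "e \<in> (`) h ` edges V"
  then obtain x y where "x \<in> V" "y \<in> V" "x \<noteq> y" "e = h ` {x, y}" by (auto simp: edges_def)
  then show "e \<in> edges (h ` V)" using inj by (auto simp: inj_on_def)
qed

lemma sym_adj: "sym (adj \<omega>)"
  by (auto simp: sym_def adj_def insert_commute)

lemma cl_refl [simp]: "x \<in> cl \<omega> x"
  by (simp add: cl_def)

lemma cl_sym: "y \<in> cl \<omega> x \<Longrightarrow> x \<in> cl \<omega> y"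
  unfolding cl_def by (auto dest: symD[OF sym_rtrancl[OF sym_adj]])

lemma cl_trans: "y \<in> cl \<omega> x \<Longrightarrow> z \<in> cl \<omega> y \<Longrightarrow> z \<in> cl \<omega> x"
  by (auto simp: cl_def)

lemma cl_eq: "y \<in> cl \<omega> x \<Longrightarrow> cl \<omega> y = cl \<omega> x"
  by (auto intro: cl_trans cl_sym)

lemma cl_step: "y \<in> cl \<omega> x \<Longrightarrow> {y, z} \<in> \<omega> \<Longrightarrow> z \<in> cl \<omega> x"
  by (auto simp: cl_def adj_def intro: rtrancl_into_rtrancl)

lemma cl_mono: "\<omega> \<subseteq> \<omega>' \<Longrightarrow> cl \<omega> x \<subseteq> cl \<omega>' x"
  unfolding cl_def using rtrancl_mono[of "adj \<omega>" "adj \<omega>'"] by (auto simp: adj_def)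

lemma cl_subset_closed:
  assumes "x \<in> Z" "\<And>u v. u \<in> Z \<Longrightarrow> {u, v} \<in> \<omega> \<Longrightarrow> v \<in> Z"
  shows "cl \<omega> x \<subseteq> Z"
proof
  fix y assume "y \<in> cl \<omega> x"
  then have "(x, y) \<in> (adj \<omega>)\<^sup>*" by (simp add: cl_def)
  then show "y \<in> Z" by induction (use assms in \<open>auto simp: adj_def\<close>)
qed

lemma cl_subset:
  assumes "\<omega> \<subseteq> Pow V" "x \<in> V"
  shows "cl \<omega> x \<subseteq> V"
  by (rule cl_subset_closed) (use assms in auto)

text \<open>Exploring the cluster of \<open>x\<close> examines only edges that meet it; hence the
  event that the cluster is a given set does not depend on any other edge.\<close>

lemma cl_eqI:
  assumes "\<And>u v. u \<in> cl \<omega> x \<Longrightarrow> {u, v} \<in> \<omega> \<longleftrightarrow> {u, v} \<in> \<omega>'"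
  shows "cl \<omega>' x = cl \<omega> x"
proof
  show "cl \<omega>' x \<subseteq> cl \<omega> x"
    by (rule cl_subset_closed) (use assms cl_step in fastforce)+
  show "cl \<omega> x \<subseteq> cl \<omega>' x"
  proof
    fix y assume "y \<in> cl \<omega> x"
    then have "(x, y) \<in> (adj \<omega>)\<^sup>*" by (simp add: cl_def)
    then show "y \<in> cl \<omega>' x"
    proof induction
      case (step y z)
      then have "y \<in> cl \<omega> x" "{y, z} \<in> \<omega>" by (auto simp: cl_def adj_def)
      then have "{y, z} \<in> \<omega>'" using assms by simp
      then show ?case using step cl_step by fastforce
    qed simp
  qed
qed

text \<open>The first step of a path out of \<open>V\<close> starts at a vertex reached inside
  \<open>V\<close>; this reduces leaving a ball to the cluster within the ball.\<close>

lemma cl_exit: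
  assumes "x \<in> V" "\<not> cl \<omega> x \<subseteq> V"
  shows "\<exists>u\<in>cl (\<omega> \<inter> edges V) x. \<exists>v. v \<notin> V \<and> {u, v} \<in> \<omega>"
proof (rule ccontr)
  assume *: "\<not> ?thesis"
  let ?C = "cl (\<omega> \<inter> edges V) x"
  have sub: "?C \<subseteq> V" by (rule cl_subset) (use assms edges_subset_Pow in auto)
  have "cl \<omega> x \<subseteq> ?C"
  proof (rule cl_subset_closed)
    fix u v assume u: "u \<in> ?C" and uv: "{u, v} \<in> \<omega>"
    then have "v \<in> V" using * by auto
    then show "v \<in> ?C"
    proof (cases "u = v")
      case False
      then have "{u, v} \<in> \<omega> \<inter> edges V" using u uv sub \<open>v \<in> V\<close> by auto
      then show ?thesis using cl_step[OF u] by blast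
    qed (use u in simp)
  qed simp
  then show False using assms sub by auto
qed

lemma image_doubleton_mem:
  assumes "inj_on h V" "\<omega> \<subseteq> Pow V" "u \<in> V" "v \<in> V"
  shows "{h u, h v} \<in> (`) h ` \<omega> \<longleftrightarrow> {u, v} \<in> \<omega>"
proof
  assume "{h u, h v} \<in> (`) h ` \<omega>"
  then obtain e where e: "e \<in> \<omega>" "h ` {u, v} = h ` e" by auto
  then have "{u, v} = e" using assms inj_on_image_eq_iff[OF assms(1), of "{u, v}" e] by auto
  then show "{u, v} \<in> \<omega>" using e by simp
next
  assume "{u, v} \<in> \<omega>"
  then have "h ` {u, v} \<in> (`) h ` \<omega>" by blast
  then show "{h u, h v} \<in> (`) h ` \<omega>" by simp
qed

lemma cl_image:
  assumes "inj_on h V" "\<omega> \<subseteq> Pow V" "x \<in> V"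
  shows "cl ((`) h ` \<omega>) (h x) = h ` cl \<omega> x"
proof
  have sub: "cl \<omega> x \<subseteq> V" using assms by (intro cl_subset)
  show "cl ((`) h ` \<omega>) (h x) \<subseteq> h ` cl \<omega> x"
  proof (rule cl_subset_closed)
    fix u v assume u: "u \<in> h ` cl \<omega> x" and uv: "{u, v} \<in> (`) h ` \<omega>"
    obtain a where a: "a \<in> cl \<omega> x" "u = h a" using u by auto
    have "v \<in> h ` V" using uv assms(2) by fastforce
    then obtain b where b: "b \<in> V" "v = h b" by auto
    have "{a, b} \<in> \<omega>" using image_doubleton_mem[OF assms(1,2)] a b sub uv by auto
    then show "v \<in> h ` cl \<omega> x" using cl_step[OF a(1)] b by auto
  qed simp
  show "h ` cl \<omega> x \<subseteq> cl ((`) h ` \<omega>) (h x)"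
  proof
    fix z assume "z \<in> h ` cl \<omega> x"
    then obtain y where "y \<in> cl \<omega> x" "z = h y" by auto
    then have "(x, y) \<in> (adj \<omega>)\<^sup>*" by (simp add: cl_def)
    then have "h y \<in> cl ((`) h ` \<omega>) (h x)"
    proof induction
      case (step y w)
      then have yw: "{y, w} \<in> \<omega>" by (auto simp: adj_def)
      then have "{h y, h w} \<in> (`) h ` \<omega>"
        using image_doubleton_mem[OF assms(1,2), of y w] assms(2) by auto
      then show ?case using step cl_step by fastforce
    qed simp
    then show "z \<in> cl ((`) h ` \<omega>) (h x)" using \<open>z = h y\<close> by simp
  qed
qed

section \<open>The hierarchical lattice\<close>

lemma support_subset: "\<forall>i\<ge>n. x i = 0 \<Longrightarrow> {i. x i \<noteq> 0} \<subseteq> {..<n::nat}"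
  by (rule subsetI, rule ccontr) (auto simp: not_less)

text \<open>The terms of a summable sequence of natural numbers are eventually smaller than 1, hence
  eventually 0.\<close>

lemma hlattice_iff: "x \<in> hlattice N \<longleftrightarrow> (\<forall>i. x i < N) \<and> finite {i. x i \<noteq> 0}"
proof -
  have "finite {i. x i \<noteq> 0}" if "summable (\<lambda>i. real (x i))"
  proof -
    have "eventually (\<lambda>i. real (x i) < 1) sequentially"
      using summable_LIMSEQ_zero[OF that] by (rule order_tendstoD) simp
    then obtain n where "\<forall>i\<ge>n. x i = 0" by (auto simp: eventually_sequentially)
    then show ?thesis by (rule finite_subset[OF support_subset finite_lessThan])
  qed
  moreover have "summable (\<lambda>i. real (x i))" if "finite {i. x i \<noteq> 0}"
    by (rule summable_finite[OF that]) auto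
  ultimately show ?thesis by (auto simp: hlattice_def)
qed

lemma finite_diff_hlattice: "x \<in> hlattice N \<Longrightarrow> y \<in> hlattice N \<Longrightarrow> finite {i. x i \<noteq> y i}"
  by (rule finite_subset[of _ "{i. x i \<noteq> 0} \<union> {i. y i \<noteq> 0}"]) (auto simp: hlattice_iff)

text \<open>Coordinates count from 0, so a difference at index \<open>i\<close> contributes
  \<open>Suc i\<close>; distance at most \<open>n\<close> therefore means agreement from index
  \<open>n\<close> on.\<close>

lemma hdist_le_iff:
  assumes "x \<in> hlattice N" "y \<in> hlattice N"
  shows "hdist x y \<le> n \<longleftrightarrow> (\<forall>i\<ge>n. x i = y i)"
proof (cases "x = y")
  case False
  then have ne: "Suc ` {i. x i \<noteq> y i} \<noteq> {}" by auto
  have "hdist x y \<le> n \<longleftrightarrow> (\<forall>i. x i \<noteq> y i \<longrightarrow> Suc i \<le> n)"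
    unfolding hdist_def using False ne finite_diff_hlattice[OF assms] by auto
  then show ?thesis by (meson not_less_eq_eq)
qed (simp add: hdist_def)

lemma hdist_pos:
  assumes "x \<in> hlattice N" "y \<in> hlattice N" "x \<noteq> y"
  shows "1 \<le> hdist x y"
proof (rule ccontr)
  assume "\<not> 1 \<le> hdist x y"
  then have "hdist x y \<le> 0" by simp
  then show False using assms hdist_le_iff[of x N y 0] by auto
qed

lemma hpairs_eq: "hpairs N = edges (hlattice N)"
  by (auto simp: hpairs_def edges_def)

lemma edge_prob_bounds:
  assumes "0 \<le> \<alpha>" "0 < \<beta>"
  shows "0 \<le> edge_prob \<alpha> \<beta> e" "edge_prob \<alpha> \<beta> e \<le> 1"
  using assms by (auto simp: edge_prob_def)

text \<open>Coordinatewise addition modulo \<open>N\<close> makes the lattice an abelian group with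
  a translation invariant distance; \<open>B n\<close> is a subgroup and the balls of radius
  \<open>n\<close> are its cosets.\<close>

definition shift :: "nat \<Rightarrow> (nat \<Rightarrow> nat) \<Rightarrow> (nat \<Rightarrow> nat) \<Rightarrow> nat \<Rightarrow> nat" where
  "shift N a x = (\<lambda>i. (x i + a i) mod N)"

definition hball :: "nat \<Rightarrow> nat \<Rightarrow> (nat \<Rightarrow> nat) \<Rightarrow> (nat \<Rightarrow> nat) set" where
  "hball N n x = {y \<in> hlattice N. \<forall>i\<ge>n. y i = x i}"

locale hierarchical =
  fixes N :: nat
  assumes N2: "2 \<le> N"
begin

abbreviation "B n \<equiv> hball N n (\<lambda>_. 0)"

lemma zero_in_hlattice [simp]: "(\<lambda>_. 0) \<in> hlattice N"
  using N2 by (simp add: hlattice_iff)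

lemma zero_in_B [simp]: "(\<lambda>_. 0) \<in> B n"
  by (simp add: hball_def)

lemma hball_subset: "hball N n x \<subseteq> hlattice N"
  by (auto simp: hball_def)

lemma center_in_hball: "x \<in> hlattice N \<Longrightarrow> x \<in> hball N n x"
  by (simp add: hball_def)

lemma hball_eq: "y \<in> hball N n x \<Longrightarrow> hball N n y = hball N n x"
  by (auto simp: hball_def)

lemma hball_mono: "n \<le> m \<Longrightarrow> hball N n x \<subseteq> hball N m x"
  by (auto simp: hball_def)

lemma hball_subset_B: "x \<in> B m \<Longrightarrow> n \<le> m \<Longrightarrow> hball N n x \<subseteq> B m"
  by (auto simp: hball_def)

lemma B_eq: "B n = PiE_dflt {..<n} 0 (\<lambda>_. {..<N})"
proof -
  have "finite {i. y i \<noteq> 0}" if "\<forall>i\<ge>n. y i = 0" for y :: "nat \<Rightarrow> nat"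
    by (rule finite_subset[OF support_subset[OF that] finite_lessThan])
  then have "y \<in> B n \<longleftrightarrow> (\<forall>i. y i < N) \<and> (\<forall>i\<ge>n. y i = 0)" for y
    unfolding hball_def hlattice_iff by blast
  moreover have "y \<in> PiE_dflt {..<n} 0 (\<lambda>_. {..<N}) \<longleftrightarrow> (\<forall>i. y i < N) \<and> (\<forall>i\<ge>n. y i = 0)" for y
    unfolding PiE_dflt_def using N2
    by (auto simp: not_less) (metis gr0I leI less_le_trans zero_less_numeral)
  ultimately show ?thesis by blast
qed

lemma finite_B [simp]: "finite (B n)"
  unfolding B_eq by (intro finite_PiE_dflt) auto

lemma card_B: "card (B n) = N ^ n"
  unfolding B_eq by (subst card_PiE_dflt) auto

lemma hlattice_UN_B: "hlattice N = (\<Union>n. B n)"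
proof
  show "hlattice N \<subseteq> (\<Union>n. B n)"
  proof
    fix x assume x: "x \<in> hlattice N"
    then have "finite {i. x i \<noteq> 0}" by (simp add: hlattice_iff)
    then obtain n where "\<forall>i\<in>{i. x i \<noteq> 0}. i < n" by (meson finite_nat_set_iff_bounded)
    then have "\<forall>i\<ge>n. x i = 0" by fastforce
    then have "x \<in> B n" using x by (simp add: hball_def)
    then show "x \<in> (\<Union>n. B n)" by blast
  qed
qed (auto simp: hball_def)

lemma shift_in:
  assumes "a \<in> hlattice N" "x \<in> hlattice N"
  shows "shift N a x \<in> hlattice N"
proof -
  have "finite {i. shift N a x i \<noteq> 0}"
    by (rule finite_subset[of _ "{i. a i \<noteq> 0} \<union> {i. x i \<noteq> 0}"])
       (use assms in \<open>auto simp: hlattice_iff shift_def\<close>)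
  then show ?thesis using N2 by (auto simp: hlattice_iff shift_def)
qed

lemma mod_add_inj:
  assumes "u < N" "v < N" "(u + c) mod N = (v + c) mod N"
  shows "u = v"
proof -
  \<comment> \<open>Adding \<open>N * c - c\<close> completes \<open>c\<close> to a multiple of
    \<open>N\<close>.\<close>
  have "(u + c + (N * c - c)) mod N = (v + c + (N * c - c)) mod N"
    using assms(3) by (rule mod_add_cong) simp
  moreover have "w + c + (N * c - c) = w + N * c" for w using N2 by simp
  ultimately show ?thesis using assms by simp
qed

lemma shift_diff_iff:
  assumes "x \<in> hlattice N" "y \<in> hlattice N"
  shows "shift N a x i = shift N a y i \<longleftrightarrow> x i = y i"
  using assms mod_add_inj[of "x i" "y i" "a i"] by (auto simp: shift_def hlattice_iff)

lemma inj_shift: "inj_on (shift N a) (hlattice N)"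
  by (rule inj_onI, rule ext) (use shift_diff_iff in metis)

lemma hdist_shift:
  assumes "x \<in> hlattice N" "y \<in> hlattice N"
  shows "hdist (shift N a x) (shift N a y) = hdist x y"
proof -
  have "shift N a x = shift N a y \<longleftrightarrow> x = y" using inj_shift assms by (auto simp: inj_on_def)
  then show ?thesis by (simp add: hdist_def shift_diff_iff[OF assms])
qed

lemma shift_image_B:
  assumes x: "x \<in> hlattice N"
  shows "shift N x ` B n = hball N n x"
proof
  have xN: "x i < N" for i using x by (simp add: hlattice_iff)
  show "shift N x ` B n \<subseteq> hball N n x"
    using shift_in[OF x] xN by (auto simp: hball_def shift_def)
  show "hball N n x \<subseteq> shift N x ` B n"
  proof
    fix y assume y: "y \<in> hball N n x"
    then have yN: "y i < N" for i by (simp add: hball_def hlattice_iff)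
    define z where "z = (\<lambda>i. (y i + (N - x i)) mod N)"
    have "finite {i. x i \<noteq> 0 \<or> y i \<noteq> 0}" using x y by (simp add: hball_def hlattice_iff Collect_disj_eq)
    moreover have "{i. z i \<noteq> 0} \<subseteq> {i. x i \<noteq> 0 \<or> y i \<noteq> 0}" 
      using N2 by (auto simp: z_def intro!: Nat.gr0I)
    ultimately have "finite {i. z i \<noteq> 0}" using finite_subset by blast
    then have "z \<in> hlattice N" using N2 by (auto simp: hlattice_iff z_def)
    moreover have "z i = 0" if "i \<ge> n" for i
      using y that xN[of i] by (auto simp: z_def hball_def)
    ultimately have "z \<in> B n" by (simp add: hball_def)
    moreover have "shift N x z = y"
    proof
      fix i
      have "(z i + x i) mod N = (y i + (N - x i) + x i) mod N" by (simp add: z_def mod_add_left_eq)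
      also have "\<dots> = (y i + N) mod N" using xN[of i] by (simp add: less_imp_le)
      also have "\<dots> = y i" using yN by simp
      finally show "shift N x z i = y i" by (simp add: shift_def)
    qed
    ultimately show "y \<in> shift N x ` B n" by blast
  qed
qed

lemma inj_shift_B: "inj_on (shift N a) (B n)"
  using inj_shift hball_subset by (rule inj_on_subset)

lemma finite_hball [simp]: "x \<in> hlattice N \<Longrightarrow> finite (hball N n x)"
  using shift_image_B[of x n, symmetric] by simp

lemma card_hball: "x \<in> hlattice N \<Longrightarrow> card (hball N n x) = N ^ n"
  using shift_image_B[of x n, symmetric] by (simp add: card_image[OF inj_shift_B] card_B)

lemma edge_prob_shift:
  assumes "e \<in> edges (hlattice N)"
  shows "edge_prob \<alpha> \<beta> (shift N a ` e) = edge_prob \<alpha> \<beta> e"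
  using assms by (auto simp: edges_def edge_prob_def pair_dist_doubleton hdist_shift)

lemma EE_translate:
  assumes "x \<in> hlattice N"
  shows "EE (edges (hball N n x)) (edge_prob \<alpha> \<beta>) F
    = EE (edges (B n)) (edge_prob \<alpha> \<beta>) (\<lambda>\<omega>. F ((`) (shift N x) ` \<omega>))"
proof -
  have e: "edges (hball N n x) = (`) (shift N x) ` edges (B n)"
    unfolding shift_image_B[OF assms, symmetric] by (rule edges_image[OF inj_shift_B])
  have "inj_on ((`) (shift N x)) (Pow (B n))"
    by (rule inj_on_image_Pow[OF inj_shift_B])
  then have inj: "inj_on ((`) (shift N x)) (edges (B n))"
    using edges_subset_Pow inj_on_subset by blast
  show ?thesis
    unfolding e by (subst EE_image[OF finite_edges[OF finite_B] inj])
      (intro EE_cong refl edge_prob_shift subsetD[OF edges_mono[OF hball_subset]])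
qed

text \<open>Exactly \<open>N ^ k - N ^ (k - 1)\<close> points have distance \<open>k\<close> from a
  given vertex; the sum is the total weight of the edges from one vertex of \<open>B n\<close> to
  \<open>B m - B n\<close>, the same for every vertex of \<open>B n\<close>.\<close>

definition shell_weight :: "real \<Rightarrow> nat \<Rightarrow> nat \<Rightarrow> real" where
  "shell_weight \<beta> n m = (\<Sum>k\<in>{n<..m}. (real N ^ k - real N ^ (k - 1)) / \<beta> ^ k)"

lemma shell_weight_Suc: "n \<le> m \<Longrightarrow> shell_weight \<beta> n (Suc m) = shell_weight \<beta> n m + (real N ^ Suc m - real N ^ m) / \<beta> ^ Suc m"
proof -
  assume "n \<le> m"
  then have "{n<..Suc m} = insert (Suc m) {n<..m}" by auto
  then show ?thesis by (simp add: shell_weight_def)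
qed

lemma hdist_shell:
  assumes "x \<in> B n" "y \<in> B (Suc n) - B n"
  shows "hdist x y = Suc n"
proof -
  have x: "x \<in> hlattice N" "\<forall>i\<ge>n. x i = 0" and y: "y \<in> hlattice N" "\<forall>i\<ge>Suc n. y i = 0"
    "\<not> (\<forall>i\<ge>n. y i = 0)" using assms by (auto simp: hball_def)
  have "hdist x y \<le> Suc n" using x y by (simp add: hdist_le_iff[of x N y])
  moreover have "\<not> hdist x y \<le> n" using x y by (simp add: hdist_le_iff[of x N y])
  ultimately show ?thesis by simp
qed

lemma sum_shells:
  assumes "x \<in> B n" "n \<le> m"
  shows "(\<Sum>y\<in>B m - B n. 1 / \<beta> ^ hdist x y) = shell_weight \<beta> n m"
  using assms(2)
proof (induction m rule: dec_induct)
  case base then show ?case by (simp add: shell_weight_def)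
next
  case (step m)
  have sub: "B n \<subseteq> B m" "B m \<subseteq> B (Suc m)" using step hball_mono by auto
  then have "B (Suc m) - B n = (B m - B n) \<union> (B (Suc m) - B m)" by auto
  then have "(\<Sum>y\<in>B (Suc m) - B n. 1 / \<beta> ^ hdist x y) = shell_weight \<beta> n m + (\<Sum>y\<in>B (Suc m) - B m. 1 / \<beta> ^ hdist x y)"
    using sub step.IH by (simp only:, subst sum.union_disjoint) auto
  also have "(\<Sum>y\<in>B (Suc m) - B m. 1 / \<beta> ^ hdist x y) = (\<Sum>y\<in>B (Suc m) - B m. 1 / \<beta> ^ Suc m)"
  proof (rule sum.cong)
    fix y assume "y \<in> B (Suc m) - B m"
    then have "hdist x y = Suc m" using hdist_shell[of x m y] assms sub by auto
    then show "1 / \<beta> ^ hdist x y = 1 / \<beta> ^ Suc m" by simp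
  qed simp
  also have "\<dots> = (real N ^ Suc m - real N ^ m) / \<beta> ^ Suc m"
    using N2 sub by (simp add: card_Diff_subset card_B of_nat_diff divide_inverse)
  finally show ?case using shell_weight_Suc step by simp
qed

text \<open>For \<open>\<beta> > N\<close>, this is the limit of \<open>shell_weight \<beta> n m\<close> for \<open>m \<rightarrow> \<infinity>\<close>.\<close>

definition rho :: "real \<Rightarrow> nat \<Rightarrow> real" where
  "rho \<beta> n = (real N - 1) / (\<beta> - real N) * (real N / \<beta>) ^ n"

lemma rho_Suc:
  assumes "real N < \<beta>"
  shows "rho \<beta> n - rho \<beta> (Suc n) = (real N ^ Suc n - real N ^ n) / \<beta> ^ Suc n"
proof -
  have "\<beta> > 0" using assms N2 by simp
  have "rho \<beta> n - rho \<beta> (Suc n) = (real N - 1) / (\<beta> - real N) * ((real N / \<beta>) ^ n) * (1 - real N / \<beta>)"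
  proof -
    have "c * A - c * (r * A) = c * A * (1 - r)" for c A r :: real by algebra
    then show ?thesis unfolding rho_def power_Suc .
  qed
  also have "1 - real N / \<beta> = (\<beta> - real N) / \<beta>" using \<open>\<beta> > 0\<close> by (simp add: field_simps)
  also have "(real N - 1) / (\<beta> - real N) * ((real N / \<beta>) ^ n) * ((\<beta> - real N) / \<beta>)
    = (real N - 1) * (real N / \<beta>) ^ n / \<beta>" using assms by simp
  also have "\<dots> = (real N ^ Suc n - real N ^ n) / \<beta> ^ Suc n"
    by (simp add: power_divide algebra_simps diff_divide_distrib)
  finally show ?thesis .
qed

lemma shell_weight_eq_rho:
  assumes "real N < \<beta>" "n \<le> m"
  shows "shell_weight \<beta> n m = rho \<beta> n - rho \<beta> m"
  using assms(2)
proof (induction m rule: dec_induct)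
  case base then show ?case by (simp add: shell_weight_def)
next
  case (step m)
  then show ?case using rho_Suc[OF assms(1), of m] by (simp add: shell_weight_Suc)
qed

lemma rho_pos: "real N < \<beta> \<Longrightarrow> 0 < rho \<beta> n"
  using N2 by (auto simp: rho_def)

lemma rho_tendsto_0: "real N < \<beta> \<Longrightarrow> rho \<beta> \<longlonglongrightarrow> 0"
proof -
  assume a: "real N < \<beta>"
  have "(\<lambda>n. (real N / \<beta>) ^ n) \<longlonglongrightarrow> 0"
    by (rule LIMSEQ_power_zero) (use a N2 in auto)
  from tendsto_mult_right_zero[OF this] show ?thesis unfolding rho_def .
qed

end

section \<open>Escape probabilities of the cluster of 0 in finite balls\<close>

lemma EE_tendsto_fun:
  assumes "\<And>\<omega>. \<omega> \<subseteq> E \<Longrightarrow> ((\<lambda>t. F t \<omega>) \<longlongrightarrow> G \<omega>) \<F>"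
  shows "((\<lambda>t. EE E p (F t)) \<longlongrightarrow> EE E p G) \<F>"
  unfolding EE_def by (intro tendsto_intros assms) auto

definition between :: "'v set \<Rightarrow> 'v set \<Rightarrow> 'v set set" where
  "between A D = (\<lambda>(u, v). {u, v}) ` (A \<times> D)"

lemma inj_on_between: "A \<inter> D = {} \<Longrightarrow> inj_on (\<lambda>(u, v). {u, v}) (A \<times> D)"
  by (auto simp: inj_on_def doubleton_eq_iff)

lemma finite_between: "finite A \<Longrightarrow> finite D \<Longrightarrow> finite (between A D)"
  by (simp add: between_def)

lemma between_subset_edges: "A \<inter> D = {} \<Longrightarrow> A \<subseteq> V \<Longrightarrow> D \<subseteq> V \<Longrightarrow> between A D \<subseteq> edges V"
  by (auto simp: between_def)

lemma between_disjoint_iff: "\<omega> \<inter> between A D = {} \<longleftrightarrow> (\<forall>u\<in>A. \<forall>v\<in>D. {u, v} \<notin> \<omega>)"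
  by (auto simp: between_def)

lemma between_disjoint_edges: "V \<inter> D = {} \<Longrightarrow> between A D \<inter> edges V = {}"
  by (auto simp: between_def)

lemma exp_sum_real: "exp (sum f A) = (\<Prod>x\<in>A. exp (f x :: real))" if "finite A"
  using that by (induction A rule: finite_induct) (auto simp: exp_add)

lemma prod_between:
  assumes "finite A" "finite D" "A \<inter> D = {}"
  shows "(\<Prod>e\<in>between A D. 1 - edge_prob \<alpha> \<beta> e)
    = exp (- \<alpha> * (\<Sum>u\<in>A. \<Sum>v\<in>D. 1 / \<beta> ^ hdist u v))"
proof -
  have "(\<Prod>e\<in>between A D. 1 - edge_prob \<alpha> \<beta> e) = (\<Prod>(u, v)\<in>A \<times> D. exp (- \<alpha> / \<beta> ^ hdist u v))"
    unfolding between_def by (subst prod.reindex[OF inj_on_between[OF assms(3)]])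
      (auto simp: edge_prob_def pair_dist_doubleton intro!: prod.cong)
  also have "\<dots> = exp (\<Sum>(u, v)\<in>A \<times> D. - \<alpha> / \<beta> ^ hdist u v)"
    using assms by (subst exp_sum_real) (auto intro!: prod.cong)
  also have "(\<Sum>(u, v)\<in>A \<times> D. - \<alpha> / \<beta> ^ hdist u v) = - \<alpha> * (\<Sum>u\<in>A. \<Sum>v\<in>D. 1 / \<beta> ^ hdist u v)"
    unfolding sum_distrib_left sum.cartesian_product by (intro sum.cong) auto
  finally show ?thesis .
qed

context hierarchical
begin

abbreviation C :: "nat \<Rightarrow> (nat \<Rightarrow> nat) set set \<Rightarrow> (nat \<Rightarrow> nat) set" where
  "C n \<omega> \<equiv> cl (\<omega> \<inter> edges (B n)) (\<lambda>_. 0)"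

abbreviation exits :: "nat \<Rightarrow> nat \<Rightarrow> (nat \<Rightarrow> nat) set set \<Rightarrow> bool" where
  "exits n m \<omega> \<equiv> \<exists>u\<in>C n \<omega>. \<exists>v\<in>B m - B n. {u, v} \<in> \<omega>"

abbreviation PB :: "nat \<Rightarrow> real \<Rightarrow> real \<Rightarrow> ((nat \<Rightarrow> nat) set set \<Rightarrow> real) \<Rightarrow> real" where
  "PB n \<alpha> \<beta> \<equiv> EE (edges (B n)) (edge_prob \<alpha> \<beta>)"

definition escape_prob :: "real \<Rightarrow> real \<Rightarrow> nat \<Rightarrow> real" where
  "escape_prob \<alpha> \<beta> n = 1 - PB n \<alpha> \<beta> (\<lambda>\<omega>. exp (- \<alpha> * rho \<beta> n * card (C n \<omega>)))"

lemma finite_edges_B [simp]: "finite (edges (B n))"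
  by (rule finite_edges) simp

lemma C_subset: "C n \<omega> \<subseteq> B n"
  by (rule cl_subset) (use edges_subset_Pow in auto)

lemma finite_C [simp]: "finite (C n \<omega>)"
  using C_subset finite_B finite_subset by blast

lemma card_C_pos: "1 \<le> card (C n \<omega>)"
proof -
  have "(\<lambda>_. 0) \<in> C n \<omega>" by (rule cl_refl)
  then have "C n \<omega> \<noteq> {}" by blast
  then show ?thesis by (simp add: Suc_le_eq card_gt_0_iff)
qed

lemma card_C_le: "card (C n \<omega>) \<le> N ^ n"
  using card_mono[OF finite_B C_subset] by (simp add: card_B)

lemma not_exits_imp_C_eq:
  assumes "n \<le> m" "\<not> exits n m \<omega>"
  shows "C m \<omega> = C n \<omega>"
proof -
  have sub: "edges (B n) \<subseteq> edges (B m)" using assms by (intro edges_mono hball_mono)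
  then have eq: "\<omega> \<inter> edges (B m) \<inter> edges (B n) = \<omega> \<inter> edges (B n)" by auto
  have in_B: "C m \<omega> \<subseteq> B n"
  proof (rule ccontr)
    assume "\<not> C m \<omega> \<subseteq> B n"
    from cl_exit[OF zero_in_B this]
    show False using assms(2) unfolding eq by auto
  qed
  have "C n \<omega> = C m \<omega>"
  proof (rule cl_eqI)
    fix u v assume u: "u \<in> C m \<omega>"
    show "{u, v} \<in> \<omega> \<inter> edges (B m) \<longleftrightarrow> {u, v} \<in> \<omega> \<inter> edges (B n)"
    proof
      assume uv: "{u, v} \<in> \<omega> \<inter> edges (B m)"
      then have "v \<in> C m \<omega>" using cl_step[OF u] by blast
      then show "{u, v} \<in> \<omega> \<inter> edges (B n)" using uv u in_B by auto
    qed (use sub in blast)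
  qed
  then show ?thesis ..
qed

lemma sum_shells_C: "n \<le> m \<Longrightarrow> (\<Sum>u\<in>C n \<omega>. \<Sum>v\<in>B m - B n. 1 / \<beta> ^ hdist u v) = card (C n \<omega>) * shell_weight \<beta> n m"
  using sum_shells C_subset by (simp add: subset_iff)

text \<open>Once the edges inside \<open>B n\<close> are revealed, the cluster is a fixed set and
  the edges from it to the shells are independent of what was revealed; every vertex contributes the
  same weight. The factor \<open>G\<close> carries a second exponential along, as
  \<open>escape_prob_diff\<close> requires.\<close>

lemma EE_not_exits:
  assumes "n \<le> m"
  shows "PB m \<alpha> \<beta> (\<lambda>\<omega>. of_bool (\<not> exits n m \<omega>) * G (C n \<omega>))
    = PB n \<alpha> \<beta> (\<lambda>\<omega>. exp (- \<alpha> * shell_weight \<beta> n m * card (C n \<omega>)) * G (C n \<omega>))"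
proof -
  let ?J = "edges (B n)" and ?E = "edges (B m)"
  have BB: "B n \<subseteq> B m" by (rule hball_mono[OF assms])
  have sub: "?J \<subseteq> ?E" by (rule edges_mono[OF BB])
  have "PB m \<alpha> \<beta> (\<lambda>\<omega>. of_bool (\<not> exits n m \<omega>) * G (C n \<omega>))
    = EE ?J (edge_prob \<alpha> \<beta>) (\<lambda>a. EE (?E - ?J) (edge_prob \<alpha> \<beta>)
        (\<lambda>b. of_bool (\<not> exits n m (a \<union> b)) * G (C n (a \<union> b))))"
    by (rule EE_split[OF finite_edges_B sub])
  also have "\<dots> = EE ?J (edge_prob \<alpha> \<beta>) (\<lambda>a. exp (- \<alpha> * shell_weight \<beta> n m * card (C n a)) * G (C n a))"
  proof (intro EE_cong refl)
    fix a assume a: "a \<subseteq> ?J"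
    let ?T = "between (C n a) (B m - B n)"
    have dis: "C n a \<inter> (B m - B n) = {}" using C_subset by blast
    have T: "?T \<subseteq> ?E - ?J"
    proof -
      have "C n a \<subseteq> B m" using C_subset BB by (rule subset_trans)
      then have "?T \<subseteq> ?E" using dis by (intro between_subset_edges) auto
      moreover have "?T \<inter> ?J = {}" by (rule between_disjoint_edges) auto
      ultimately show ?thesis by auto
    qed
    have "EE (?E - ?J) (edge_prob \<alpha> \<beta>) (\<lambda>b. of_bool (\<not> exits n m (a \<union> b)) * G (C n (a \<union> b)))
      = EE (?E - ?J) (edge_prob \<alpha> \<beta>) (\<lambda>b. of_bool (b \<inter> ?T = {}) * G (C n a))"
    proof (intro EE_cong refl)
      fix b assume b: "b \<subseteq> ?E - ?J"
      have "(a \<union> b) \<inter> ?J = a \<inter> ?J" using a b by auto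
      then have Cab: "C n (a \<union> b) = C n a" by simp
      have "{u, v} \<notin> a" if "v \<in> B m - B n" for u v using a that by auto
      then have "exits n m (a \<union> b) \<longleftrightarrow> b \<inter> ?T \<noteq> {}"
        unfolding Cab between_disjoint_iff by blast
      then show "of_bool (\<not> exits n m (a \<union> b)) * G (C n (a \<union> b)) = of_bool (b \<inter> ?T = {}) * G (C n a)"
        by (simp add: Cab)
    qed
    also have "\<dots> = (\<Prod>e\<in>?T. 1 - edge_prob \<alpha> \<beta> e) * G (C n a)"
      unfolding EE_cmult_right by (subst EE_all_closed) (use T in auto)
    also have "(\<Prod>e\<in>?T. 1 - edge_prob \<alpha> \<beta> e) = exp (- \<alpha> * shell_weight \<beta> n m * card (C n a))"
      using prod_between[OF finite_C _ dis] sum_shells_C[OF assms] by (simp add: mult_ac)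
    finally show "EE (?E - ?J) (edge_prob \<alpha> \<beta>) (\<lambda>b. of_bool (\<not> exits n m (a \<union> b)) * G (C n (a \<union> b)))
      = exp (- \<alpha> * shell_weight \<beta> n m * card (C n a)) * G (C n a)" .
  qed
  finally show ?thesis .
qed

lemma prob_exits:
  assumes "n \<le> m"
  shows "PB m \<alpha> \<beta> (\<lambda>\<omega>. of_bool (exits n m \<omega>)) = 1 - PB n \<alpha> \<beta> (\<lambda>\<omega>. exp (- \<alpha> * shell_weight \<beta> n m * card (C n \<omega>)))"
proof -
  have "PB m \<alpha> \<beta> (\<lambda>\<omega>. of_bool (exits n m \<omega>)) = PB m \<alpha> \<beta> (\<lambda>\<omega>. 1 - of_bool (\<not> exits n m \<omega>) * 1)"
    by (intro EE_cong refl) auto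
  also have "\<dots> = 1 - PB m \<alpha> \<beta> (\<lambda>\<omega>. of_bool (\<not> exits n m \<omega>) * 1)"
    by (subst EE_diff) (simp add: EE_const)
  also have "PB m \<alpha> \<beta> (\<lambda>\<omega>. of_bool (\<not> exits n m \<omega>) * 1)
     = PB n \<alpha> \<beta> (\<lambda>\<omega>. exp (- \<alpha> * shell_weight \<beta> n m * card (C n \<omega>)) * 1)"
    using EE_not_exits[OF assms, of \<alpha> \<beta> "\<lambda>_. 1"] .
  finally show ?thesis by simp
qed

text \<open>The difference is the probability of leaving \<open>B n\<close> inside
  \<open>B m\<close> and then not leaving \<open>B m\<close>: without an exit into
  \<open>B m - B n\<close> the two clusters coincide, and the weights add up,
  \<open>shell_weight \<beta> n m + rho \<beta> m = rho \<beta> n\<close>.\<close>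

lemma escape_prob_diff:
  assumes "real N < \<beta>" "n \<le> m"
  shows "escape_prob \<alpha> \<beta> n - escape_prob \<alpha> \<beta> m = PB m \<alpha> \<beta> (\<lambda>\<omega>. of_bool (exits n m \<omega>) * exp (- \<alpha> * rho \<beta> m * card (C m \<omega>)))"
    (is "_ = ?R")
proof -
  have "1 - escape_prob \<alpha> \<beta> m = PB m \<alpha> \<beta> (\<lambda>\<omega>. exp (- \<alpha> * rho \<beta> m * card (C m \<omega>)))" by (simp add: escape_prob_def)
  also have "\<dots> = PB m \<alpha> \<beta> (\<lambda>\<omega>. of_bool (exits n m \<omega>) * exp (- \<alpha> * rho \<beta> m * card (C m \<omega>))
      + of_bool (\<not> exits n m \<omega>) * exp (- \<alpha> * rho \<beta> m * card (C n \<omega>)))"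
  proof (intro EE_cong refl)
    fix \<omega>
    show "exp (- \<alpha> * rho \<beta> m * card (C m \<omega>)) = of_bool (exits n m \<omega>) * exp (- \<alpha> * rho \<beta> m * card (C m \<omega>))
      + of_bool (\<not> exits n m \<omega>) * exp (- \<alpha> * rho \<beta> m * card (C n \<omega>))"
      using not_exits_imp_C_eq[OF assms(2), of \<omega>] by (cases "exits n m \<omega>") simp_all
  qed
  also have "\<dots> = ?R + PB n \<alpha> \<beta> (\<lambda>\<omega>. exp (- \<alpha> * shell_weight \<beta> n m * card (C n \<omega>)) * exp (- \<alpha> * rho \<beta> m * card (C n \<omega>)))"
    unfolding EE_add using EE_not_exits[OF assms(2), of \<alpha> \<beta> "\<lambda>S. exp (- \<alpha> * rho \<beta> m * card S)"] by simp
  also have "(\<lambda>\<omega>. exp (- \<alpha> * shell_weight \<beta> n m * card (C n \<omega>)) * exp (- \<alpha> * rho \<beta> m * card (C n \<omega>)))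
    = (\<lambda>\<omega>. exp (- \<alpha> * rho \<beta> n * card (C n \<omega>)))"
    unfolding shell_weight_eq_rho[OF assms] mult_exp_exp by (simp add: algebra_simps)
  finally show ?thesis by (simp add: escape_prob_def)
qed

lemma PB_le:
  assumes "0 \<le> \<alpha>" "0 < \<beta>" "\<And>\<omega>. \<omega> \<subseteq> edges (B n) \<Longrightarrow> F \<omega> \<le> G \<omega>"
  shows "PB n \<alpha> \<beta> F \<le> PB n \<alpha> \<beta> G"
  using assms by (intro EE_mono) (auto simp: edge_prob_bounds)

lemma escape_prob_bounds:
  assumes "0 \<le> \<alpha>" "real N < \<beta>"
  shows "0 \<le> escape_prob \<alpha> \<beta> n" "escape_prob \<alpha> \<beta> n \<le> 1"
proof -
  have b: "0 < \<beta>" using assms N2 by simp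
  have "PB n \<alpha> \<beta> (\<lambda>\<omega>. exp (- \<alpha> * rho \<beta> n * card (C n \<omega>))) \<le> PB n \<alpha> \<beta> (\<lambda>_. 1)"
    using rho_pos[OF assms(2), of n] assms(1) by (intro PB_le assms b) auto
  then show "0 \<le> escape_prob \<alpha> \<beta> n" by (simp add: escape_prob_def EE_const)
  have "PB n \<alpha> \<beta> (\<lambda>_. 0) \<le> PB n \<alpha> \<beta> (\<lambda>\<omega>. exp (- \<alpha> * rho \<beta> n * card (C n \<omega>)))"
    by (intro PB_le assms b) auto
  then show "escape_prob \<alpha> \<beta> n \<le> 1" by (simp add: escape_prob_def EE_const)
qed

lemma escape_prob_antimono:
  assumes "0 \<le> \<alpha>" "real N < \<beta>" "n \<le> m"
  shows "escape_prob \<alpha> \<beta> m \<le> escape_prob \<alpha> \<beta> n"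
proof -
  have "0 < \<beta>" using assms N2 by simp
  then have "PB m \<alpha> \<beta> (\<lambda>_. 0) \<le> PB m \<alpha> \<beta> (\<lambda>\<omega>. of_bool (exits n m \<omega>) * exp (- \<alpha> * rho \<beta> m * card (C m \<omega>)))"
    using assms by (intro PB_le) auto
  then show ?thesis using escape_prob_diff[OF assms(2,3), of \<alpha>] by (simp add: EE_const)
qed

text \<open>A cluster of size at most \<open>L\<close> in \<open>B n\<close> dies out with probability at least
  \<open>exp (- \<alpha> * rho \<beta> n * L)\<close>, but only an amount \<open>escape_prob \<alpha> \<beta> m - escape_prob \<alpha> \<beta> n\<close> of mass is lost.\<close>

lemma escape_prob_le_large_cluster:
  fixes \<alpha> \<beta> :: real
  assumes "0 \<le> \<alpha>" "real N < \<beta>" "m \<le> n"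
  shows "escape_prob \<alpha> \<beta> m \<le> PB n \<alpha> \<beta> (\<lambda>\<omega>. of_bool (L < card (C n \<omega>)))
    + exp (\<alpha> * rho \<beta> n * L) * (escape_prob \<alpha> \<beta> m - escape_prob \<alpha> \<beta> n) + real (N ^ m) * \<alpha> * rho \<beta> n"
proof -
  have b: "0 < \<beta>" using assms N2 by simp
  have r: "0 < rho \<beta> n" by (rule rho_pos[OF assms(2)])
  have "PB n \<alpha> \<beta> (\<lambda>\<omega>. of_bool (exits m n \<omega>))
    \<le> PB n \<alpha> \<beta> (\<lambda>\<omega>. of_bool (L < card (C n \<omega>))
       + exp (\<alpha> * rho \<beta> n * L) * (of_bool (exits m n \<omega>) * exp (- \<alpha> * rho \<beta> n * card (C n \<omega>))))"
  proof (intro PB_le assms b)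
    fix \<omega>
    have "1 \<le> exp (\<alpha> * rho \<beta> n * L) * exp (- \<alpha> * rho \<beta> n * card (C n \<omega>))" if "card (C n \<omega>) \<le> L"
    proof -
      have "\<alpha> * rho \<beta> n * card (C n \<omega>) \<le> \<alpha> * rho \<beta> n * L" using that assms(1) r by (intro mult_left_mono) auto
      then show ?thesis unfolding mult_exp_exp by simp
    qed
    then show "of_bool (exits m n \<omega>) \<le> of_bool (L < card (C n \<omega>))
       + exp (\<alpha> * rho \<beta> n * L) * (of_bool (exits m n \<omega>) * exp (- \<alpha> * rho \<beta> n * card (C n \<omega>)))"
      by (cases "L < card (C n \<omega>)"; cases "exits m n \<omega>") simp_all
  qed
  also have "\<dots> = PB n \<alpha> \<beta> (\<lambda>\<omega>. of_bool (L < card (C n \<omega>)))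
    + exp (\<alpha> * rho \<beta> n * L) * (escape_prob \<alpha> \<beta> m - escape_prob \<alpha> \<beta> n)"
    unfolding EE_add EE_cmult escape_prob_diff[OF assms(2,3)] ..
  finally have 1: "PB n \<alpha> \<beta> (\<lambda>\<omega>. of_bool (exits m n \<omega>)) \<le> \<dots>" .
  \<comment> \<open>\<open>escape_prob \<alpha> \<beta> m\<close> also counts edges from the cluster
    in \<open>B m\<close> to points outside \<open>B n\<close>; their expected number is at most
    \<open>real (N ^ m) * \<alpha> * rho \<beta> n\<close>, the error term.\<close>
  have "PB m \<alpha> \<beta> (\<lambda>\<omega>. exp (- \<alpha> * shell_weight \<beta> m n * card (C m \<omega>)))
    \<le> PB m \<alpha> \<beta> (\<lambda>\<omega>. exp (- \<alpha> * rho \<beta> m * card (C m \<omega>)) + real (N ^ m) * \<alpha> * rho \<beta> n)"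
  proof (intro PB_le assms b)
    fix \<omega>
    let ?c = "real (card (C m \<omega>))"
    have cle: "?c \<le> real (N ^ m)" using card_C_le by (simp only: of_nat_le_iff)
    have nn: "0 \<le> shell_weight \<beta> m n"
      unfolding shell_weight_def using b N2 by (intro sum_nonneg divide_nonneg_nonneg) (auto intro!: power_increasing)
    let ?t = "\<alpha> * rho \<beta> n * ?c"
    have t0: "0 \<le> ?t" using assms(1) r by simp
    have "exp (- \<alpha> * shell_weight \<beta> m n * ?c) - exp (- \<alpha> * rho \<beta> m * ?c) = exp (- \<alpha> * shell_weight \<beta> m n * ?c) * (1 - exp (- ?t))"
      unfolding right_diff_distrib mult_exp_exp shell_weight_eq_rho[OF assms(2,3)] by (simp add: algebra_simps)
    also have "\<dots> \<le> 1 * ?t"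
    proof (rule mult_mono)
      show "exp (- \<alpha> * shell_weight \<beta> m n * ?c) \<le> 1" using nn assms(1) by simp
      show "1 - exp (- ?t) \<le> ?t" using exp_ge_add_one_self[of "- ?t"] by linarith
    qed (use t0 in auto)
    also have "\<dots> \<le> real (N ^ m) * \<alpha> * rho \<beta> n"
      using mult_left_mono[OF cle, of "\<alpha> * rho \<beta> n"] assms(1) r by (simp add: mult_ac)
    finally show "exp (- \<alpha> * shell_weight \<beta> m n * ?c) \<le> exp (- \<alpha> * rho \<beta> m * ?c) + real (N ^ m) * \<alpha> * rho \<beta> n" by simp
  qed
  then show ?thesis
    using 1 unfolding prob_exits[OF assms(3)] by (simp add: escape_prob_def EE_add EE_const)
qed

end

section \<open>From the infinite lattice to finite balls\<close>

lemma product_prob_space_percolation: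
  "product_prob_space (\<lambda>e. measure_pmf (bernoulli_pmf (edge_prob \<alpha> \<beta> e)))"
  by (intro product_prob_spaceI measure_pmf.prob_space_axioms)

lemma prob_space_percolation: "prob_space (percolation N \<alpha> \<beta>)"
  unfolding percolation_def by (rule prob_space_PiM) (rule measure_pmf.prob_space_axioms)

text \<open>An event on finitely many edges is a finite disjoint union of cylinders, whose
  probabilities are the products in \<open>EE\<close>; this is the bridge from the infinite product
  measure to \<open>EE\<close>.\<close>

lemma percolation_finite:
  assumes E: "finite E" "E \<subseteq> hpairs N" and ab: "0 \<le> \<alpha>" "0 < \<beta>"
  defines "M \<equiv> percolation N \<alpha> \<beta>"
  shows "{\<omega> \<in> space M. Q {e \<in> E. \<omega> e}} \<in> sets M" (is ?S)
    and "measure M {\<omega> \<in> space M. Q {e \<in> E. \<omega> e}}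
      = EE E (edge_prob \<alpha> \<beta>) (\<lambda>\<omega>. of_bool (Q \<omega>))" (is ?M)
proof -
  interpret pr: product_prob_space "\<lambda>e. measure_pmf (bernoulli_pmf (edge_prob \<alpha> \<beta> e))" "hpairs N"
    by (rule product_prob_space_percolation)
  interpret prob_space M unfolding M_def by (rule prob_space_percolation)
  \<comment> \<open>\<open>{e \<in> S}\<close> is the singleton of a truth value: the condition says
    that \<open>\<omega> e\<close> agrees with membership of \<open>e\<close> in
    \<open>S\<close>.\<close>
  define A where "A = (\<lambda>S. {\<omega> \<in> space M. \<forall>e\<in>E. \<omega> e \<in> {e \<in> S}})"
  have A_eq: "A S = {\<omega> \<in> space M. {e \<in> E. \<omega> e} = S}" if "S \<subseteq> E" for S
    using that by (auto simp: A_def)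
  have A_sets: "A S \<in> sets M" for S
  proof -
    have "{\<omega> \<in> space M. \<forall>e\<in>E. \<omega> e \<in> X e} \<in> sets M" for X
    proof (rule sets.sets_Collect_finite_All[OF _ E(1)])
      fix e assume "e \<in> E"
      then have e: "e \<in> hpairs N" using E by auto
      have "(\<lambda>\<omega>. \<omega> e) -` X e \<inter> space M \<in> sets M"
        unfolding M_def percolation_def
        by (rule measurable_sets[OF measurable_component_singleton[OF e]]) simp
      then show "{\<omega> \<in> space M. \<omega> e \<in> X e} \<in> sets M"
        by (simp add: vimage_def Int_def conj_commute)
    qed
    then show ?thesis unfolding A_def .
  qed
  have A_measure: "measure M (A S) = (\<Prod>e\<in>S. edge_prob \<alpha> \<beta> e) * (\<Prod>e\<in>E - S. 1 - edge_prob \<alpha> \<beta> e)"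
    if S: "S \<subseteq> E" for S
  proof -
    let ?b = "\<lambda>e. measure_pmf (bernoulli_pmf (edge_prob \<alpha> \<beta> e))"
    have "emeasure M (A S) = (\<Prod>e\<in>E. emeasure (?b e) {e \<in> S})"
      unfolding M_def percolation_def A_def using E
      by (intro pr.emeasure_PiM_Collect) auto
    also have "\<dots> = (\<Prod>e\<in>E. ennreal (measure (?b e) {e \<in> S}))"
      by (simp add: measure_pmf.emeasure_eq_measure)
    also have "\<dots> = ennreal (\<Prod>e\<in>E. measure (?b e) {e \<in> S})"
      by (rule prod_ennreal) simp
    finally have "measure M (A S) = (\<Prod>e\<in>E. measure (?b e) {e \<in> S})"
      by (simp add: measure_def prod_nonneg)
    also have "\<dots> = (\<Prod>e\<in>E. if e \<in> S then edge_prob \<alpha> \<beta> e else 1 - edge_prob \<alpha> \<beta> e)"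
      using ab edge_prob_bounds[OF ab] by (intro prod.cong) (auto simp: measure_pmf_single)
    also have "\<dots> = (\<Prod>e\<in>S. edge_prob \<alpha> \<beta> e) * (\<Prod>e\<in>E - S. 1 - edge_prob \<alpha> \<beta> e)"
    proof -
      have "E \<inter> {e. e \<in> S} = S" "E \<inter> - {e. e \<in> S} = E - S" using S by auto
      then show ?thesis by (subst prod.If_cases[OF E(1)]) simp
    qed
    finally show ?thesis .
  qed
  let ?I = "{S \<in> Pow E. Q S}"
  have U: "{\<omega> \<in> space M. Q {e \<in> E. \<omega> e}} = (\<Union>S\<in>?I. A S)"
    using A_eq by auto
  have fin: "finite ?I" using E by auto
  show ?S unfolding U using fin A_sets by (intro sets.finite_UN) auto
  have "measure M (\<Union>S\<in>?I. A S) = (\<Sum>S\<in>?I. measure M (A S))"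
  proof (rule finite_measure_finite_Union[OF fin])
    show "disjoint_family_on A ?I" unfolding disjoint_family_on_def using A_eq by auto
  qed (use A_sets in auto)
  also have "\<dots> = (\<Sum>S\<in>?I. (\<Prod>e\<in>S. edge_prob \<alpha> \<beta> e) * (\<Prod>e\<in>E - S. 1 - edge_prob \<alpha> \<beta> e))"
    using A_measure by (intro sum.cong) auto
  also have "\<dots> = EE E (edge_prob \<alpha> \<beta>) (\<lambda>\<omega>. of_bool (Q \<omega>))"
    unfolding EE_def using E by (intro sum.mono_neutral_cong_left) auto
  finally show ?M unfolding U .
qed

context hierarchical
begin

lemma B_mono: "n \<le> m \<Longrightarrow> B n \<subseteq> B m"
  by (rule hball_mono)

lemma finite_subset_B:
  assumes "finite S" "S \<subseteq> hlattice N"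
  shows "\<exists>n. S \<subseteq> B n"
proof -
  have "\<forall>x\<in>S. \<exists>n. x \<in> B n" using assms hlattice_UN_B by auto
  then obtain f where f: "\<And>x. x \<in> S \<Longrightarrow> x \<in> B (f x)" by metis
  have "x \<in> B (Max (f ` S))" if "x \<in> S" for x
    using f[OF that] B_mono[of "f x" "Max (f ` S)"] assms(1) that by auto
  then show ?thesis by auto
qed

context
  fixes \<alpha> \<beta> :: real
  assumes ab: "0 \<le> \<alpha>" "0 < \<beta>"
begin

abbreviation "perc \<equiv> percolation N \<alpha> \<beta>"

definition open_edges :: "((nat \<Rightarrow> nat) set \<Rightarrow> bool) \<Rightarrow> (nat \<Rightarrow> nat) set set" where
  "open_edges \<omega> = {e \<in> hpairs N. \<omega> e}"

lemma cluster_eq_cl: "cluster N \<omega> x = cl (open_edges \<omega>) x"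
  by (simp add: cluster_def cl_def open_adj_def adj_def open_edges_def)

text \<open>Cut down to the edges of \<open>B m\<close>, the event depends on finitely many edges
  and is accessible to \<open>percolation_finite\<close>.\<close>

definition exit_event :: "nat \<Rightarrow> nat \<Rightarrow> ((nat \<Rightarrow> nat) set \<Rightarrow> bool) set" where
  "exit_event n m = {\<omega> \<in> space perc. exits n m {e \<in> edges (B m). \<omega> e}}"

lemma open_edges_Int_edges: "open_edges \<omega> \<inter> edges (B m) = {e \<in> edges (B m). \<omega> e}"
  using edges_mono[OF hball_subset[of m "\<lambda>_. 0"]] by (auto simp: open_edges_def hpairs_eq)

lemma exit_event_sets: "exit_event n m \<in> sets perc"
  unfolding exit_event_def using edges_mono[OF hball_subset] ab
  by (intro percolation_finite) (auto simp: hpairs_eq)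

lemma measure_exit_event:
  assumes "n \<le> m"
  shows "measure perc (exit_event n m) = 1 - PB n \<alpha> \<beta> (\<lambda>\<omega>. exp (- \<alpha> * shell_weight \<beta> n m * card (C n \<omega>)))"
  unfolding prob_exits[OF assms, symmetric] exit_event_def using edges_mono[OF hball_subset] ab
  by (subst percolation_finite) (auto simp: hpairs_eq)

lemma exits_iff_exit_event:
  assumes "n \<le> m" "\<omega> \<in> space perc"
  shows "\<omega> \<in> exit_event n m \<longleftrightarrow> (\<exists>u\<in>C n (open_edges \<omega>). \<exists>v\<in>B m - B n. {u, v} \<in> open_edges \<omega>)"
proof -
  have sub: "edges (B n) \<subseteq> edges (B m)" by (rule edges_mono[OF B_mono[OF assms(1)]])
  have "open_edges \<omega> \<inter> edges (B m) \<inter> edges (B n) = open_edges \<omega> \<inter> edges (B n)" using sub by auto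
  then have Ceq: "C n (open_edges \<omega> \<inter> edges (B m)) = C n (open_edges \<omega>)" by simp
  have uv: "{u, v} \<in> open_edges \<omega> \<inter> edges (B m) \<longleftrightarrow> {u, v} \<in> open_edges \<omega>" if "u \<in> C n (open_edges \<omega>)" "v \<in> B m - B n" for u v
  proof -
    have "u \<in> B n" using that C_subset by blast
    then have "u \<in> B m" "u \<noteq> v" using that B_mono[OF assms(1)] by auto
    then show ?thesis using that by auto
  qed
  show ?thesis
    unfolding exit_event_def open_edges_Int_edges[symmetric] mem_Collect_eq Ceq using uv assms(2) by blast
qed

lemma UN_exit_event:
  "(\<Union>k. exit_event n (n + k)) = {\<omega> \<in> space perc. \<not> cl (open_edges \<omega>) (\<lambda>_. 0) \<subseteq> B n}"
proof (intro equalityI subsetI)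
  fix \<omega> assume "\<omega> \<in> (\<Union>k. exit_event n (n + k))"
  then obtain k where k: "\<omega> \<in> exit_event n (n + k)" by auto
  then have sp: "\<omega> \<in> space perc" by (simp add: exit_event_def)
  obtain u v where uv: "u \<in> C n (open_edges \<omega>)" "v \<in> B (n + k) - B n" "{u, v} \<in> open_edges \<omega>"
    using k exits_iff_exit_event[of n "n + k" \<omega>] sp by auto
  have "u \<in> cl (open_edges \<omega>) (\<lambda>_. 0)" using uv cl_mono[of "open_edges \<omega> \<inter> edges (B n)" "open_edges \<omega>"] by auto
  then have "v \<in> cl (open_edges \<omega>) (\<lambda>_. 0)" using uv(3) by (rule cl_step)
  then show "\<omega> \<in> {\<omega> \<in> space perc. \<not> cl (open_edges \<omega>) (\<lambda>_. 0) \<subseteq> B n}" using uv sp by auto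
next
  fix \<omega> assume w: "\<omega> \<in> {\<omega> \<in> space perc. \<not> cl (open_edges \<omega>) (\<lambda>_. 0) \<subseteq> B n}"
  then have sp: "\<omega> \<in> space perc" and nsub: "\<not> cl (open_edges \<omega>) (\<lambda>_. 0) \<subseteq> B n" by auto
  from cl_exit[OF zero_in_B nsub] obtain u v where
    uv: "u \<in> C n (open_edges \<omega>)" "v \<notin> B n" "{u, v} \<in> open_edges \<omega>" by blast
  then have "v \<in> hlattice N" by (auto simp: open_edges_def hpairs_eq)
  then obtain m where "v \<in> B m" using hlattice_UN_B by auto
  then have "v \<in> B (n + m)" using B_mono[of m "n + m"] by auto
  then show "\<omega> \<in> (\<Union>k. exit_event n (n + k))" using uv exits_iff_exit_event[of n "n + m" \<omega>] sp by auto
qed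

lemma exit_event_incseq: "incseq (\<lambda>k. exit_event n (n + k))"
proof (rule incseq_SucI, rule subsetI)
  fix k \<omega> assume w: "\<omega> \<in> exit_event n (n + k)"
  then have sp: "\<omega> \<in> space perc" by (simp add: exit_event_def)
  then show "\<omega> \<in> exit_event n (n + Suc k)"
    using w exits_iff_exit_event[of n "n + k" \<omega>] exits_iff_exit_event[of n "n + Suc k" \<omega>] B_mono[of "n + k" "n + Suc k"]
    by (auto; blast)
qed

text \<open>Balls are finite and exhaust the lattice, so a cluster is infinite iff no ball contains
  it; continuity of the measure from above does the rest.\<close>

lemma theta_LIMSEQ:
  "(\<lambda>n. measure perc (\<Union>k. exit_event n (n + k))) \<longlonglongrightarrow> theta N \<alpha> \<beta>"
proof -
  interpret prob_space perc by (rule prob_space_percolation)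
  have "(\<Inter>n. \<Union>k. exit_event n (n + k)) = {\<omega> \<in> space perc. infinite (cluster N \<omega> (\<lambda>_. 0))}"
  proof -
    have "infinite (cl (open_edges \<omega>) (\<lambda>_. 0)) \<longleftrightarrow> (\<forall>n. \<not> cl (open_edges \<omega>) (\<lambda>_. 0) \<subseteq> B n)" for \<omega>
    proof -
      have "cl (open_edges \<omega>) (\<lambda>_. 0) \<subseteq> hlattice N"
        by (rule cl_subset) (use edges_subset_Pow in \<open>auto simp: open_edges_def hpairs_eq\<close>)
      then have "finite (cl (open_edges \<omega>) (\<lambda>_. 0)) \<longleftrightarrow> (\<exists>n. cl (open_edges \<omega>) (\<lambda>_. 0) \<subseteq> B n)"
        by (metis finite_subset_B finite_subset finite_B)
      then show ?thesis by simp
    qed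
    then show ?thesis unfolding UN_exit_event cluster_eq_cl by auto
  qed
  moreover have "decseq (\<lambda>n. \<Union>k. exit_event n (n + k))"
    unfolding UN_exit_event decseq_def
  proof (intro allI impI subsetI)
    fix m n \<omega> assume "m \<le> n" "\<omega> \<in> {\<omega> \<in> space perc. \<not> cl (open_edges \<omega>) (\<lambda>_. 0) \<subseteq> B n}"
    then show "\<omega> \<in> {\<omega> \<in> space perc. \<not> cl (open_edges \<omega>) (\<lambda>_. 0) \<subseteq> B m}"
      using subset_trans[OF _ B_mono[OF \<open>m \<le> n\<close>]] by simp blast
  qed
  moreover have "range (\<lambda>n. \<Union>k. exit_event n (n + k)) \<subseteq> sets perc" using exit_event_sets by auto
  ultimately show ?thesis
    using finite_Lim_measure_decseq[of "\<lambda>n. \<Union>k. exit_event n (n + k)"] by (simp add: theta_def)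
qed

text \<open>The finite shell weights are kept here because they diverge for \<beta> \<le> N and
  converge to \<open>rho\<close> differences for \<beta> > N; both regimes start from this
  limit.\<close>

lemma measure_UN_exit_event:
  "(\<lambda>k. 1 - PB n \<alpha> \<beta> (\<lambda>\<omega>. exp (- \<alpha> * shell_weight \<beta> n (n + k) * card (C n \<omega>))))
    \<longlonglongrightarrow> measure perc (\<Union>k. exit_event n (n + k))"
proof -
  interpret prob_space perc by (rule prob_space_percolation)
  have "(\<lambda>k. measure perc (exit_event n (n + k))) \<longlonglongrightarrow> measure perc (\<Union>k. exit_event n (n + k))"
    using exit_event_sets exit_event_incseq by (intro finite_Lim_measure_incseq) auto
  then show ?thesis by (simp add: measure_exit_event)
qed

end

text \<open>In a fixed ball the limit of the shell weights may be taken inside the finite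
  expectation, so \<open>escape_prob \<alpha> \<beta> n\<close> is exactly the probability that the
  cluster of 0 in the whole lattice leaves \<open>B n\<close>.\<close>

lemma escape_prob_LIMSEQ_theta:
  assumes "0 \<le> \<alpha>" "real N < \<beta>"
  shows "escape_prob \<alpha> \<beta> \<longlonglongrightarrow> theta N \<alpha> \<beta>"
proof -
  have b: "0 < \<beta>" using assms N2 by simp
  have "measure (percolation N \<alpha> \<beta>) (\<Union>k. exit_event \<alpha> \<beta> n (n + k)) = escape_prob \<alpha> \<beta> n" for n
  proof (rule LIMSEQ_unique[OF measure_UN_exit_event[OF assms(1) b]])
    have "(\<lambda>k. rho \<beta> (n + k)) \<longlonglongrightarrow> 0"
      using LIMSEQ_ignore_initial_segment[OF rho_tendsto_0[OF assms(2)], of n] by (simp add: add.commute)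
    then have "(\<lambda>k. exp (- \<alpha> * (rho \<beta> n - rho \<beta> (n + k)) * card (C n \<omega>)))
      \<longlonglongrightarrow> exp (- \<alpha> * (rho \<beta> n - 0) * card (C n \<omega>))" for \<omega>
      by (intro tendsto_intros)
    then have "(\<lambda>k. 1 - PB n \<alpha> \<beta> (\<lambda>\<omega>. exp (- \<alpha> * (rho \<beta> n - rho \<beta> (n + k)) * card (C n \<omega>))))
      \<longlonglongrightarrow> 1 - PB n \<alpha> \<beta> (\<lambda>\<omega>. exp (- \<alpha> * (rho \<beta> n - 0) * card (C n \<omega>)))"
      by (intro tendsto_diff[OF tendsto_const] EE_tendsto_fun)
    then show "(\<lambda>k. 1 - PB n \<alpha> \<beta> (\<lambda>\<omega>. exp (- \<alpha> * shell_weight \<beta> n (n + k) * card (C n \<omega>)))) \<longlonglongrightarrow> escape_prob \<alpha> \<beta> n"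
      using shell_weight_eq_rho[OF assms(2)] by (simp add: escape_prob_def)
  qed
  then show ?thesis using theta_LIMSEQ[OF assms(1) b] by simp
qed

lemma theta_le_escape_prob:
  assumes "0 \<le> \<alpha>" "real N < \<beta>"
  shows "theta N \<alpha> \<beta> \<le> escape_prob \<alpha> \<beta> n"
  by (rule LIMSEQ_le_const2[OF escape_prob_LIMSEQ_theta[OF assms]]) (use escape_prob_antimono[OF assms] in auto)

text \<open>\<open>escape_prob\<close> decreases with the ball, so a bound for arbitrarily large
  balls is enough; the renormalization controls only a subsequence of balls.\<close>

lemma theta_ge:
  assumes "0 \<le> \<alpha>" "real N < \<beta>" "\<And>n. \<exists>m\<ge>n. c \<le> escape_prob \<alpha> \<beta> m"
  shows "c \<le> theta N \<alpha> \<beta>"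
proof (rule LIMSEQ_le_const[OF escape_prob_LIMSEQ_theta[OF assms(1,2)]], intro exI allI impI)
  fix n
  obtain m where "n \<le> m" "c \<le> escape_prob \<alpha> \<beta> m" using assms(3) by blast
  then show "c \<le> escape_prob \<alpha> \<beta> n" using escape_prob_antimono[OF assms(1,2), of n m] by linarith
qed

section \<open>The boundary regimes: \<beta> at most N, and \<beta> = N^2\<close>

lemma shell_weight_ge:
  assumes "0 < \<beta>" "\<beta> \<le> real N"
  shows "real k / 2 \<le> shell_weight \<beta> n (n + k)"
proof (induction k)
  case (Suc k)
  let ?m = "n + k"
  have "\<beta> ^ Suc ?m \<le> real N ^ Suc ?m" using assms by (intro power_mono) auto
  \<comment> \<open>Each shell weighs at least \<open>1 - 1 / N\<close>, which is at least 1/2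
    because \<open>N \<ge> 2\<close>.\<close>
  moreover have "real N ^ Suc ?m \<le> 2 * (real N ^ Suc ?m - real N ^ ?m)"
    using mult_right_mono[of 2 "real N" "real N ^ ?m"] N2 by simp
  ultimately have "\<beta> ^ Suc ?m \<le> 2 * (real N ^ Suc ?m - real N ^ ?m)" by linarith
  then have "1 / 2 \<le> (real N ^ Suc ?m - real N ^ ?m) / \<beta> ^ Suc ?m"
    using assms by (simp add: pos_le_divide_eq)
  then show ?case using Suc shell_weight_Suc[of n ?m \<beta>] by simp
qed (simp add: shell_weight_def)

text \<open>The shell weights diverge, so even a single vertex almost surely has an edge out of any
  given ball.\<close>

lemma theta_eq_1:
  assumes "0 < \<alpha>" "0 < \<beta>" "\<beta> \<le> real N"
  shows "theta N \<alpha> \<beta> = 1"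
proof -
  have a: "0 \<le> \<alpha>" using assms by simp
  interpret prob_space "percolation N \<alpha> \<beta>" by (rule prob_space_percolation)
  have "1 \<le> measure (percolation N \<alpha> \<beta>) (\<Union>k. exit_event \<alpha> \<beta> n (n + k))" for n
  proof (rule LIMSEQ_le[OF _ measure_UN_exit_event[OF a assms(2)]])
    have "(\<lambda>k. exp (- (\<alpha> / 2) * real k)) \<longlonglongrightarrow> 0" using assms(1) by real_asymp
    from tendsto_diff[OF tendsto_const[of 1] this]
    show "(\<lambda>k. 1 - exp (- (\<alpha> / 2) * real k)) \<longlonglongrightarrow> 1" by simp
    have "PB n \<alpha> \<beta> (\<lambda>\<omega>. exp (- \<alpha> * shell_weight \<beta> n (n + k) * card (C n \<omega>))) \<le> exp (- (\<alpha> / 2) * real k)" for k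
    proof (rule EE_le_const)
      fix \<omega>
      have "real k / 2 * 1 \<le> shell_weight \<beta> n (n + k) * card (C n \<omega>)"
        using shell_weight_ge[OF assms(2,3), of k n] card_C_pos[of \<omega> n] by (intro mult_mono) auto
      then have "\<alpha> * (real k / 2) \<le> \<alpha> * (shell_weight \<beta> n (n + k) * card (C n \<omega>))" using a by (intro mult_left_mono) auto
      then show "exp (- \<alpha> * shell_weight \<beta> n (n + k) * card (C n \<omega>)) \<le> exp (- (\<alpha> / 2) * real k)" by simp
    qed (use edge_prob_bounds[OF a assms(2)] in auto)
    then show "\<exists>M. \<forall>k\<ge>M. 1 - exp (- (\<alpha> / 2) * real k)
      \<le> 1 - PB n \<alpha> \<beta> (\<lambda>\<omega>. exp (- \<alpha> * shell_weight \<beta> n (n + k) * card (C n \<omega>)))" by auto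
  qed
  then have "measure (percolation N \<alpha> \<beta>) (\<Union>k. exit_event \<alpha> \<beta> n (n + k)) = 1" for n
    using prob_le_1 by (simp add: order.antisym)
  then show ?thesis using theta_LIMSEQ[OF a assms(2)] LIMSEQ_unique[OF tendsto_const] by fastforce
qed

text \<open>At this \<beta> the product of \<open>rho\<close> and the volume of the ball is the
  constant \<open>1 / N\<close>. Hence \<open>escape_prob_le_large_cluster\<close> can be used with
  \<open>L = N ^ n\<close>, which no cluster exceeds, and its exponential stays bounded. Letting
  \<open>n\<close> and then \<open>m\<close> tend to infinity bounds theta by
  \<open>exp (\<alpha> / N) * 0\<close>.\<close>

lemma theta_N2:
  assumes "0 \<le> \<alpha>"
  shows "theta N \<alpha> ((real N)\<^sup>2) = 0"
proof (rule antisym)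
  let ?b = "(real N)\<^sup>2" let ?t = "theta N \<alpha> ?b"
  have Nb: "real N < ?b" using N2 by (simp add: power2_eq_square)
  have rho: "rho ?b n = 1 / (real N * real N ^ n)" for n
  proof -
    have "?b - real N = real N * (real N - 1)" by (simp add: power2_eq_square algebra_simps)
    moreover have "real N / ?b = 1 / real N" by (simp add: power2_eq_square)
    ultimately show ?thesis using N2 by (simp add: rho_def power_one_over field_simps)
  qed
  have "escape_prob \<alpha> ?b m \<le> exp (\<alpha> / N) * (escape_prob \<alpha> ?b m - ?t)" for m
  proof (rule LIMSEQ_le_const)
    have "(\<lambda>n. exp (\<alpha> / N) * (escape_prob \<alpha> ?b m - escape_prob \<alpha> ?b n) + real (N ^ m) * \<alpha> * rho ?b n)
      \<longlonglongrightarrow> exp (\<alpha> / N) * (escape_prob \<alpha> ?b m - ?t) + real (N ^ m) * \<alpha> * 0"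
      by (intro tendsto_intros escape_prob_LIMSEQ_theta rho_tendsto_0 assms Nb)
    then show "(\<lambda>n. exp (\<alpha> / N) * (escape_prob \<alpha> ?b m - escape_prob \<alpha> ?b n) + real (N ^ m) * \<alpha> * rho ?b n)
      \<longlonglongrightarrow> exp (\<alpha> / N) * (escape_prob \<alpha> ?b m - ?t)" by simp
    have "escape_prob \<alpha> ?b m \<le> exp (\<alpha> / N) * (escape_prob \<alpha> ?b m - escape_prob \<alpha> ?b n) + real (N ^ m) * \<alpha> * rho ?b n" if "m \<le> n" for n
    proof -
      have "of_bool (N ^ n < card (C n \<omega>)) = (0::real)" for \<omega> using card_C_le[of \<omega> n] by simp
      moreover have "\<alpha> * rho ?b n * real (N ^ n) = \<alpha> / N" using N2 unfolding rho by simp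
      ultimately show ?thesis
        using escape_prob_le_large_cluster[OF assms Nb that, of "N ^ n"] by (simp add: EE_const)
    qed
    then show "\<exists>M. \<forall>n\<ge>M. escape_prob \<alpha> ?b m \<le> exp (\<alpha> / N) * (escape_prob \<alpha> ?b m - escape_prob \<alpha> ?b n) + real (N ^ m) * \<alpha> * rho ?b n"
      by blast
  qed
  then have "?t \<le> exp (\<alpha> / N) * (?t - ?t)"
    by (intro LIMSEQ_le[OF escape_prob_LIMSEQ_theta[OF assms Nb] tendsto_mult[OF tendsto_const
      tendsto_diff[OF escape_prob_LIMSEQ_theta[OF assms Nb] tendsto_const]]]) auto
  then show "?t \<le> 0" by simp
  show "0 \<le> ?t" by (simp add: theta_def)
qed

end

section \<open>Renormalization\<close>

definition big :: "'v set \<Rightarrow> real \<Rightarrow> 'v set set \<Rightarrow> bool" where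
  "big V s \<omega> \<longleftrightarrow> (\<exists>x\<in>V. s \<le> card (cl (\<omega> \<inter> edges V) x))"

lemma cl_Int_edges_subset: "x \<in> V \<Longrightarrow> cl (\<omega> \<inter> edges V) x \<subseteq> V"
  by (rule cl_subset) (use edges_subset_Pow in auto)

lemma big_Int [simp]: "big V s (\<omega> \<inter> edges V) = big V s \<omega>"
  by (simp add: big_def Int_assoc)

lemma big_mono:
  assumes "finite W" "V \<subseteq> W" "big V s \<omega>"
  shows "big W s \<omega>"
proof -
  obtain x where x: "x \<in> V" "s \<le> card (cl (\<omega> \<inter> edges V) x)" using assms(3) by (auto simp: big_def)
  have "cl (\<omega> \<inter> edges V) x \<subseteq> cl (\<omega> \<inter> edges W) x"
    using edges_mono[OF assms(2)] by (intro cl_mono) auto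
  moreover have "x \<in> W" using x(1) assms(2) by auto
  then have "finite (cl (\<omega> \<inter> edges W) x)"
    by (rule finite_subset[OF cl_Int_edges_subset assms(1)])
  ultimately have "card (cl (\<omega> \<inter> edges V) x) \<le> card (cl (\<omega> \<inter> edges W) x)" by (rule card_mono[rotated])
  then show ?thesis using x assms(2) unfolding big_def by (intro bexI[of _ x]) auto
qed

lemma big_antimono: "s \<le> s' \<Longrightarrow> big V s' \<omega> \<Longrightarrow> big V s \<omega>"
  unfolding big_def by (auto intro: order_trans)

lemma big_image:
  assumes "inj_on h V" "\<omega> \<subseteq> edges V"
  shows "big (h ` V) s ((`) h ` \<omega>) \<longleftrightarrow> big V s \<omega>"
proof -
  have 1: "(`) h ` \<omega> \<inter> edges (h ` V) = (`) h ` \<omega>"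
    using assms(2) edges_image[OF assms(1)] by auto
  have 2: "\<omega> \<inter> edges V = \<omega>" using assms(2) by auto
  have "card (cl ((`) h ` \<omega>) (h x)) = card (cl \<omega> x)" if "x \<in> V" for x
  proof -
    have P: "\<omega> \<subseteq> Pow V" using assms(2) edges_subset_Pow by blast
    have "inj_on h (cl \<omega> x)" by (rule inj_on_subset[OF assms(1) cl_subset[OF P that]])
    then show ?thesis unfolding cl_image[OF assms(1) P that] by (rule card_image)
  qed
  then show ?thesis unfolding big_def 1 2 by simp
qed

text \<open>The choice is a function of \<open>\<omega> \<inter> edges V\<close> alone, so the edges
  between the chosen clusters of two disjoint sets stay independent of the choice.\<close>

definition chosen :: "'v set \<Rightarrow> real \<Rightarrow> 'v set set \<Rightarrow> 'v set" where
  "chosen V s \<omega> = (SOME S. \<exists>y\<in>V. S = cl (\<omega> \<inter> edges V) y \<and> s \<le> card S)"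

lemma chosen_Int [simp]: "chosen V s (\<omega> \<inter> edges V) = chosen V s \<omega>"
  by (simp add: chosen_def Int_assoc)

lemma chosen_prop:
  assumes "big V s \<omega>"
  shows "\<exists>y\<in>V. chosen V s \<omega> = cl (\<omega> \<inter> edges V) y \<and> s \<le> card (chosen V s \<omega>)"
proof -
  have "\<exists>S. \<exists>y\<in>V. S = cl (\<omega> \<inter> edges V) y \<and> s \<le> card S" using assms by (auto simp: big_def)
  from someI_ex[OF this] show ?thesis unfolding chosen_def by blast
qed

lemma chosen_subset: "big V s \<omega> \<Longrightarrow> chosen V s \<omega> \<subseteq> V"
  using chosen_prop cl_Int_edges_subset by metis

lemma chosen_in_cl:
  assumes "big V s \<omega>" "V \<subseteq> W" "x \<in> chosen V s \<omega>"
  shows "chosen V s \<omega> \<subseteq> cl (\<omega> \<inter> edges W) x"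
proof -
  obtain y where y: "chosen V s \<omega> = cl (\<omega> \<inter> edges V) y" using chosen_prop[OF assms(1)] by blast
  have "chosen V s \<omega> = cl (\<omega> \<inter> edges V) x" using assms(3) cl_eq[of x "\<omega> \<inter> edges V" y] by (simp add: y)
  also have "\<dots> \<subseteq> cl (\<omega> \<inter> edges W) x" using edges_mono[OF assms(2)] by (intro cl_mono) auto
  finally show ?thesis .
qed

text \<open>At most one member of the family fails, and all others are linked to a fixed good one
  through their chosen clusters. These clusters join into one, and disjointness makes their sizes
  add up.\<close>

lemma big_union_of_linked:
  fixes s :: real
  assumes fW: "finite W" and ne: "W \<noteq> {}" and fV: "finite \<V>" and VW: "\<And>V. V \<in> \<V> \<Longrightarrow> V \<subseteq> W"
    and dis: "disjoint \<V>" and s: "0 \<le> s"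
    and bad: "\<And>V V'. V \<in> \<V> \<Longrightarrow> V' \<in> \<V> \<Longrightarrow> V \<noteq> V' \<Longrightarrow> big V s \<omega> \<or> big V' s \<omega>"
    and link: "\<And>V V'. V \<in> \<V> \<Longrightarrow> V' \<in> \<V> \<Longrightarrow> V \<noteq> V' \<Longrightarrow> big V s \<omega> \<Longrightarrow> big V' s \<omega>
      \<Longrightarrow> \<omega> \<inter> between (chosen V s \<omega>) (chosen V' s \<omega>) \<noteq> {}"
  shows "big W ((real (card \<V>) - 1) * s) \<omega>"
proof -
  define G where "G = {V \<in> \<V>. big V s \<omega>}"
  have GV: "G \<subseteq> \<V>" and fG: "finite G" using fV by (auto simp: G_def)
  have "card (\<V> - G) \<le> Suc 0"
    using fV bad by (subst card_le_Suc0_iff_eq) (auto simp: G_def)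
  then have cG: "real (card \<V>) - 1 \<le> card G"
    using card_Diff_subset[OF fG GV] by linarith
  show ?thesis
  proof (cases "G = {}")
    \<comment> \<open>Without a good member the family has at most one member, and the required size
      is at most 0.\<close>
    case True
    then have "(real (card \<V>) - 1) * s \<le> 0 * s" using cG s by (intro mult_right_mono) auto
    then show ?thesis using ne unfolding big_def by (auto intro: order_trans)
  next
    case False
    then obtain V0 where V0: "V0 \<in> G" by auto
    let ?\<omega> = "\<omega> \<inter> edges W"
    have bG: "big V s \<omega>" if "V \<in> G" for V using that by (simp add: G_def)
    obtain x0 where x0: "x0 \<in> V0" "chosen V0 s \<omega> = cl (\<omega> \<inter> edges V0) x0"
      using chosen_prop[OF bG[OF V0]] by auto
    then have x0s: "x0 \<in> chosen V0 s \<omega>" by simp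
    have W0: "V0 \<subseteq> W" using V0 GV VW by auto
    have S0: "chosen V0 s \<omega> \<subseteq> cl ?\<omega> x0" by (rule chosen_in_cl[OF bG[OF V0] W0 x0s])
    have sub: "chosen V s \<omega> \<subseteq> cl ?\<omega> x0" if V: "V \<in> G" for V
    proof (cases "V = V0")
      case False
      then obtain u v where uv: "u \<in> chosen V0 s \<omega>" "v \<in> chosen V s \<omega>" "{u, v} \<in> \<omega>"
        using link[of V0 V] V V0 bG GV unfolding between_disjoint_iff by blast
      have VWs: "V \<subseteq> W" using V GV VW by auto
      have uV: "u \<in> V0" "v \<in> V" using uv chosen_subset bG V V0 by blast+
      then have "u \<noteq> v" using dis False V V0 GV by (auto simp: disjoint_def)
      then have "{u, v} \<in> ?\<omega>" using uv uV W0 VWs by auto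
      then have "v \<in> cl ?\<omega> x0" by (rule cl_step[OF subsetD[OF S0 uv(1)]])
      then show ?thesis using chosen_in_cl[OF bG[OF V] VWs uv(2)] cl_eq[of v ?\<omega> x0] by simp
    qed (use S0 in simp)
    have "x0 \<in> W" using x0(1) W0 by auto
    then have fcl: "finite (cl ?\<omega> x0)"
      by (rule finite_subset[OF cl_Int_edges_subset fW])
    have "(real (card \<V>) - 1) * s \<le> card G * s" using cG s by (intro mult_right_mono) auto
    also have "\<dots> = (\<Sum>V\<in>G. s)" by simp
    also have "\<dots> \<le> (\<Sum>V\<in>G. real (card (chosen V s \<omega>)))"
      using chosen_prop bG by (intro sum_mono) blast
    also have "\<dots> = card (\<Union>V\<in>G. chosen V s \<omega>)"
    proof (subst card_UN_disjoint[OF fG])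
      show "\<forall>V\<in>G. finite (chosen V s \<omega>)" using finite_subset[OF sub fcl] by simp
      show "\<forall>V\<in>G. \<forall>V'\<in>G. V \<noteq> V' \<longrightarrow> chosen V s \<omega> \<inter> chosen V' s \<omega> = {}"
      proof (intro ballI impI)
        fix V V' assume V: "V \<in> G" "V' \<in> G" "V \<noteq> V'"
        then have "V \<in> \<V>" "V' \<in> \<V>" using GV by auto
        then have "V \<inter> V' = {}" using dis V(3) unfolding disjoint_def by blast
        moreover note chosen_subset[OF bG[OF V(1)]] chosen_subset[OF bG[OF V(2)]]
        ultimately show "chosen V s \<omega> \<inter> chosen V' s \<omega> = {}" by blast
      qed
    qed simp
    also have "\<dots> \<le> card (cl ?\<omega> x0)"
      using sub fcl by (intro of_nat_mono card_mono) auto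
    finally show ?thesis using x0(1) W0 unfolding big_def by blast
  qed
qed

section \<open>Failure probabilities of balls and their recursion\<close>

context hierarchical
begin

definition prob_not_big :: "real \<Rightarrow> real \<Rightarrow> nat \<Rightarrow> real \<Rightarrow> real" where
  "prob_not_big \<alpha> \<beta> n s = PB n \<alpha> \<beta> (\<lambda>\<omega>. of_bool (\<not> big (B n) s \<omega>))"

lemma prob_not_big_bounds:
  assumes "0 \<le> \<alpha>" "0 < \<beta>"
  shows "0 \<le> prob_not_big \<alpha> \<beta> n s" "prob_not_big \<alpha> \<beta> n s \<le> 1"
  unfolding prob_not_big_def using edge_prob_bounds[OF assms]
  by (auto intro!: EE_nonneg EE_le_const)

lemma prob_not_big_mono:
  assumes "0 \<le> \<alpha>" "0 < \<beta>" "s \<le> s'"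
  shows "prob_not_big \<alpha> \<beta> n s \<le> prob_not_big \<alpha> \<beta> n s'"
  unfolding prob_not_big_def using big_antimono[OF assms(3)] by (intro PB_le assms) auto

lemma EE_not_big_hball:
  assumes "x \<in> hlattice N" "finite E" "edges (hball N n x) \<subseteq> E"
  shows "EE E (edge_prob \<alpha> \<beta>) (\<lambda>\<omega>. of_bool (\<not> big (hball N n x) s \<omega>)) = prob_not_big \<alpha> \<beta> n s"
proof -
  have "EE E (edge_prob \<alpha> \<beta>) (\<lambda>\<omega>. of_bool (\<not> big (hball N n x) s \<omega>))
    = EE E (edge_prob \<alpha> \<beta>) (\<lambda>\<omega>. of_bool (\<not> big (hball N n x) s (\<omega> \<inter> edges (hball N n x))))"
    by simp
  also have "\<dots> = EE (edges (hball N n x)) (edge_prob \<alpha> \<beta>) (\<lambda>\<omega>. of_bool (\<not> big (hball N n x) s \<omega>))"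
    by (rule EE_marginal[OF assms(2,3)])
  also have "\<dots> = PB n \<alpha> \<beta> (\<lambda>\<omega>. of_bool (\<not> big (hball N n x) s ((`) (shift N x) ` \<omega>)))"
    by (rule EE_translate[OF assms(1)])
  also have "\<dots> = prob_not_big \<alpha> \<beta> n s"
    unfolding prob_not_big_def shift_image_B[OF assms(1), symmetric]
    by (intro EE_cong refl) (simp add: big_image[OF inj_shift_B])
  finally show ?thesis .
qed

lemma EE_two_not_big:
  assumes "x \<in> hlattice N" "y \<in> hlattice N" "finite E" "edges (hball N n x) \<subseteq> E" "edges (hball N n y) \<subseteq> E"
    "hball N n x \<inter> hball N n y = {}"
  shows "EE E (edge_prob \<alpha> \<beta>) (\<lambda>\<omega>. of_bool (\<not> big (hball N n x) s \<omega>) * of_bool (\<not> big (hball N n y) s \<omega>))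
    = (prob_not_big \<alpha> \<beta> n s)\<^sup>2"
  using EE_indep[OF assms(3) edges_disjoint[OF assms(6)], of "edge_prob \<alpha> \<beta>"
      "\<lambda>a. of_bool (\<not> big (hball N n x) s a)" "\<lambda>a. of_bool (\<not> big (hball N n y) s a)"]
    EE_not_big_hball[OF assms(1,3,4)] EE_not_big_hball[OF assms(2,3,5)]
  by (simp add: power2_eq_square)

lemma hball_disjoint_or_eq: "hball N n x = hball N n y \<or> hball N n x \<inter> hball N n y = {}"
proof (cases "hball N n x \<inter> hball N n y = {}")
  case False
  then obtain z where "z \<in> hball N n x" "z \<in> hball N n y" by auto
  then show ?thesis using hball_eq by metis
qed simp

lemma finite_sub_B: "S \<subseteq> B m \<Longrightarrow> finite S"
  by (rule finite_subset[OF _ finite_B])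

lemma sum_J_ge:
  assumes "1 \<le> \<beta>" "A \<subseteq> B m" "S \<subseteq> B m"
  shows "real (card A) * real (card S) / \<beta> ^ m \<le> (\<Sum>u\<in>A. \<Sum>v\<in>S. 1 / \<beta> ^ hdist u v)"
proof -
  have "(\<Sum>u\<in>A. \<Sum>v\<in>S. 1 / \<beta> ^ m) \<le> (\<Sum>u\<in>A. \<Sum>v\<in>S. 1 / \<beta> ^ hdist u v)"
  proof (intro sum_mono)
    fix u v assume "u \<in> A" "v \<in> S"
    then have "u \<in> B m" "v \<in> B m" using assms by auto
    then have "hdist u v \<le> m" by (subst hdist_le_iff[of u N v]) (auto simp: hball_def)
    then show "1 / \<beta> ^ m \<le> 1 / \<beta> ^ hdist u v"
      using assms(1) by (intro divide_left_mono power_increasing) auto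
  qed
  then show ?thesis by simp
qed

lemma prod_between_le:
  assumes "0 \<le> \<alpha>" "1 \<le> \<beta>" "A \<subseteq> B m" "S \<subseteq> B m" "A \<inter> S = {}"
  shows "(\<Prod>e\<in>between A S. 1 - edge_prob \<alpha> \<beta> e) \<le> exp (- \<alpha> * (real (card A) * real (card S) / \<beta> ^ m))"
proof -
  have "\<alpha> * (real (card A) * real (card S) / \<beta> ^ m) \<le> \<alpha> * (\<Sum>u\<in>A. \<Sum>v\<in>S. 1 / \<beta> ^ hdist u v)"
    using sum_J_ge[OF assms(2-4)] assms(1) by (rule mult_left_mono)
  then show ?thesis
    unfolding prod_between[OF finite_sub_B[OF assms(3)] finite_sub_B[OF assms(4)] assms(5)] by simp
qed

text \<open>Given the edges inside \<open>V\<close> and \<open>V'\<close>, the chosen clusters are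
  fixed and span at least \<open>s * s\<close> pairs at distance at most \<open>m\<close>, each
  closed with probability at most \<open>exp (- \<alpha> / \<beta> ^ m)\<close>.\<close>

lemma EE_two_big_unlinked:
  assumes ab: "0 \<le> \<alpha>" "1 \<le> \<beta>" and s: "0 \<le> s"
    and sub: "V \<subseteq> B m" "V' \<subseteq> B m" and dis: "V \<inter> V' = {}"
  shows "PB m \<alpha> \<beta> (\<lambda>\<omega>. of_bool (big V s \<omega> \<and> big V' s \<omega> \<and> \<omega> \<inter> between (chosen V s \<omega>) (chosen V' s \<omega>) = {}))
    \<le> exp (- \<alpha> * s\<^sup>2 / \<beta> ^ m)"
proof -
  let ?E = "edges (B m)" and ?J = "edges V \<union> edges V'"
  let ?F = "\<lambda>\<omega>. of_bool (big V s \<omega> \<and> big V' s \<omega> \<and> \<omega> \<inter> between (chosen V s \<omega>) (chosen V' s \<omega>) = {}) :: real"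
  have b: "0 < \<beta>" using ab by simp
  have p: "0 \<le> edge_prob \<alpha> \<beta> e \<and> edge_prob \<alpha> \<beta> e \<le> 1" for e using edge_prob_bounds[OF ab(1) b] by auto
  have J: "?J \<subseteq> ?E" using edges_mono sub by blast
  have fJ: "finite ?J" by (rule finite_subset[OF J finite_edges_B])
  have "PB m \<alpha> \<beta> ?F = EE ?J (edge_prob \<alpha> \<beta>) (\<lambda>a. EE (?E - ?J) (edge_prob \<alpha> \<beta>) (\<lambda>b. ?F (a \<union> b)))"
    by (rule EE_split[OF finite_edges_B J])
  also have "\<dots> \<le> exp (- \<alpha> * s\<^sup>2 / \<beta> ^ m)"
  proof (rule EE_le_const[OF fJ p])
    fix a assume a: "a \<subseteq> ?J"
    show "EE (?E - ?J) (edge_prob \<alpha> \<beta>) (\<lambda>b. ?F (a \<union> b)) \<le> exp (- \<alpha> * s\<^sup>2 / \<beta> ^ m)"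
    proof (cases "big V s a \<and> big V' s a")
      case True
      then have bg: "big V s a" "big V' s a" by auto
      let ?S = "chosen V s a" and ?S' = "chosen V' s a"
      let ?T = "between ?S ?S'"
      have SV: "?S \<subseteq> V" "?S' \<subseteq> V'" using chosen_subset bg by auto
      then have SB: "?S \<subseteq> B m" "?S' \<subseteq> B m" "?S \<inter> ?S' = {}" using sub dis by auto
      have T: "?T \<subseteq> ?E - ?J"
      proof -
        have "?T \<subseteq> ?E" using SB by (intro between_subset_edges) auto
        moreover have "?T \<inter> ?J = {}" using SV dis by (auto simp: between_def)
        ultimately show ?thesis by auto
      qed
      have "EE (?E - ?J) (edge_prob \<alpha> \<beta>) (\<lambda>b. ?F (a \<union> b))
        \<le> EE (?E - ?J) (edge_prob \<alpha> \<beta>) (\<lambda>b. of_bool (b \<inter> ?T = {}))"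
      proof (rule EE_mono[OF p])
        fix b assume b: "b \<subseteq> ?E - ?J"
        have "(a \<union> b) \<inter> edges V = a \<inter> edges V" "(a \<union> b) \<inter> edges V' = a \<inter> edges V'" using b by auto
        then have "chosen V s (a \<union> b) = ?S" "chosen V' s (a \<union> b) = ?S'" by (metis chosen_Int)+
        then show "?F (a \<union> b) \<le> of_bool (b \<inter> ?T = {})" by auto
      qed
      also have "\<dots> = (\<Prod>e\<in>?T. 1 - edge_prob \<alpha> \<beta> e)"
        by (rule EE_all_closed) (use T in auto)
      also have "\<dots> \<le> exp (- \<alpha> * (real (card ?S) * real (card ?S') / \<beta> ^ m))"
        by (rule prod_between_le[OF ab SB])
      also have "\<dots> \<le> exp (- \<alpha> * s\<^sup>2 / \<beta> ^ m)"
      proof -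
        have "s * s \<le> real (card ?S) * real (card ?S')"
          using chosen_prop[OF bg(1)] chosen_prop[OF bg(2)] s by (intro mult_mono) auto
        then have "\<alpha> * (s\<^sup>2 / \<beta> ^ m) \<le> \<alpha> * (real (card ?S) * real (card ?S') / \<beta> ^ m)"
          using ab b by (intro mult_left_mono divide_right_mono) (auto simp: power2_eq_square)
        then show ?thesis by simp
      qed
      finally show ?thesis .
    next
      case False
      have "EE (?E - ?J) (edge_prob \<alpha> \<beta>) (\<lambda>b. ?F (a \<union> b)) = EE (?E - ?J) (edge_prob \<alpha> \<beta>) (\<lambda>b. 0)"
      proof (intro EE_cong refl)
        fix b assume b: "b \<subseteq> ?E - ?J"
        have "(a \<union> b) \<inter> edges V = a \<inter> edges V" "(a \<union> b) \<inter> edges V' = a \<inter> edges V'" using b by auto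
        then have "big V s (a \<union> b) = big V s a" "big V' s (a \<union> b) = big V' s a" by (metis big_Int)+
        then show "?F (a \<union> b) = 0" using False by auto
      qed
      then show ?thesis by (simp add: EE_const)
    qed
  qed
  finally show ?thesis .
qed

lemma card_subballs: "card (hball N n ` B (n + K)) = N ^ K"
proof -
  let ?V = "hball N n ` B (n + K)"
  have U: "\<Union>?V = B (n + K)"
  proof
    show "\<Union>?V \<subseteq> B (n + K)" using hball_subset_B[of _ "n + K" n] by auto
    show "B (n + K) \<subseteq> \<Union>?V" using center_in_hball hball_subset by blast
  qed
  have "N ^ n * card ?V = card (\<Union>?V)"
  proof (rule card_partition)
    show "card S = N ^ n" if "S \<in> ?V" for S
      using that card_hball hball_subset by blast
    show "S \<inter> S' = {}" if "S \<in> ?V" "S' \<in> ?V" "S \<noteq> S'" for S S'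
      using that hball_disjoint_or_eq by blast
  qed (auto simp: U)
  then have "N ^ n * card ?V = N ^ n * N ^ K" by (simp add: U card_B power_add)
  then show ?thesis using N2 by simp
qed

text \<open>A ball fails only if two of its subballs fail or two good subballs are not linked; the first
  event has a probability of second order.\<close>

lemma prob_not_big_step:
  assumes ab: "0 \<le> \<alpha>" "1 \<le> \<beta>" and s: "0 \<le> s"
  shows "prob_not_big \<alpha> \<beta> (n + K) ((real N ^ K - 1) * s)
    \<le> (real N ^ K)\<^sup>2 * ((prob_not_big \<alpha> \<beta> n s)\<^sup>2 + exp (- \<alpha> * s\<^sup>2 / \<beta> ^ (n + K)))"
proof -
  let ?m = "n + K" and ?V = "hball N n ` B (n + K)"
  let ?PP = "{(V, V') \<in> ?V \<times> ?V. V \<noteq> V'}"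
  have b: "0 < \<beta>" using ab by simp
  have fV: "finite ?V" by simp
  have subB: "V \<subseteq> B ?m" if "V \<in> ?V" for V using that hball_subset_B[of _ ?m n] by auto
  have dis: "disjoint ?V" unfolding disjoint_def using hball_disjoint_or_eq by blast
  define b1 where "b1 = (\<lambda>(V::(nat \<Rightarrow> nat) set) (V'::(nat \<Rightarrow> nat) set) \<omega>. of_bool (\<not> big V s \<omega>) * of_bool (\<not> big V' s \<omega>) :: real)"
  define b2 where "b2 = (\<lambda>(V::(nat \<Rightarrow> nat) set) V' \<omega>. of_bool (big V s \<omega> \<and> big V' s \<omega> \<and> \<omega> \<inter> between (chosen V s \<omega>) (chosen V' s \<omega>) = {}) :: real)"
  have fPP: "finite ?PP" by (rule finite_subset[of _ "?V \<times> ?V"]) auto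
  have "prob_not_big \<alpha> \<beta> ?m ((real N ^ K - 1) * s) \<le> PB ?m \<alpha> \<beta> (\<lambda>\<omega>. \<Sum>(V, V')\<in>?PP. b1 V V' \<omega> + b2 V V' \<omega>)"
    unfolding prob_not_big_def
  proof (intro PB_le ab(1) b)
    fix \<omega>
    show "of_bool (\<not> big (B ?m) ((real N ^ K - 1) * s) \<omega>) \<le> (\<Sum>(V, V')\<in>?PP. b1 V V' \<omega> + b2 V V' \<omega>)"
    \<comment> \<open>Union bound over ordered pairs: if no pair of subballs fails or is unlinked,
      \<open>big_union_of_linked\<close> applies to all \<open>N ^ K\<close> subballs.\<close>
    proof (cases "\<exists>(V, V')\<in>?PP. b1 V V' \<omega> + b2 V V' \<omega> \<ge> 1")
      case True
      then obtain P where P: "P \<in> ?PP" "(case P of (V, V') \<Rightarrow> b1 V V' \<omega> + b2 V V' \<omega>) \<ge> 1" by auto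
      have "(case P of (V, V') \<Rightarrow> b1 V V' \<omega> + b2 V V' \<omega>) \<le> (\<Sum>(V, V')\<in>?PP. b1 V V' \<omega> + b2 V V' \<omega>)"
        by (rule member_le_sum[OF P(1) _ fPP]) (auto simp: b1_def b2_def)
      then show ?thesis using P(2) by (smt (verit) of_bool_less_eq_one)
    next
      case False
      then have no: "b1 V V' \<omega> + b2 V V' \<omega> < 1" if "V \<in> ?V" "V' \<in> ?V" "V \<noteq> V'" for V V'
        using that by fastforce
      have "big (B ?m) ((real (card ?V) - 1) * s) \<omega>"
      proof (rule big_union_of_linked[OF finite_B _ fV subB dis s])
        show "B ?m \<noteq> {}" using zero_in_B by blast
        show "big V s \<omega> \<or> big V' s \<omega>" if "V \<in> ?V" "V' \<in> ?V" "V \<noteq> V'" for V V'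
          using no[OF that] by (auto simp: b1_def b2_def split: if_splits)
        show "\<omega> \<inter> between (chosen V s \<omega>) (chosen V' s \<omega>) \<noteq> {}"
          if "V \<in> ?V" "V' \<in> ?V" "V \<noteq> V'" "big V s \<omega>" "big V' s \<omega>" for V V'
          using no[OF that(1-3)] that(4,5) by (auto simp: b1_def b2_def split: if_splits)
      qed
      then have "big (B ?m) ((real N ^ K - 1) * s) \<omega>" by (simp add: card_subballs)
      moreover have "0 \<le> (\<Sum>(V, V')\<in>?PP. b1 V V' \<omega> + b2 V V' \<omega>)"
        by (intro sum_nonneg) (auto simp: b1_def b2_def)
      ultimately show ?thesis by simp
    qed
  qed
  also have "\<dots> = (\<Sum>(V, V')\<in>?PP. PB ?m \<alpha> \<beta> (b1 V V') + PB ?m \<alpha> \<beta> (b2 V V'))"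
    by (simp add: EE_sum EE_add case_prod_beta)
  also have "\<dots> \<le> (\<Sum>(V, V')\<in>?PP. (prob_not_big \<alpha> \<beta> n s)\<^sup>2 + exp (- \<alpha> * s\<^sup>2 / \<beta> ^ ?m))"
  proof (intro sum_mono)
    fix P assume P: "P \<in> ?PP"
    obtain V V' where VV: "P = (V, V')" "V \<in> ?V" "V' \<in> ?V" "V \<noteq> V'" using P by auto
    then obtain x y where xy: "x \<in> B ?m" "y \<in> B ?m" "V = hball N n x" "V' = hball N n y" by auto
    have d: "V \<inter> V' = {}" using VV xy hball_disjoint_or_eq by metis
    have "PB ?m \<alpha> \<beta> (b1 V V') = (prob_not_big \<alpha> \<beta> n s)\<^sup>2"
      using EE_two_not_big[OF subsetD[OF hball_subset xy(1)] subsetD[OF hball_subset xy(2)] finite_edges_B,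
          of n ?m \<alpha> \<beta> s] edges_mono[OF subB[OF VV(2)]] edges_mono[OF subB[OF VV(3)]] d
      unfolding b1_def xy(3,4) by blast
    moreover have "PB ?m \<alpha> \<beta> (b2 V V') \<le> exp (- \<alpha> * s\<^sup>2 / \<beta> ^ ?m)"
      unfolding b2_def by (rule EE_two_big_unlinked[OF ab s subB[OF VV(2)] subB[OF VV(3)] d])
    ultimately show "(case P of (V, V') \<Rightarrow> PB ?m \<alpha> \<beta> (b1 V V') + PB ?m \<alpha> \<beta> (b2 V V'))
      \<le> (case P of (V, V') \<Rightarrow> (prob_not_big \<alpha> \<beta> n s)\<^sup>2 + exp (- \<alpha> * s\<^sup>2 / \<beta> ^ ?m))"
      by (simp add: VV(1))
  qed
  also have "\<dots> = real (card ?PP) * ((prob_not_big \<alpha> \<beta> n s)\<^sup>2 + exp (- \<alpha> * s\<^sup>2 / \<beta> ^ ?m))"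
    by simp
  also have "\<dots> \<le> (real N ^ K)\<^sup>2 * ((prob_not_big \<alpha> \<beta> n s)\<^sup>2 + exp (- \<alpha> * s\<^sup>2 / \<beta> ^ ?m))"
  proof (intro mult_right_mono)
    have "card ?PP \<le> card (?V \<times> ?V)" by (intro card_mono) auto
    also have "\<dots> = (N ^ K)\<^sup>2" unfolding card_cartesian_product card_subballs by (simp add: power2_eq_square)
    finally have "real (card ?PP) \<le> real ((N ^ K)\<^sup>2)" by (simp only: of_nat_le_iff)
    then show "real (card ?PP) \<le> (real N ^ K)\<^sup>2" by (simp only: of_nat_power)
  qed simp
  finally show ?thesis .
qed

end

text \<open>The number of levels climbed in the first \<open>j\<close> renormalization steps, when
  step \<open>i\<close> groups \<open>N ^ (K + i)\<close> balls into one.\<close>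

definition block_sum :: "nat \<Rightarrow> nat \<Rightarrow> nat" where
  "block_sum K j = (\<Sum>i<j. K + i)"

lemma block_sum_ge: "K * j \<le> block_sum K j"
  by (induction j) (auto simp: block_sum_def)

context hierarchical
begin

text \<open>The block length grows by one at every step, so that the density lost by discarding one
  subball per step stays summable.\<close>

lemma prob_not_big_recursion:
  assumes a: "0 \<le> \<alpha>" and b: "1 \<le> \<beta>" and s0: "0 \<le> s0" and K: "3 \<le> K"
    and u: "2 * \<beta> \<le> ((real N)\<^sup>2 / \<beta>) ^ K"
    and A: "32 * K * ln N * \<beta> ^ (n0 + K) \<le> \<alpha> * s0\<^sup>2"
    and Q0: "prob_not_big \<alpha> \<beta> n0 s0 \<le> 1 / real N ^ (4 * K)"
  shows "prob_not_big \<alpha> \<beta> (n0 + block_sum K j) (s0 * real N ^ block_sum K j * (1 / 2 + 2 * (1 / 2) ^ (K + j))) \<le> 1 / real N ^ (4 * (K + j))"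
proof (induction j)
  case 0
  have "(1 / 2 :: real) ^ K \<le> (1 / 2) ^ 3" using K by (intro power_decreasing) auto
  also have "\<dots> = 1 / 8" by (simp add: power_divide)
  finally have "1 / 2 + 2 * (1 / 2) ^ K \<le> (1::real)" by linarith
  then have "s0 * (1 / 2 + 2 * (1 / 2) ^ K) \<le> s0 * 1" using s0 by (rule mult_left_mono)
  then have "prob_not_big \<alpha> \<beta> n0 (s0 * (1 / 2 + 2 * (1 / 2) ^ K)) \<le> prob_not_big \<alpha> \<beta> n0 s0" using a b by (intro prob_not_big_mono) auto
  then show ?case using Q0 by (simp add: block_sum_def)
next
  case (Suc j)
  define h :: real where "h = (1 / 2) ^ (K + j)"
  define m where "m = real N ^ (K + j)"
  define r where "r = real N ^ block_sum K j"
  define n where "n = n0 + block_sum K j"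
  define S where "S = s0 * r * (1 / 2 + 2 * h)"
  have N1: "1 < real N" using N2 by simp
  have r: "0 < r" unfolding r_def using N1 by simp
  have h8: "0 < h" "h \<le> 1 / 8"
  proof -
    have "h \<le> (1 / 2) ^ 3" unfolding h_def using K by (intro power_decreasing) auto
    then show "h \<le> 1 / 8" by (simp add: power_divide)
  qed (simp add: h_def)
  have hm: "1 \<le> m * h"
  proof -
    have "(2::real) ^ (K + j) \<le> m" unfolding m_def using N2 by (intro power_mono) auto
    then show ?thesis unfolding h_def by (simp add: power_one_over field_simps)
  qed
  have m3: "real N ^ 3 \<le> m" unfolding m_def using N1 K by (intro power_increasing) auto
  then have m0: "0 < m" using N1 by (smt (verit) zero_less_power)
  have rS: "real N ^ block_sum K (Suc j) = r * m" by (simp add: r_def m_def block_sum_def power_add)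
  have nS: "n0 + block_sum K (Suc j) = n + (K + j)" by (simp add: n_def block_sum_def)
  have S0: "0 \<le> S" unfolding S_def using s0 r h8 by simp
  \<comment> \<open>The excess \<open>2 * h\<close> of the density over 1/2 is halved. In units of
    \<open>s0 * r\<close> this gives up \<open>m * h \<ge> 1\<close>, which covers the
    \<open>1 / 2 + 2 * h\<close> lost with the one discarded subball.\<close>
  have SS: "s0 * (r * m) * (1 / 2 + 2 * (1 / 2) ^ (K + Suc j)) \<le> (m - 1) * S"
  proof -
    have "(m - 1) * (1 / 2 + 2 * h) = m * (1 / 2 + h) + (m * h - 1 / 2 - 2 * h)" by (simp add: field_simps)
    then have "m * (1 / 2 + h) \<le> (m - 1) * (1 / 2 + 2 * h)" using hm h8 by linarith
    then have "(s0 * r) * (m * (1 / 2 + h)) \<le> (s0 * r) * ((m - 1) * (1 / 2 + 2 * h))"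
      using s0 r by (intro mult_left_mono) auto
    then show ?thesis by (simp add: S_def h_def mult_ac)
  qed
  have IH: "prob_not_big \<alpha> \<beta> n S \<le> 1 / m ^ 4"
    using Suc by (simp add: n_def S_def r_def h_def m_def power_mult[symmetric] mult.commute)
  have ex: "exp (- \<alpha> * S\<^sup>2 / \<beta> ^ (n + (K + j))) \<le> 1 / m ^ 8"
  proof -
    have b0: "0 < \<beta>" using b by simp
    define v where "v = (real N)\<^sup>2 / \<beta>"
    have v1: "1 \<le> v"
    proof (rule ccontr)
      assume "\<not> 1 \<le> v"
      moreover have "0 \<le> v" using b0 by (simp add: v_def)
      ultimately have "v ^ K \<le> 1" by (intro power_le_one) auto
      then show False using u b by (simp add: v_def)
    qed
    \<comment> \<open>Per step, \<open>v ^ K\<close> covers a factor \<beta>, due to the longer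
      block, and a factor 2, whose powers absorb the linear growth \<open>1 + j\<close>
      below.\<close>
    have "(2 * \<beta>) ^ j \<le> (v ^ K) ^ j" using u b0 by (intro power_mono) (auto simp: v_def)
    also have "\<dots> = v ^ (K * j)" by (simp add: power_mult)
    also have "\<dots> \<le> v ^ block_sum K j" using v1 block_sum_ge by (intro power_increasing) auto
    also have "\<dots> = r\<^sup>2 / \<beta> ^ block_sum K j"
      unfolding v_def r_def power_divide by (simp add: power_mult[symmetric] mult.commute)
    finally have vj: "2 ^ j * \<beta> ^ j * \<beta> ^ block_sum K j \<le> r\<^sup>2"
      using b0 by (simp add: power_mult_distrib pos_le_divide_eq)
    have lnN: "0 < ln (real N)" using N1 by simp
    have "j < 2 ^ j" by (rule less_exp)
    then have j2: "1 + real j \<le> 2 ^ j" 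
    proof -
      have "real (Suc j) \<le> real (2 ^ j)" using \<open>j < 2 ^ j\<close> by (simp only: of_nat_le_iff Suc_le_eq)
      then show ?thesis by simp
    qed
    have "8 * (K + j) \<le> 8 * K * (1 + j)" using K by (simp add: algebra_simps)
    then have "real (8 * (K + j)) \<le> real (8 * K * (1 + j))" by (simp only: of_nat_le_iff)
    also have "\<dots> = 8 * K * (1 + real j)" by (simp add: algebra_simps)
    also have "\<dots> \<le> 8 * real K * 2 ^ j" using j2 by (simp add: mult_left_mono)
    finally have "8 * real (K + j) \<le> 8 * real K * 2 ^ j" by simp
    then have "8 * real (K + j) * ln N \<le> 8 * real K * 2 ^ j * ln N"
      by (rule mult_right_mono) (use lnN in simp)
    then have "8 * real (K + j) * ln N * \<beta> ^ (n + (K + j)) \<le> 8 * real K * 2 ^ j * ln N * \<beta> ^ (n + (K + j))"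
      by (rule mult_right_mono) (use b0 in simp)
    also have "\<dots> = (8 * K * ln N * \<beta> ^ (n0 + K)) * (2 ^ j * \<beta> ^ j * \<beta> ^ block_sum K j)"
      by (simp add: n_def power_add mult_ac)
    also have "\<dots> \<le> (8 * K * ln N * \<beta> ^ (n0 + K)) * r\<^sup>2"
      using vj lnN b0 by (intro mult_left_mono) auto
    \<comment> \<open>The constant 32 is 8 times 4: the 8 yields the power \<open>m ^ 8\<close>, the
      4 makes up for the density factor 1/2, which enters squared.\<close>
    also have "\<dots> \<le> (\<alpha> * s0\<^sup>2 / 4) * r\<^sup>2" using A by (intro mult_right_mono) auto
    also have "\<dots> = \<alpha> * (s0 * r * (1 / 2))\<^sup>2" by (simp add: power2_eq_square)
    also have "\<dots> \<le> \<alpha> * S\<^sup>2"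
      unfolding S_def using a s0 r h8 by (intro mult_left_mono power_mono) auto
    finally have "8 * real (K + j) * ln N \<le> \<alpha> * S\<^sup>2 / \<beta> ^ (n + (K + j))"
      using b0 by (simp add: pos_le_divide_eq)
    moreover have "ln (m ^ 8) = 8 * real (K + j) * ln N"
      using N1 m0 by (simp add: ln_realpow m_def)
    ultimately have "exp (- \<alpha> * S\<^sup>2 / \<beta> ^ (n + (K + j))) \<le> exp (- ln (m ^ 8))" by simp
    then show ?thesis using m0 by (simp add: exp_minus inverse_eq_divide)
  qed
  have "prob_not_big \<alpha> \<beta> (n + (K + j)) (s0 * (r * m) * (1 / 2 + 2 * (1 / 2) ^ (K + Suc j)))
    \<le> prob_not_big \<alpha> \<beta> (n + (K + j)) ((m - 1) * S)" using a b SS by (intro prob_not_big_mono) auto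
  also have "\<dots> \<le> m\<^sup>2 * ((prob_not_big \<alpha> \<beta> n S)\<^sup>2 + exp (- \<alpha> * S\<^sup>2 / \<beta> ^ (n + (K + j))))"
    unfolding m_def by (rule prob_not_big_step[OF a b S0])
  also have "\<dots> \<le> m\<^sup>2 * ((1 / m ^ 4)\<^sup>2 + 1 / m ^ 8)"
    using IH ex prob_not_big_bounds[of \<alpha> \<beta> n S] a b by (intro mult_left_mono add_mono power_mono) auto
  also have "\<dots> = 2 / m ^ 6" using m0 by (simp add: field_simps eval_nat_numeral)
  \<comment> \<open>The exponent 4 reproduces itself if \<open>2 * N ^ 4 \<le> m ^ 2\<close>, and
    \<open>K \<ge> 3\<close> gives \<open>m \<ge> N ^ 3\<close>.\<close>
  also have "\<dots> \<le> 1 / (real N * m) ^ 4"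
  proof -
    have "2 * real N ^ 4 \<le> real N ^ 2 * real N ^ 4" using N2 by (intro mult_right_mono) (auto intro: order_trans[OF _ self_le_power])
    also have "\<dots> = (real N ^ 3)\<^sup>2" by (simp flip: power_add power_mult)
    also have "\<dots> \<le> m\<^sup>2" using m3 by (intro power_mono) auto
    finally have "2 * real N ^ 4 * m ^ 4 \<le> m\<^sup>2 * m ^ 4" using m0 by (intro mult_right_mono) auto
    then have "2 * (real N * m) ^ 4 \<le> m ^ 6" by (simp add: power_mult_distrib flip: power_add)
    then show ?thesis using m0 N1 by (simp add: pos_divide_le_eq pos_le_divide_eq mult.commute)
  qed
  also have "(real N * m) ^ 4 = real N ^ (4 * (K + Suc j))"
    by (simp add: m_def power_mult[symmetric] mult.commute flip: power_Suc)
  finally show ?case unfolding nS rS .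
qed

section \<open>Relating the cluster of 0 to all clusters of the ball\<close>

lemma shift_zero: "x \<in> hlattice N \<Longrightarrow> shift N x (\<lambda>_. 0) = x"
  by (auto simp: shift_def hlattice_iff)

text \<open>Translation by a point of \<open>B n\<close> maps \<open>B n\<close> onto itself, so the
  finite ball has no boundary effects: all its vertices have clusters with the same law of
  sizes.\<close>

lemma EE_cluster_translate:
  fixes G :: "nat \<Rightarrow> real"
  assumes x: "x \<in> B n"
  shows "PB n \<alpha> \<beta> (\<lambda>\<omega>. G (card (cl (\<omega> \<inter> edges (B n)) x))) = PB n \<alpha> \<beta> (\<lambda>\<omega>. G (card (C n \<omega>)))"
proof -
  have xh: "x \<in> hlattice N" using x hball_subset by auto
  have hb: "hball N n x = B n" using hball_eq[OF x] .
  have im: "shift N x ` B n = B n" using shift_image_B[OF xh] hb by simp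
  have "PB n \<alpha> \<beta> (\<lambda>\<omega>. G (card (cl (\<omega> \<inter> edges (B n)) x)))
    = PB n \<alpha> \<beta> (\<lambda>\<omega>. G (card (cl ((`) (shift N x) ` \<omega> \<inter> edges (B n)) x)))"
    using EE_translate[OF xh, of n \<alpha> \<beta>] unfolding hb .
  also have "\<dots> = PB n \<alpha> \<beta> (\<lambda>\<omega>. G (card (C n \<omega>)))"
  proof (intro EE_cong refl)
    fix \<omega> assume w: "\<omega> \<subseteq> edges (B n)"
    have P: "\<omega> \<subseteq> Pow (B n)" using w edges_subset_Pow by blast
    have "(`) (shift N x) ` \<omega> \<subseteq> edges (B n)"
      using edges_image[OF inj_shift_B[of x n]] w unfolding im by auto
    then have 1: "(`) (shift N x) ` \<omega> \<inter> edges (B n) = (`) (shift N x) ` \<omega>" by auto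
    have 2: "\<omega> \<inter> edges (B n) = \<omega>" using w by auto
    have "cl ((`) (shift N x) ` \<omega>) x = shift N x ` cl \<omega> (\<lambda>_. 0)"
      using cl_image[OF inj_shift_B P zero_in_B, of x] shift_zero[OF xh] by simp
    moreover have "inj_on (shift N x) (cl \<omega> (\<lambda>_. 0))"
      by (rule inj_on_subset[OF inj_shift_B cl_subset[OF P zero_in_B]])
    ultimately have "card (cl ((`) (shift N x) ` \<omega>) x) = card (cl \<omega> (\<lambda>_. 0))" by (simp add: card_image)
    then show "G (card (cl ((`) (shift N x) ` \<omega> \<inter> edges (B n)) x)) = G (card (C n \<omega>))"
      unfolding 1 2 by simp
  qed
  finally show ?thesis .
qed

abbreviation cnt :: "'v set \<Rightarrow> real \<Rightarrow> 'v set set \<Rightarrow> nat" where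
  "cnt V s \<omega> \<equiv> card {x \<in> V. s \<le> card (cl (\<omega> \<inter> edges V) x)}"

lemma EE_cnt: "PB n \<alpha> \<beta> (\<lambda>\<omega>. real (cnt (B n) s \<omega>)) = real N ^ n * PB n \<alpha> \<beta> (\<lambda>\<omega>. of_bool (s \<le> card (C n \<omega>)))"
proof -
  have "real (cnt (B n) s \<omega>) = (\<Sum>x\<in>B n. of_bool (s \<le> card (cl (\<omega> \<inter> edges (B n)) x)))" for \<omega>
    by (simp add: of_bool_def sum.If_cases Int_def)
  then have "PB n \<alpha> \<beta> (\<lambda>\<omega>. real (cnt (B n) s \<omega>))
    = (\<Sum>x\<in>B n. PB n \<alpha> \<beta> (\<lambda>\<omega>. of_bool (s \<le> card (cl (\<omega> \<inter> edges (B n)) x))))"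
    by (simp only: EE_sum)
  also have "\<dots> = (\<Sum>x\<in>B n. PB n \<alpha> \<beta> (\<lambda>\<omega>. of_bool (s \<le> card (C n \<omega>))))"
    by (intro sum.cong refl EE_cluster_translate[where G = "\<lambda>k. of_bool (s \<le> real k)"])
  finally show ?thesis by (simp add: card_B)
qed

text \<open>One cluster of size at least \<open>s\<close> already contributes \<open>s\<close>
  vertices to \<open>cnt\<close>, and by homogeneity the mean of \<open>cnt\<close> is
  \<open>N ^ n\<close> times the probability for 0.\<close>

lemma prob_cluster_ge:
  assumes "0 \<le> \<alpha>" "0 < \<beta>" "0 \<le> s"
  shows "s * (1 - prob_not_big \<alpha> \<beta> n s) \<le> real N ^ n * PB n \<alpha> \<beta> (\<lambda>\<omega>. of_bool (s \<le> card (C n \<omega>)))"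
proof -
  have "s * (1 - prob_not_big \<alpha> \<beta> n s) = PB n \<alpha> \<beta> (\<lambda>\<omega>. s * (1 - of_bool (\<not> big (B n) s \<omega>)))"
    by (simp add: prob_not_big_def EE_cmult EE_diff EE_const)
  also have "\<dots> \<le> PB n \<alpha> \<beta> (\<lambda>\<omega>. real (cnt (B n) s \<omega>))"
  proof (intro PB_le assms)
    fix \<omega>
    show "s * (1 - of_bool (\<not> big (B n) s \<omega>)) \<le> real (cnt (B n) s \<omega>)"
    proof (cases "big (B n) s \<omega>")
      case True
      then obtain x where x: "x \<in> B n" "s \<le> card (cl (\<omega> \<inter> edges (B n)) x)" by (auto simp: big_def)
      have "cl (\<omega> \<inter> edges (B n)) x \<subseteq> {y \<in> B n. s \<le> card (cl (\<omega> \<inter> edges (B n)) y)}"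
      proof
        fix y assume y: "y \<in> cl (\<omega> \<inter> edges (B n)) x"
        then have "y \<in> B n" using cl_Int_edges_subset[OF x(1)] by blast
        then show "y \<in> {y \<in> B n. s \<le> card (cl (\<omega> \<inter> edges (B n)) y)}"
          using x(2) by (simp add: cl_eq[OF y])
      qed
      then have "card (cl (\<omega> \<inter> edges (B n)) x) \<le> cnt (B n) s \<omega>" by (intro card_mono) auto
      then show ?thesis using True x(2) by simp
    qed simp
  qed
  finally show ?thesis unfolding EE_cnt .
qed

text \<open>The recursion yields clusters of density \<open>c\<close> in a sequence of growing
  balls. With probability at least \<open>c / 2\<close> the cluster of 0 is that large, and its
  weight to the exterior is then bounded below, since \<open>rho \<beta> n * N ^ n\<close> is a
  multiple of \<open>(N^2 / \<beta>) ^ n\<close>.\<close>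

lemma theta_pos:
  assumes a: "0 < \<alpha>" and b: "real N < \<beta>" and s0: "0 < s0" and K: "3 \<le> K"
    and u: "2 * \<beta> \<le> ((real N)\<^sup>2 / \<beta>) ^ K"
    and A: "32 * K * ln N * \<beta> ^ (n0 + K) \<le> \<alpha> * s0\<^sup>2"
    and Q0: "prob_not_big \<alpha> \<beta> n0 s0 \<le> 1 / real N ^ (4 * K)"
  shows "0 < theta N \<alpha> \<beta>"
proof -
  have b1: "1 \<le> \<beta>" "0 < \<beta>" using b N2 by auto
  have N1: "1 < real N" using N2 by simp
  \<comment> \<open>Half of the initial density: the density factor in the recursion never falls
    below 1/2.\<close>
  define c where "c = s0 / (2 * real N ^ n0)"
  define \<kappa> where "\<kappa> = \<alpha> * c * (real N - 1) / (\<beta> - real N)"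
  have c: "0 < c" using s0 N1 by (simp add: c_def)
  have k: "0 < \<kappa>" using a c b N1 by (simp add: \<kappa>_def)
  have v1: "1 \<le> (real N)\<^sup>2 / \<beta>"
  proof (rule ccontr)
    assume "\<not> 1 \<le> (real N)\<^sup>2 / \<beta>"
    then have "((real N)\<^sup>2 / \<beta>) ^ K \<le> 1" using b1 by (intro power_le_one) auto
    then show False using u b1 by simp
  qed
  have "(c / 2) * (1 - exp (- \<kappa>)) \<le> escape_prob \<alpha> \<beta> (n0 + block_sum K j)" for j
  proof -
    define n where "n = n0 + block_sum K j"
    let ?s = "c * real N ^ n"
    have Nn: "0 < real N ^ n" using N1 by simp
    have s: "0 < ?s" using c Nn by simp
    have "?s = s0 * real N ^ block_sum K j * (1 / 2)" using N1 by (simp add: c_def n_def power_add)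
    also have "\<dots> \<le> s0 * real N ^ block_sum K j * (1 / 2 + 2 * (1 / 2) ^ (K + j))"
      using s0 N1 by (intro mult_left_mono) auto
    finally have "prob_not_big \<alpha> \<beta> n ?s \<le> prob_not_big \<alpha> \<beta> n (s0 * real N ^ block_sum K j * (1 / 2 + 2 * (1 / 2) ^ (K + j)))"
      using a b1 by (intro prob_not_big_mono) auto
    also have "\<dots> \<le> 1 / real N ^ (4 * (K + j))"
      unfolding n_def using prob_not_big_recursion[OF _ b1(1) _ K u A Q0] a s0 by simp
    also have "\<dots> \<le> 1 / 2"
    proof -
      have "real N ^ 1 \<le> real N ^ (4 * (K + j))" using K N1 by (intro power_increasing) auto
      moreover have "2 \<le> real N" using N2 by simp
      ultimately have "2 \<le> real N ^ (4 * (K + j))" by (simp only: power_one_right)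
      then show ?thesis using N1 by (intro divide_left_mono) auto
    qed
    finally have "?s * (1 / 2) \<le> ?s * (1 - prob_not_big \<alpha> \<beta> n ?s)" using s by (intro mult_left_mono) auto
    also have "\<dots> \<le> real N ^ n * PB n \<alpha> \<beta> (\<lambda>\<omega>. of_bool (?s \<le> card (C n \<omega>)))"
      using a b1 s by (intro prob_cluster_ge) auto
    finally have p: "c / 2 \<le> PB n \<alpha> \<beta> (\<lambda>\<omega>. of_bool (?s \<le> card (C n \<omega>)))"
      using Nn by simp
    have rs: "\<kappa> \<le> \<alpha> * rho \<beta> n * ?s"
    proof -
      have "real N ^ n * (real N / \<beta>) ^ n = ((real N)\<^sup>2 / \<beta>) ^ n"
        by (simp add: power_divide power2_eq_square power_mult_distrib)
      then have "\<alpha> * rho \<beta> n * ?s = \<kappa> * ((real N)\<^sup>2 / \<beta>) ^ n"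
        unfolding rho_def \<kappa>_def by (simp add: mult_ac)
      moreover have "1 \<le> ((real N)\<^sup>2 / \<beta>) ^ n" using v1 by (rule one_le_power)
      ultimately show ?thesis using k by simp
    qed
    have "1 - escape_prob \<alpha> \<beta> n = PB n \<alpha> \<beta> (\<lambda>\<omega>. exp (- \<alpha> * rho \<beta> n * card (C n \<omega>)))" by (simp add: escape_prob_def)
    also have "\<dots> \<le> PB n \<alpha> \<beta> (\<lambda>\<omega>. 1 - of_bool (?s \<le> card (C n \<omega>)) * (1 - exp (- \<kappa>)))"
    proof (intro PB_le)
      fix \<omega>
      have r: "0 < \<alpha> * rho \<beta> n" using a rho_pos[OF b] by simp
      have "\<kappa> \<le> \<alpha> * rho \<beta> n * card (C n \<omega>)" if "?s \<le> card (C n \<omega>)"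
        using rs mult_left_mono[OF that, of "\<alpha> * rho \<beta> n"] r by linarith
      then show "exp (- \<alpha> * rho \<beta> n * card (C n \<omega>)) \<le> 1 - of_bool (?s \<le> card (C n \<omega>)) * (1 - exp (- \<kappa>))"
        using r by (cases "?s \<le> card (C n \<omega>)") auto
    qed (use a b1 in auto)
    also have "\<dots> = 1 - PB n \<alpha> \<beta> (\<lambda>\<omega>. of_bool (?s \<le> card (C n \<omega>))) * (1 - exp (- \<kappa>))"
      by (simp add: EE_diff EE_const EE_cmult_right)
    finally have "PB n \<alpha> \<beta> (\<lambda>\<omega>. of_bool (?s \<le> card (C n \<omega>))) * (1 - exp (- \<kappa>)) \<le> escape_prob \<alpha> \<beta> n" by simp
    moreover have "(c / 2) * (1 - exp (- \<kappa>)) \<le> PB n \<alpha> \<beta> (\<lambda>\<omega>. of_bool (?s \<le> card (C n \<omega>))) * (1 - exp (- \<kappa>))"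
      by (rule mult_right_mono[OF p]) (use k in simp)
    ultimately show ?thesis unfolding n_def[symmetric] by (rule order_trans[rotated])
  qed
  moreover have "\<exists>j. n \<le> n0 + block_sum K j" for n
  proof (intro exI)
    have "1 * n \<le> K * n" using K by (intro mult_right_mono) auto
    then show "n \<le> n0 + block_sum K n" using block_sum_ge[of K n] by linarith
  qed
  ultimately have "\<exists>m\<ge>n. (c / 2) * (1 - exp (- \<kappa>)) \<le> escape_prob \<alpha> \<beta> m" for n by blast
  then have "(c / 2) * (1 - exp (- \<kappa>)) \<le> theta N \<alpha> \<beta>"
    using a by (intro theta_ge[OF _ b]) auto
  moreover have "0 < (c / 2) * (1 - exp (- \<kappa>))" using c k by simp
  ultimately show ?thesis by linarith
qed

section \<open>Survival forces the cluster of 0 to exceed the extinction scale\<close>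

text \<open>A cluster of size \<open>(\<beta> / N) ^ n\<close> in \<open>B n\<close> has about one edge to the outside.\<close>

definition spread :: "real \<Rightarrow> real \<Rightarrow> real \<Rightarrow> bool" where
  "spread \<alpha> \<beta> p \<longleftrightarrow> (\<forall>M>0. \<exists>n1. \<forall>n\<ge>n1. p \<le> PB n \<alpha> \<beta> (\<lambda>\<omega>. of_bool (M * (\<beta> / real N) ^ n \<le> card (C n \<omega>))))"

text \<open>For \<open>L\<close> of order \<open>(\<beta> / N) ^ n\<close> the product
  \<open>rho \<beta> n * L\<close> is bounded, so small clusters die out with a probability bounded
  from below. Since \<open>escape_prob\<close> converges, hardly any mass is left to die.\<close>

lemma spread_of_theta_pos:
  assumes a: "0 \<le> \<alpha>" and b: "real N < \<beta>" and t: "0 < theta N \<alpha> \<beta>"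
  shows "spread \<alpha> \<beta> (theta N \<alpha> \<beta> / 2)"
  unfolding spread_def
proof (intro allI impI)
  fix M :: real assume M: "0 < M"
  let ?t = "theta N \<alpha> \<beta>"
  have b0: "0 < \<beta>" using b N2 by simp
  \<comment> \<open>This is \<open>\<alpha> * rho \<beta> n\<close> times the threshold
    \<open>M * (\<beta> / N) ^ n\<close>; the powers cancel.\<close>
  define \<kappa> where "\<kappa> = \<alpha> * M * (real N - 1) / (\<beta> - real N)"
  \<comment> \<open>One quarter of theta is budgeted for small clusters that still exit
    \<open>B m\<close>, one for the edges beyond \<open>B n\<close>; half of theta remains.\<close>
  have "eventually (\<lambda>m. escape_prob \<alpha> \<beta> m < ?t + ?t / (4 * exp \<kappa>)) sequentially"
    using escape_prob_LIMSEQ_theta[OF a b] by (rule order_tendstoD) (use t in simp)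
  then obtain m where m: "escape_prob \<alpha> \<beta> m < ?t + ?t / (4 * exp \<kappa>)" by (auto simp: eventually_sequentially)
  have "(\<lambda>n. real (N ^ m) * \<alpha> * rho \<beta> n) \<longlonglongrightarrow> 0"
    by (rule tendsto_mult_right_zero[OF rho_tendsto_0[OF b]])
  then have "eventually (\<lambda>n. real (N ^ m) * \<alpha> * rho \<beta> n < ?t / 4) sequentially"
    by (rule order_tendstoD) (use t in simp)
  then obtain n1 where n1: "\<And>n. n1 \<le> n \<Longrightarrow> real (N ^ m) * \<alpha> * rho \<beta> n < ?t / 4"
    by (auto simp: eventually_sequentially)
  show "\<exists>n1. \<forall>n\<ge>n1. ?t / 2 \<le> PB n \<alpha> \<beta> (\<lambda>\<omega>. of_bool (M * (\<beta> / real N) ^ n \<le> card (C n \<omega>)))"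
  proof (intro exI allI impI)
    fix n assume n: "max n1 m \<le> n"
    let ?x = "M * (\<beta> / real N) ^ n"
    define L where "L = nat \<lfloor>?x\<rfloor>"
    have x0: "0 \<le> ?x" using M b0 by simp
    have L: "real L \<le> ?x" using x0 by (simp add: L_def)
    have e1: "(real N / \<beta>) ^ n * (\<beta> / real N) ^ n = 1"
      using b0 N2 by (simp flip: power_mult_distrib)
    have "\<alpha> * (c * (real N / \<beta>) ^ n) * (M * (\<beta> / real N) ^ n)
      = \<alpha> * M * c * ((real N / \<beta>) ^ n * (\<beta> / real N) ^ n)" for c
      by (simp only: mult_ac)
    then have "\<alpha> * (c * (real N / \<beta>) ^ n) * (M * (\<beta> / real N) ^ n) = \<alpha> * M * c" for c
      unfolding e1 by simp
    from this[of "(real N - 1) / (\<beta> - real N)"] have "\<alpha> * rho \<beta> n * ?x = \<kappa>"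
      unfolding rho_def \<kappa>_def by (simp only: times_divide_eq_right)
    moreover have "\<alpha> * rho \<beta> n * L \<le> \<alpha> * rho \<beta> n * ?x"
      using L a rho_pos[OF b, of n] by (intro mult_left_mono) auto
    ultimately have e: "exp (\<alpha> * rho \<beta> n * L) \<le> exp \<kappa>" by simp
    have "escape_prob \<alpha> \<beta> m \<le> PB n \<alpha> \<beta> (\<lambda>\<omega>. of_bool (L < card (C n \<omega>)))
      + exp (\<alpha> * rho \<beta> n * L) * (escape_prob \<alpha> \<beta> m - escape_prob \<alpha> \<beta> n) + real (N ^ m) * \<alpha> * rho \<beta> n"
      by (rule escape_prob_le_large_cluster[OF a b]) (use n in simp)
    also have "exp (\<alpha> * rho \<beta> n * L) * (escape_prob \<alpha> \<beta> m - escape_prob \<alpha> \<beta> n) \<le> exp \<kappa> * (?t / (4 * exp \<kappa>))"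
      using e m theta_le_escape_prob[OF a b, of n] escape_prob_antimono[OF a b, of m n] n by (intro mult_mono) auto
    also have "exp \<kappa> * (?t / (4 * exp \<kappa>)) = ?t / 4" by simp
    also have "PB n \<alpha> \<beta> (\<lambda>\<omega>. of_bool (L < card (C n \<omega>))) \<le> PB n \<alpha> \<beta> (\<lambda>\<omega>. of_bool (?x \<le> card (C n \<omega>)))"
    proof (intro PB_le a b0)
      fix \<omega>
      have "?x \<le> card (C n \<omega>)" if "L < card (C n \<omega>)" using that x0 unfolding L_def by linarith
      then show "of_bool (L < card (C n \<omega>)) \<le> (of_bool (?x \<le> card (C n \<omega>)) :: real)" by simp
    qed
    finally have "escape_prob \<alpha> \<beta> m \<le> PB n \<alpha> \<beta> (\<lambda>\<omega>. of_bool (?x \<le> card (C n \<omega>))) + ?t / 4 + real (N ^ m) * \<alpha> * rho \<beta> n"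
      by simp
    then show "?t / 2 \<le> PB n \<alpha> \<beta> (\<lambda>\<omega>. of_bool (?x \<le> card (C n \<omega>)))"
      using n1[of n] n theta_le_escape_prob[OF a b, of m] t by simp
  qed
qed

lemma exits_card_less:
  assumes "n \<le> m" "exits n m \<omega>"
  shows "card (C n \<omega>) < card (C m \<omega>)"
proof -
  obtain u v where uv: "u \<in> C n \<omega>" "v \<in> B m - B n" "{u, v} \<in> \<omega>" using assms(2) by auto
  have "edges (B n) \<subseteq> edges (B m)" by (rule edges_mono[OF B_mono[OF assms(1)]])
  then have sub: "C n \<omega> \<subseteq> C m \<omega>" by (intro cl_mono) auto
  have "u \<in> B n" using uv C_subset by blast
  then have "u \<in> B m" "u \<noteq> v" using B_mono[OF assms(1)] uv by auto
  then have "v \<in> C m \<omega>" using cl_step[OF subsetD[OF sub uv(1)]] uv by auto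
  moreover have "v \<notin> C n \<omega>" using uv C_subset by blast
  ultimately have "C n \<omega> \<subset> C m \<omega>" using sub by blast
  then show ?thesis by (rule psubset_card_mono[OF finite_C])
qed

text \<open>At \<beta> = N every shell weighs at least 1/2, so the cluster exits \<open>B m\<close>
  into enough further shells with probability close to 1, and each exit adds a vertex; hence the
  induction on the size.\<close>

lemma small_cluster_vanishes:
  fixes M :: nat
  assumes a: "0 < \<alpha>" and e: "0 < \<epsilon>"
  shows "\<exists>n1. \<forall>n\<ge>n1. PB n \<alpha> (real N) (\<lambda>\<omega>. of_bool (card (C n \<omega>) \<le> M)) \<le> \<epsilon>"
  using e
proof (induction M arbitrary: \<epsilon>)
  case 0
  have "\<not> card (C n \<omega>) \<le> 0" for n \<omega> using card_C_pos[of \<omega> n] by linarith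
  then show ?case using 0 by (simp add: EE_const)
next
  case (Suc M)
  have a0: "0 \<le> \<alpha>" and b0: "0 < real N" using a N2 by auto
  obtain m where m: "PB m \<alpha> (real N) (\<lambda>\<omega>. of_bool (card (C m \<omega>) \<le> M)) \<le> \<epsilon> / 2"
    using Suc.IH[of "\<epsilon> / 2"] Suc.prems by auto
  have "(\<lambda>k. exp (- (\<alpha> / 2) * real k)) \<longlonglongrightarrow> 0" using a by real_asymp
  then have "eventually (\<lambda>k. exp (- (\<alpha> / 2) * real k) < \<epsilon> / 2) sequentially"
    by (rule order_tendstoD) (use Suc.prems in simp)
  then obtain k0 where k0: "\<And>k. k0 \<le> k \<Longrightarrow> exp (- (\<alpha> / 2) * real k) < \<epsilon> / 2"
    by (auto simp: eventually_sequentially)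
  show ?case
  proof (intro exI allI impI)
    fix n assume n: "m + k0 \<le> n"
    then have mn: "m \<le> n" by simp
    have sub: "edges (B m) \<subseteq> edges (B n)" by (rule edges_mono[OF B_mono[OF mn]])
    have "PB n \<alpha> (real N) (\<lambda>\<omega>. of_bool (card (C n \<omega>) \<le> Suc M))
      \<le> PB n \<alpha> (real N) (\<lambda>\<omega>. of_bool (\<not> exits m n \<omega>) * 1 + of_bool (card (C m (\<omega> \<inter> edges (B m))) \<le> M))"
    proof (intro PB_le a0 b0)
      fix \<omega>
      have "card (C m \<omega>) \<le> M" if "card (C n \<omega>) \<le> Suc M" "exits m n \<omega>"
        using exits_card_less[OF mn that(2)] that(1) by simp
      then show "of_bool (card (C n \<omega>) \<le> Suc M)
        \<le> of_bool (\<not> exits m n \<omega>) * 1 + (of_bool (card (C m (\<omega> \<inter> edges (B m))) \<le> M) :: real)"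
        by (cases "card (C n \<omega>) \<le> Suc M"; cases "exits m n \<omega>") (simp_all add: Int_assoc)
    qed
    also have "\<dots> = PB m \<alpha> (real N) (\<lambda>\<omega>. exp (- \<alpha> * shell_weight (real N) m n * card (C m \<omega>)) * 1)
      + PB m \<alpha> (real N) (\<lambda>\<omega>. of_bool (card (C m \<omega>) \<le> M))"
      using EE_not_exits[OF mn, of \<alpha> "real N" "\<lambda>_. 1"]
        EE_marginal[OF finite_edges_B sub, of "edge_prob \<alpha> (real N)" "\<lambda>\<omega>. of_bool (card (C m \<omega>) \<le> M)"]
      by (simp add: EE_add)
    also have "PB m \<alpha> (real N) (\<lambda>\<omega>. exp (- \<alpha> * shell_weight (real N) m n * card (C m \<omega>)) * 1) \<le> exp (- (\<alpha> / 2) * real (n - m))"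
    proof (rule EE_le_const)
      fix \<omega>
      have "real (n - m) / 2 * 1 \<le> shell_weight (real N) m n * card (C m \<omega>)"
        using shell_weight_ge[of "real N" "n - m" m] card_C_pos[of \<omega> m] b0 mn by (intro mult_mono) auto
      then have "\<alpha> * (real (n - m) / 2) \<le> \<alpha> * (shell_weight (real N) m n * card (C m \<omega>))"
        using a0 by (intro mult_left_mono) auto
      then show "exp (- \<alpha> * shell_weight (real N) m n * card (C m \<omega>)) * 1 \<le> exp (- (\<alpha> / 2) * real (n - m))"
        using mn by (simp add: of_nat_diff)
    qed (use edge_prob_bounds[OF a0 b0] in auto)
    also have "exp (- (\<alpha> / 2) * real (n - m)) \<le> \<epsilon> / 2"
      by (rule less_imp_le[OF k0]) (use n in simp)
    finally show "PB n \<alpha> (real N) (\<lambda>\<omega>. of_bool (card (C n \<omega>) \<le> Suc M)) \<le> \<epsilon>" using m by simp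
  qed
qed

text \<open>Here the threshold \<open>M * (\<beta> / N) ^ n\<close> is the constant
  \<open>M\<close>, so it suffices that cluster sizes tend to infinity in probability.\<close>

lemma spread_at_N:
  assumes a: "0 < \<alpha>"
  shows "spread \<alpha> (real N) (1 / 2)"
  unfolding spread_def
proof (intro allI impI)
  fix M :: real assume "0 < M"
  define L where "L = nat \<lceil>M\<rceil>"
  have N1: "real N \<noteq> 0" using N2 by simp
  obtain n1 where n1: "\<And>n. n1 \<le> n \<Longrightarrow> PB n \<alpha> (real N) (\<lambda>\<omega>. of_bool (card (C n \<omega>) \<le> L)) \<le> 1 / 2"
    using small_cluster_vanishes[OF a, of "1 / 2" L] by auto
  have "1 / 2 \<le> PB n \<alpha> (real N) (\<lambda>\<omega>. of_bool (M \<le> card (C n \<omega>)))" if "n1 \<le> n" for n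
  proof -
    have "PB n \<alpha> (real N) (\<lambda>\<omega>. 1 - of_bool (card (C n \<omega>) \<le> L)) \<le> PB n \<alpha> (real N) (\<lambda>\<omega>. of_bool (M \<le> card (C n \<omega>)))"
    proof (intro PB_le)
      fix \<omega>
      have "M \<le> card (C n \<omega>)" if "\<not> card (C n \<omega>) \<le> L" using that unfolding L_def by linarith
      then show "1 - of_bool (card (C n \<omega>) \<le> L) \<le> (of_bool (M \<le> card (C n \<omega>)) :: real)" by auto
    qed (use a N2 in auto)
    then show ?thesis using n1[OF that] by (simp add: EE_diff EE_const)
  qed
  then show "\<exists>n1. \<forall>n\<ge>n1. 1 / 2 \<le> PB n \<alpha> (real N) (\<lambda>\<omega>. of_bool (M * (real N / real N) ^ n \<le> card (C n \<omega>)))"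
    using N1 by auto
qed

end

section \<open>Merging many clusters of moderate size into one of positive density\<close>

lemma closed_set_balanced:
  fixes w :: real
  assumes fW: "finite W" and sub: "\<omega> \<subseteq> Pow W" and U: "U \<subseteq> W" and w: "0 < w" "w \<le> card U"
    and small: "\<And>x. x \<in> W \<Longrightarrow> card (cl \<omega> x) < w / 3"
  shows "\<exists>Z\<subseteq>W. (\<forall>x\<in>Z. cl \<omega> x \<subseteq> Z) \<and> w / 3 \<le> card (Z \<inter> U) \<and> w / 3 \<le> card (U - Z)"
proof -
  \<comment> \<open>Greedy choice: among the unions of clusters that leave \<open>w / 3\<close> of
    \<open>U\<close> outside, take one with the most points of \<open>U\<close>. If it held fewer
    than \<open>w / 3\<close>, adding one more cluster, itself smaller than \<open>w / 3\<close>,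
    would keep the total below \<open>2 * w / 3 \<le> card U - w / 3\<close>.\<close>
  define ZZ where "ZZ = {Z. Z \<subseteq> W \<and> (\<forall>x\<in>Z. cl \<omega> x \<subseteq> Z) \<and> card (Z \<inter> U) \<le> card U - w / 3}"
  have fU: "finite U" using fW U by (rule finite_subset[rotated])
  have fZZ: "finite ZZ" by (rule finite_subset[of _ "Pow W"]) (use fW in \<open>auto simp: ZZ_def\<close>)
  have "{} \<in> ZZ" using w by (auto simp: ZZ_def)
  then have "Max ((\<lambda>Z. card (Z \<inter> U)) ` ZZ) \<in> (\<lambda>Z. card (Z \<inter> U)) ` ZZ"
    using fZZ by (intro Max_in) auto
  then obtain Z where Z: "Z \<in> ZZ" and Zm: "card (Z \<inter> U) = Max ((\<lambda>Z. card (Z \<inter> U)) ` ZZ)" by auto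
  have max: "card (Z' \<inter> U) \<le> card (Z \<inter> U)" if "Z' \<in> ZZ" for Z'
    unfolding Zm using that fZZ by (intro Max_ge) auto
  have ZW: "Z \<subseteq> W" and Zc: "\<And>x. x \<in> Z \<Longrightarrow> cl \<omega> x \<subseteq> Z" and Zs: "card (Z \<inter> U) \<le> card U - w / 3"
    using Z by (auto simp: ZZ_def)
  have big: "w / 3 \<le> card (Z \<inter> U)"
  proof (rule ccontr)
    assume "\<not> w / 3 \<le> card (Z \<inter> U)"
    then have lt: "card (Z \<inter> U) < w / 3" by simp
    have "\<not> U \<subseteq> Z"
    proof
      assume "U \<subseteq> Z"
      then have "Z \<inter> U = U" by auto
      then show False using lt w by simp
    qed
    then obtain x where x: "x \<in> U" "x \<notin> Z" by auto
    have xW: "x \<in> W" using x U by auto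
    have cW: "cl \<omega> x \<subseteq> W" by (rule cl_subset[OF sub xW])
    have fc: "finite (cl \<omega> x)" by (rule finite_subset[OF cW fW])
    let ?Z = "Z \<union> cl \<omega> x"
    have "card (?Z \<inter> U) \<le> card (Z \<inter> U) + card (cl \<omega> x)"
    proof -
      have "card (?Z \<inter> U) \<le> card ((Z \<inter> U) \<union> cl \<omega> x)" using fU fc by (intro card_mono) auto
      also have "\<dots> \<le> card (Z \<inter> U) + card (cl \<omega> x)" by (rule card_Un_le)
      finally show ?thesis .
    qed
    then have "card (?Z \<inter> U) \<le> card U - w / 3" using lt small[OF xW] w(2) by linarith
    moreover have "cl \<omega> y \<subseteq> ?Z" if "y \<in> ?Z" for y
    proof (cases "y \<in> Z")
      case True then show ?thesis using Zc by blast
    next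
      case False
      then have "y \<in> cl \<omega> x" using that by simp
      then show ?thesis by (simp add: cl_eq)
    qed
    ultimately have "?Z \<in> ZZ" using ZW cW by (simp add: ZZ_def)
    then have "card (?Z \<inter> U) \<le> card (Z \<inter> U)" by (rule max)
    moreover have "Z \<inter> U \<subset> ?Z \<inter> U"
    proof
      show "Z \<inter> U \<noteq> ?Z \<inter> U" using x cl_refl[of x \<omega>] by blast
    qed auto
    then have "card (Z \<inter> U) < card (?Z \<inter> U)" using fU by (intro psubset_card_mono) auto
    ultimately show False by simp
  qed
  have "card (U - Z) = card U - card (Z \<inter> U)" "card (Z \<inter> U) \<le> card U"
    using fU by (simp_all add: card_Diff_subset_Int Int_commute card_mono)
  then have "w / 3 \<le> card (U - Z)" using Zs by (simp add: of_nat_diff)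
  then show ?thesis using ZW Zc big by blast
qed

context hierarchical
begin

lemma prod_two_between_le:
  assumes "0 \<le> \<alpha>" "1 \<le> \<beta>" and sub: "A1 \<subseteq> B m" "R1 \<subseteq> B m" "A2 \<subseteq> B m" "R2 \<subseteq> B m"
    and dis: "(A1 \<union> R1) \<inter> (A2 \<union> R2) = {}" "A1 \<inter> R1 = {}"
    and c: "c \<le> real (card A1) * real (card R2) + real (card R1) * real (card A2)"
  shows "(\<Prod>e\<in>between A1 R2 \<union> between R1 A2. 1 - edge_prob \<alpha> \<beta> e) \<le> exp (- \<alpha> * (c / \<beta> ^ m))"
proof -
  have b: "0 < \<beta>" using assms(2) by simp
  have d: "A1 \<inter> R2 = {}" "R1 \<inter> A2 = {}" using dis by auto
  have fin: "finite A1" "finite R1" "finite A2" "finite R2" using sub finite_sub_B by auto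
  have "between A1 R2 \<inter> between R1 A2 = {}"
    using dis by (auto simp: between_def doubleton_eq_iff)
  then have "(\<Prod>e\<in>between A1 R2 \<union> between R1 A2. 1 - edge_prob \<alpha> \<beta> e)
    = (\<Prod>e\<in>between A1 R2. 1 - edge_prob \<alpha> \<beta> e) * (\<Prod>e\<in>between R1 A2. 1 - edge_prob \<alpha> \<beta> e)"
    using fin by (intro prod.union_disjoint finite_between)
  also have "\<dots> \<le> exp (- \<alpha> * (real (card A1) * real (card R2) / \<beta> ^ m))
     * exp (- \<alpha> * (real (card R1) * real (card A2) / \<beta> ^ m))"
    using sub d assms(1,2) edge_prob_bounds[OF assms(1) b]
    by (intro mult_mono prod_between_le prod_nonneg) auto
  also have "\<dots> = exp (- \<alpha> * ((real (card A1) * real (card R2) + real (card R1) * real (card A2)) / \<beta> ^ m))"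
    unfolding mult_exp_exp by (simp add: add_divide_distrib algebra_simps)
  also have "\<dots> \<le> exp (- \<alpha> * (c / \<beta> ^ m))"
  proof -
    have "\<alpha> * (c / \<beta> ^ m) \<le> \<alpha> * ((real (card A1) * real (card R2) + real (card R1) * real (card A2)) / \<beta> ^ m)"
      using c assms(1) b by (intro mult_left_mono divide_right_mono) auto
    then show ?thesis by simp
  qed
  finally show ?thesis .
qed

text \<open>If no cluster is large, then the clusters of size at least \<open>L\<close> can be split into two
  families, balanced in \<open>V1\<close>, without an edge between them; there are at most \<open>2 ^ (N ^ m / L)\<close> such splittings.\<close>

lemma EE_not_big_of_dense:
  fixes L w :: real
  assumes ab: "0 \<le> \<alpha>" "1 \<le> \<beta>" and L: "0 < L" and w: "0 < w"
    and sub: "V1 \<subseteq> B m" "V2 \<subseteq> B m" and dis: "V1 \<inter> V2 = {}"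
    and a: "a \<subseteq> edges V1 \<union> edges V2"
    and U1: "w \<le> card {x \<in> V1. L \<le> card (cl a x)}" and U2: "w \<le> card {x \<in> V2. L \<le> card (cl a x)}"
  shows "EE (edges (B m) - (edges V1 \<union> edges V2)) (edge_prob \<alpha> \<beta>)
      (\<lambda>b. of_bool (\<not> big (B m) (w / 3) (a \<union> b)))
    \<le> exp (real N ^ m / L - \<alpha> * (w\<^sup>2 / 3 / \<beta> ^ m))"
proof -
  define X1 where "X1 = {x \<in> V1. L \<le> card (cl a x)}"
  define X2 where "X2 = {x \<in> V2. L \<le> card (cl a x)}"
  \<comment> \<open>Splittings are indexed by families of clusters of \<open>a\<close> rather than
    by sets of vertices: each cluster has at least \<open>L\<close> vertices, which bounds their
    number by \<open>N ^ m / L\<close>.\<close>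
  define CC where "CC = cl a ` (X1 \<union> X2)"
  define E where "E = edges (B m) - (edges V1 \<union> edges V2)"
  define T where "T = (\<lambda>A. between (A \<inter> X1) (X2 - A) \<union> between (X1 - A) (A \<inter> X2))"
  define Bal where "Bal = {\<A> \<in> Pow CC. w / 3 \<le> card (\<Union>\<A> \<inter> X1) \<and> w / 3 \<le> card (X1 - \<Union>\<A>)}"
  have b0: "0 < \<beta>" using ab by simp
  have p: "0 \<le> edge_prob \<alpha> \<beta> e \<and> edge_prob \<alpha> \<beta> e \<le> 1" for e using edge_prob_bounds[OF ab(1) b0] by auto
  have XV: "X1 \<subseteq> V1" "X2 \<subseteq> V2" by (auto simp: X1_def X2_def)
  have XB: "X1 \<subseteq> B m" "X2 \<subseteq> B m" using XV sub by auto
  have fX: "finite X1" "finite X2" using XB finite_sub_B by auto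
  have fE: "finite E" by (simp add: E_def)
  have aE: "a \<subseteq> edges (B m)" using a edges_mono[OF sub(1)] edges_mono[OF sub(2)] by blast
  have aP: "a \<subseteq> Pow (B m)" using aE edges_subset_Pow by blast
  have fCC: "finite CC" using fX by (simp add: CC_def)
  then have fBal: "finite Bal" by (simp add: Bal_def)
  have CC_L: "L \<le> card K" if "K \<in> CC" for K using that by (auto simp: CC_def X1_def X2_def)
  have CC_B: "K \<subseteq> B m" if K: "K \<in> CC" for K
  proof -
    obtain x where "x \<in> X1 \<union> X2" "K = cl a x" using K by (auto simp: CC_def)
    then show ?thesis using cl_subset[OF aP, of x] XB by auto
  qed
  have cardCC: "real (card CC) \<le> real N ^ m / L"
  proof -
    have "card CC * L = (\<Sum>K\<in>CC. L)" by simp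
    also have "\<dots> \<le> (\<Sum>K\<in>CC. real (card K))" using CC_L by (intro sum_mono) auto
    also have "\<dots> = real (card (\<Union>CC))"
    proof (subst card_Union_disjoint)
      show "pairwise disjnt CC"
        unfolding pairwise_def disjnt_def
      proof (intro ballI impI)
        fix K K' assume "K \<in> CC" "K' \<in> CC" "K \<noteq> K'"
        then obtain x y where xy: "K = cl a x" "K' = cl a y" by (auto simp: CC_def)
        show "K \<inter> K' = {}"
        proof (rule ccontr)
          assume "K \<inter> K' \<noteq> {}"
          then obtain z where "z \<in> K" "z \<in> K'" by auto
          then have "cl a z = K" "cl a z = K'" unfolding xy by (metis cl_eq)+
          then show False using \<open>K \<noteq> K'\<close> by simp
        qed
      qed
      show "finite K" if "K \<in> CC" for K by (rule finite_sub_B[OF CC_B[OF that]])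
    qed simp
    also have "\<dots> \<le> real (card (B m))" using CC_B by (intro of_nat_mono card_mono) auto
    finally show ?thesis using L by (simp add: card_B pos_le_divide_eq)
  qed
  have TE: "T A \<subseteq> E" for A
  proof -
    have d: "(A \<inter> X1) \<inter> (X2 - A) = {}" "(X1 - A) \<inter> (A \<inter> X2) = {}" by auto
    have "between (A \<inter> X1) (X2 - A) \<subseteq> edges (B m)"
      by (rule between_subset_edges[OF d(1)]) (use XB in auto)
    moreover have "between (X1 - A) (A \<inter> X2) \<subseteq> edges (B m)"
      by (rule between_subset_edges[OF d(2)]) (use XB in auto)
    moreover have "T A \<inter> (edges V1 \<union> edges V2) = {}"
      unfolding T_def using XV dis by (auto simp: between_def)
    ultimately show ?thesis unfolding E_def T_def by blast
  qed
  have pointwise: "of_bool (\<not> big (B m) (w / 3) (a \<union> b)) \<le> (\<Sum>\<A>\<in>Bal. of_bool (b \<inter> T (\<Union>\<A>) = {}) :: real)"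
    if b: "b \<subseteq> E" for b
  proof (cases "big (B m) (w / 3) (a \<union> b)")
    case True
    then show ?thesis by (simp add: sum_nonneg)
  next
    case False
    let ?\<omega> = "a \<union> b"
    have wE: "?\<omega> \<subseteq> edges (B m)" using aE b by (auto simp: E_def)
    then have int: "?\<omega> \<inter> edges (B m) = ?\<omega>" by auto
    have wP: "?\<omega> \<subseteq> Pow (B m)" using wE edges_subset_Pow by blast
    have "\<exists>Z\<subseteq>B m. (\<forall>x\<in>Z. cl ?\<omega> x \<subseteq> Z) \<and> w / 3 \<le> card (Z \<inter> X1) \<and> w / 3 \<le> card (X1 - Z)"
    proof (rule closed_set_balanced[OF finite_B wP XB(1) w])
      show "w \<le> card X1" using U1 by (simp add: X1_def)
      show "card (cl ?\<omega> x) < w / 3" if "x \<in> B m" for x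
        using False that unfolding big_def int by (auto simp: not_le)
    qed
    then obtain Z where Z: "\<And>x. x \<in> Z \<Longrightarrow> cl ?\<omega> x \<subseteq> Z"
      and Zb: "w / 3 \<le> card (Z \<inter> X1)" "w / 3 \<le> card (X1 - Z)" by blast
    \<comment> \<open>\<open>Z\<close> is closed for the larger configuration
      \<open>a \<union> b\<close>, hence on \<open>X1 \<union> X2\<close> it is a union of clusters
      of \<open>a\<close>; only finitely many such cuts exist before \<open>b\<close> is
      revealed.\<close>
    define \<A> where "\<A> = {K \<in> CC. K \<subseteq> Z}"
    have Zin: "x \<in> \<Union>\<A> \<longleftrightarrow> x \<in> Z" if "x \<in> X1 \<union> X2" for x
    proof
      assume x: "x \<in> Z"
      have "cl a x \<subseteq> cl ?\<omega> x" by (rule cl_mono) auto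
      then have "cl a x \<in> \<A>" using Z[OF x] that by (auto simp: \<A>_def CC_def)
      then show "x \<in> \<Union>\<A>" using cl_refl[of x a] by blast
    qed (auto simp: \<A>_def)
    have eq: "\<Union>\<A> \<inter> X1 = Z \<inter> X1" "X1 - \<Union>\<A> = X1 - Z" "\<Union>\<A> \<inter> X2 = Z \<inter> X2" "X2 - \<Union>\<A> = X2 - Z"
      using Zin by blast+
    have AB: "\<A> \<in> Bal" unfolding Bal_def using Zb eq by (auto simp: \<A>_def)
    have "{u, v} \<notin> b" if "u \<in> Z" "v \<notin> Z" for u v
      using Z[OF that(1)] that(2) cl_step[OF cl_refl, of u v ?\<omega>] by blast
    then have "{u, v} \<notin> b \<and> {v, u} \<notin> b" if "u \<in> Z" "v \<notin> Z" for u v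
      using that by (metis insert_commute)
    then have "b \<inter> T (\<Union>\<A>) = {}"
      unfolding T_def eq Int_Un_distrib Un_empty between_disjoint_iff by blast
    then have "of_bool (\<not> big (B m) (w / 3) (a \<union> b)) \<le> (of_bool (b \<inter> T (\<Union>\<A>) = {}) :: real)" by simp
    also have "\<dots> \<le> (\<Sum>\<A>\<in>Bal. of_bool (b \<inter> T (\<Union>\<A>) = {}))"
      by (rule member_le_sum[OF AB _ fBal]) simp
    finally show ?thesis .
  qed
  have "EE E (edge_prob \<alpha> \<beta>) (\<lambda>b. of_bool (\<not> big (B m) (w / 3) (a \<union> b)))
    \<le> EE E (edge_prob \<alpha> \<beta>) (\<lambda>b. \<Sum>\<A>\<in>Bal. of_bool (b \<inter> T (\<Union>\<A>) = {}))"
    by (rule EE_mono[OF p pointwise])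
  also have "\<dots> = (\<Sum>\<A>\<in>Bal. \<Prod>e\<in>T (\<Union>\<A>). 1 - edge_prob \<alpha> \<beta> e)"
    unfolding EE_sum by (intro sum.cong refl EE_all_closed[OF fE TE])
  also have "\<dots> \<le> (\<Sum>\<A>\<in>Bal. exp (- \<alpha> * (w\<^sup>2 / 3 / \<beta> ^ m)))"
  proof (rule sum_mono)
    fix \<A> assume A: "\<A> \<in> Bal"
    let ?A = "\<Union>\<A>"
    have split: "real (card X2) = real (card (?A \<inter> X2)) + real (card (X2 - ?A))"
    proof -
      have "card X2 = card (?A \<inter> X2) + card (X2 - ?A)"
        using card_Int_Diff[OF fX(2), of ?A] by (simp add: Int_commute)
      then show ?thesis by simp
    qed
    have "w\<^sup>2 / 3 = (w / 3) * w" by (simp add: power2_eq_square)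
    also have "\<dots> \<le> (w / 3) * real (card X2)" using U2 w by (intro mult_left_mono) (auto simp: X2_def)
    also have "\<dots> = (w / 3) * real (card (X2 - ?A)) + (w / 3) * real (card (?A \<inter> X2))"
      by (simp add: split algebra_simps)
    \<comment> \<open>Every vertex of \<open>X2\<close>, on whichever side of the cut, faces at
      least \<open>w / 3\<close> vertices of \<open>X1\<close> on the other side; balance in
      \<open>X1\<close> alone gives \<open>w * w / 3\<close> crossing pairs.\<close>
    also have "\<dots> \<le> real (card (?A \<inter> X1)) * real (card (X2 - ?A)) + real (card (X1 - ?A)) * real (card (?A \<inter> X2))"
      using A by (intro add_mono mult_right_mono) (auto simp: Bal_def)
    finally have c: "w\<^sup>2 / 3 \<le> real (card (?A \<inter> X1)) * real (card (X2 - ?A)) + real (card (X1 - ?A)) * real (card (?A \<inter> X2))" .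
    show "(\<Prod>e\<in>T ?A. 1 - edge_prob \<alpha> \<beta> e) \<le> exp (- \<alpha> * (w\<^sup>2 / 3 / \<beta> ^ m))"
      unfolding T_def by (rule prod_two_between_le[OF ab _ _ _ _ _ _ c]) (use XB XV dis in auto)
  qed
  also have "\<dots> = real (card Bal) * exp (- \<alpha> * (w\<^sup>2 / 3 / \<beta> ^ m))" by simp
  also have "\<dots> \<le> exp (real N ^ m / L) * exp (- \<alpha> * (w\<^sup>2 / 3 / \<beta> ^ m))"
  proof (rule mult_right_mono)
    have "card Bal \<le> card (Pow CC)" using fCC by (intro card_mono) (auto simp: Bal_def)
    then have "real (card Bal) \<le> 2 ^ card CC"
      by (simp add: card_Pow fCC)
    also have "\<dots> \<le> exp 1 ^ card CC" using exp_ge_add_one_self[of 1] by (intro power_mono) auto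
    also have "\<dots> = exp (real (card CC))" by (simp flip: exp_of_nat_mult)
    also have "\<dots> \<le> exp (real N ^ m / L)" using cardCC by simp
    finally show "real (card Bal) \<le> exp (real N ^ m / L)" .
  qed simp
  also have "\<dots> = exp (real N ^ m / L - \<alpha> * (w\<^sup>2 / 3 / \<beta> ^ m))" by (simp add: mult_exp_exp)
  finally show ?thesis unfolding E_def .
qed

text \<open>A reverse Markov inequality: \<open>cnt\<close> has mean at least
  \<open>p * N ^ n\<close> and never exceeds \<open>N ^ n\<close>.\<close>

lemma prob_dense:
  fixes L p :: real
  assumes ab: "0 \<le> \<alpha>" "0 < \<beta>" and p0: "0 \<le> p" and p: "p \<le> PB n \<alpha> \<beta> (\<lambda>\<omega>. of_bool (L \<le> card (C n \<omega>)))"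
  shows "p / 2 \<le> PB n \<alpha> \<beta> (\<lambda>\<omega>. of_bool (p / 2 * real N ^ n \<le> cnt (B n) L \<omega>))"
proof -
  have Nn: "0 < real N ^ n" using N2 by simp
  have "real N ^ n * p \<le> PB n \<alpha> \<beta> (\<lambda>\<omega>. real (cnt (B n) L \<omega>))"
    unfolding EE_cnt using p Nn by simp
  also have "\<dots> \<le> PB n \<alpha> \<beta> (\<lambda>\<omega>. real N ^ n * of_bool (p / 2 * real N ^ n \<le> cnt (B n) L \<omega>) + p / 2 * real N ^ n)"
  proof (intro PB_le ab)
    fix \<omega>
    have "cnt (B n) L \<omega> \<le> card (B n)" by (intro card_mono) auto
    then have "cnt (B n) L \<omega> \<le> N ^ n" by (simp add: card_B)
    then have "real (cnt (B n) L \<omega>) \<le> real N ^ n" by (simp only: of_nat_le_iff of_nat_power[symmetric])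
    moreover have "0 \<le> p / 2 * real N ^ n" using p0 Nn by simp
    ultimately have "real (cnt (B n) L \<omega>) \<le> real N ^ n + p / 2 * real N ^ n" by linarith
    moreover have "real (cnt (B n) L \<omega>) \<le> p / 2 * real N ^ n" if "\<not> p / 2 * real N ^ n \<le> cnt (B n) L \<omega>"
      using that by linarith
    ultimately show "real (cnt (B n) L \<omega>) \<le> real N ^ n * of_bool (p / 2 * real N ^ n \<le> cnt (B n) L \<omega>) + p / 2 * real N ^ n"
      by (cases "p / 2 * real N ^ n \<le> cnt (B n) L \<omega>") (simp_all only: of_bool_eq mult_1_right mult_zero_right add_0 not_False_eq_True)
  qed
  also have "\<dots> = real N ^ n * (PB n \<alpha> \<beta> (\<lambda>\<omega>. of_bool (p / 2 * real N ^ n \<le> cnt (B n) L \<omega>)) + p / 2)"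
    by (simp add: EE_add EE_cmult EE_const algebra_simps)
  finally show ?thesis using Nn by simp
qed

lemma cnt_Int: "cnt V s (\<omega> \<inter> edges V) = cnt V s \<omega>"
  by (simp add: Int_assoc)

lemma cnt_image:
  assumes "inj_on h V" "\<omega> \<subseteq> edges V"
  shows "cnt (h ` V) s ((`) h ` \<omega>) = cnt V s \<omega>"
proof -
  have 1: "(`) h ` \<omega> \<inter> edges (h ` V) = (`) h ` \<omega>"
    using assms(2) edges_image[OF assms(1)] by auto
  have 2: "\<omega> \<inter> edges V = \<omega>" using assms(2) by auto
  have P: "\<omega> \<subseteq> Pow V" using assms(2) edges_subset_Pow by blast
  have c: "card (cl ((`) h ` \<omega>) (h x)) = card (cl \<omega> x)" if "x \<in> V" for x
  proof -
    have "inj_on h (cl \<omega> x)" by (rule inj_on_subset[OF assms(1) cl_subset[OF P that]])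
    then show ?thesis unfolding cl_image[OF assms(1) P that] by (rule card_image)
  qed
  have "{y \<in> h ` V. s \<le> card (cl ((`) h ` \<omega>) y)} = h ` {x \<in> V. s \<le> card (cl \<omega> x)}"
    using c by auto
  then show ?thesis
    unfolding 1 2 using card_image[OF inj_on_subset[OF assms(1)], of "{x \<in> V. s \<le> card (cl \<omega> x)}"] by simp
qed

lemma EE_dense_hball:
  assumes "x \<in> hlattice N" "finite E" "edges (hball N n x) \<subseteq> E"
  shows "EE E (edge_prob \<alpha> \<beta>) (\<lambda>\<omega>. of_bool (w \<le> real (cnt (hball N n x) s \<omega>)))
    = PB n \<alpha> \<beta> (\<lambda>\<omega>. of_bool (w \<le> real (cnt (B n) s \<omega>)))"
proof -
  have "EE E (edge_prob \<alpha> \<beta>) (\<lambda>\<omega>. of_bool (w \<le> real (cnt (hball N n x) s \<omega>)))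
    = EE E (edge_prob \<alpha> \<beta>) (\<lambda>\<omega>. of_bool (w \<le> real (cnt (hball N n x) s (\<omega> \<inter> edges (hball N n x)))))"
    by (simp only: cnt_Int)
  also have "\<dots> = EE (edges (hball N n x)) (edge_prob \<alpha> \<beta>) (\<lambda>\<omega>. of_bool (w \<le> real (cnt (hball N n x) s \<omega>)))"
    by (rule EE_marginal[OF assms(2,3)])
  also have "\<dots> = PB n \<alpha> \<beta> (\<lambda>\<omega>. of_bool (w \<le> real (cnt (hball N n x) s ((`) (shift N x) ` \<omega>))))"
    by (rule EE_translate[OF assms(1)])
  also have "\<dots> = PB n \<alpha> \<beta> (\<lambda>\<omega>. of_bool (w \<le> real (cnt (B n) s \<omega>)))"
    unfolding shift_image_B[OF assms(1), symmetric]
    by (intro EE_cong refl) (simp only: cnt_image[OF inj_shift_B])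
  finally show ?thesis .
qed

definition unit_at :: "nat \<Rightarrow> nat \<Rightarrow> nat" where
  "unit_at n = (\<lambda>i. if i = n then 1 else 0)"

lemma unit_at_in_B: "unit_at n \<in> B (Suc n)"
proof -
  have "{i. unit_at n i \<noteq> 0} = {n}" by (auto simp: unit_at_def)
  then show ?thesis using N2 by (auto simp: hball_def hlattice_iff unit_at_def)
qed

lemma hball_unit_at_disjoint: "B n \<inter> hball N n (unit_at n) = {}"
  by (auto simp: hball_def unit_at_def)

text \<open>\<open>B (Suc n)\<close> contains \<open>B n\<close> and its disjoint translate by
  \<open>unit_at n\<close>, and one success suffices. Iterated, this drives the failure probability
  to 0 at the price of a constant factor in the density.\<close>

lemma prob_not_big_Suc_le_square:
  assumes "0 \<le> \<alpha>" "0 < \<beta>"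
  shows "prob_not_big \<alpha> \<beta> (Suc n) s \<le> (prob_not_big \<alpha> \<beta> n s)\<^sup>2"
proof -
  let ?V = "hball N n (unit_at n)"
  have sub: "B n \<subseteq> B (Suc n)" "?V \<subseteq> B (Suc n)"
    using B_mono[of n "Suc n"] hball_subset_B[OF unit_at_in_B, of n n] by auto
  have eh: "unit_at n \<in> hlattice N" using unit_at_in_B hball_subset by blast
  have "prob_not_big \<alpha> \<beta> (Suc n) s \<le> PB (Suc n) \<alpha> \<beta> (\<lambda>\<omega>. of_bool (\<not> big (B n) s \<omega>) * of_bool (\<not> big ?V s \<omega>))"
    unfolding prob_not_big_def
  proof (intro PB_le assms)
    fix \<omega>
    show "of_bool (\<not> big (B (Suc n)) s \<omega>) \<le> (of_bool (\<not> big (B n) s \<omega>) * of_bool (\<not> big ?V s \<omega>) :: real)"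
      using big_mono[OF finite_B sub(1)] big_mono[OF finite_B sub(2)] by auto
  qed
  also have "\<dots> = (prob_not_big \<alpha> \<beta> n s)\<^sup>2"
    by (rule EE_two_not_big[OF zero_in_hlattice eh finite_edges_B edges_mono[OF sub(1)] edges_mono[OF sub(2)] hball_unit_at_disjoint])
  finally show ?thesis .
qed

lemma prob_not_big_add_le_power:
  assumes "0 \<le> \<alpha>" "0 < \<beta>"
  shows "prob_not_big \<alpha> \<beta> (n + k) s \<le> prob_not_big \<alpha> \<beta> n s ^ (2 ^ k)"
proof (induction k)
  case (Suc k)
  have "prob_not_big \<alpha> \<beta> (Suc (n + k)) s \<le> (prob_not_big \<alpha> \<beta> (n + k) s)\<^sup>2" by (rule prob_not_big_Suc_le_square[OF assms])
  also have "\<dots> \<le> (prob_not_big \<alpha> \<beta> n s ^ (2 ^ k))\<^sup>2"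
    using Suc prob_not_big_bounds[OF assms] by (intro power_mono) auto
  also have "\<dots> = prob_not_big \<alpha> \<beta> n s ^ (2 ^ Suc k)" by (simp add: power_mult[symmetric] mult.commute)
  finally show ?case by simp
qed simp

text \<open>By independence both of two disjoint subballs are dense with probability at least
  \<open>q * q\<close>; the remaining edges of \<open>B (Suc n)\<close> then create a cluster of
  size \<open>w / 3\<close> with probability at least 1/2.\<close>

lemma prob_not_big_Suc_le_of_dense:
  fixes L w q :: real
  assumes ab: "0 \<le> \<alpha>" "1 \<le> \<beta>" and L: "0 < L" and w: "0 < w" and q: "0 \<le> q"
    and d: "q \<le> PB n \<alpha> \<beta> (\<lambda>\<omega>. of_bool (w \<le> cnt (B n) L \<omega>))"
    and e: "exp (real N ^ Suc n / L - \<alpha> * (w\<^sup>2 / 3 / \<beta> ^ Suc n)) \<le> 1 / 2"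
  shows "prob_not_big \<alpha> \<beta> (Suc n) (w / 3) \<le> 1 - q\<^sup>2 / 2"
proof -
  let ?V = "hball N n (unit_at n)"
  let ?J = "edges (B n) \<union> edges ?V" and ?E = "edges (B (Suc n))" and ?p = "edge_prob \<alpha> \<beta>"
  let ?d1 = "\<lambda>\<omega>. of_bool (w \<le> real (cnt (B n) L \<omega>)) :: real" and ?d2 = "\<lambda>\<omega>. of_bool (w \<le> real (cnt ?V L \<omega>)) :: real"
  have b0: "0 < \<beta>" using ab by simp
  have p: "0 \<le> edge_prob \<alpha> \<beta> e \<and> edge_prob \<alpha> \<beta> e \<le> 1" for e using edge_prob_bounds[OF ab(1) b0] by auto
  have sub: "B n \<subseteq> B (Suc n)" "?V \<subseteq> B (Suc n)"
    using B_mono[of n "Suc n"] hball_subset_B[OF unit_at_in_B, of n n] by auto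
  have eh: "unit_at n \<in> hlattice N" using unit_at_in_B hball_subset by blast
  have JE: "?J \<subseteq> ?E" using edges_mono[OF sub(1)] edges_mono[OF sub(2)] by blast
  have fJ: "finite ?J" by (rule finite_subset[OF JE finite_edges_B])
  have larger: "cnt V L a \<le> card {x \<in> V. L \<le> card (cl a x)}" if V: "V \<subseteq> B (Suc n)" and a: "a \<subseteq> ?J" for V a
  proof (rule card_mono)
    show "finite {x \<in> V. L \<le> card (cl a x)}" using finite_sub_B[OF V] by simp
    have aP: "a \<subseteq> Pow (B (Suc n))" using a JE edges_subset_Pow by blast
    show "{x \<in> V. L \<le> card (cl (a \<inter> edges V) x)} \<subseteq> {x \<in> V. L \<le> card (cl a x)}"
    proof safe
      fix x assume x: "x \<in> V" "L \<le> card (cl (a \<inter> edges V) x)"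
      have "x \<in> B (Suc n)" using x V by auto
      then have "finite (cl a x)" by (rule finite_subset[OF cl_subset[OF aP] finite_B])
      then have "card (cl (a \<inter> edges V) x) \<le> card (cl a x)" by (intro card_mono cl_mono) auto
      then show "L \<le> card (cl a x)" using x(2) by linarith
    qed
  qed
  have "prob_not_big \<alpha> \<beta> (Suc n) (w / 3) = EE ?J ?p (\<lambda>a. EE (?E - ?J) ?p (\<lambda>b. of_bool (\<not> big (B (Suc n)) (w / 3) (a \<union> b))))"
    unfolding prob_not_big_def by (rule EE_split[OF finite_edges_B JE])
  also have "\<dots> \<le> EE ?J ?p (\<lambda>a. 1 - 1 / 2 * (?d1 a * ?d2 a))"
  proof (rule EE_mono[OF p])
    fix a assume a: "a \<subseteq> ?J"
    show "EE (?E - ?J) ?p (\<lambda>b. of_bool (\<not> big (B (Suc n)) (w / 3) (a \<union> b))) \<le> 1 - 1 / 2 * (?d1 a * ?d2 a)"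
    proof (cases "w \<le> cnt (B n) L a \<and> w \<le> cnt ?V L a")
      case True
      have "w \<le> card {x \<in> B n. L \<le> card (cl a x)}" "w \<le> card {x \<in> ?V. L \<le> card (cl a x)}"
        using True larger[OF sub(1) a] larger[OF sub(2) a] by linarith+
      from EE_not_big_of_dense[OF ab L w sub hball_unit_at_disjoint a this] e
      have "EE (?E - ?J) ?p (\<lambda>b. of_bool (\<not> big (B (Suc n)) (w / 3) (a \<union> b))) \<le> 1 / 2" by linarith
      then show ?thesis using True by simp
    next
      case False
      then have "?d1 a * ?d2 a = 0" by auto
      moreover have "EE (?E - ?J) ?p (\<lambda>b. of_bool (\<not> big (B (Suc n)) (w / 3) (a \<union> b))) \<le> 1"
        by (rule EE_le_const) (use p in auto)
      ultimately show ?thesis by (simp only: mult_zero_right diff_0_right)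
    qed
  qed
  also have "\<dots> = 1 - 1 / 2 * EE ?J ?p (\<lambda>a. ?d1 a * ?d2 a)"
    using fJ by (simp only: EE_diff EE_cmult EE_const)
  also have "EE ?J ?p (\<lambda>a. ?d1 a * ?d2 a) = EE ?J ?p ?d1 * EE ?J ?p ?d2"
    using EE_indep[OF fJ edges_disjoint[OF hball_unit_at_disjoint[of n]], of ?p ?d1 ?d2] by (simp only: cnt_Int)
  also have "EE ?J ?p ?d1 = PB n \<alpha> \<beta> ?d1" by (rule EE_dense_hball[OF zero_in_hlattice fJ]) simp
  also have "EE ?J ?p ?d2 = PB n \<alpha> \<beta> ?d1" by (rule EE_dense_hball[OF eh fJ]) simp
  finally have "prob_not_big \<alpha> \<beta> (Suc n) (w / 3) \<le> 1 - 1 / 2 * (PB n \<alpha> \<beta> ?d1 * PB n \<alpha> \<beta> ?d1)" .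
  moreover have "q * q \<le> PB n \<alpha> \<beta> ?d1 * PB n \<alpha> \<beta> ?d1" using d q by (intro mult_mono) auto
  ultimately show ?thesis by (simp add: power2_eq_square)
qed

lemma prob_not_big_small_of_spread:
  assumes a: "0 < \<alpha>" and b: "1 \<le> \<beta>" "\<beta> < (real N)\<^sup>2" and p: "0 < p" "p \<le> 1" and H: "spread \<alpha> \<beta> p" and d: "0 < \<delta>"
  shows "\<exists>c>0. \<exists>n1. \<forall>n\<ge>n1. prob_not_big \<alpha> \<beta> n (c * real N ^ n) < \<delta>"
proof -
  have b0: "0 < \<beta>" and a0: "0 \<le> \<alpha>" and N0: "0 < real N" using a b N2 by auto
  \<comment> \<open>\<open>M\<close> and \<open>c0\<close> are tuned so that the entropy
    \<open>N ^ Suc n / L\<close> equals \<open>c0 * v ^ n\<close> while separation costs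
    \<open>2 * c0 * v ^ n\<close>; \<open>v > 1\<close> because \<beta> < N^2.\<close>
  define M where "M = 24 * real N * \<beta> / (\<alpha> * p\<^sup>2)"
  define v where "v = (real N)\<^sup>2 / \<beta>"
  define c0 where "c0 = \<alpha> * p\<^sup>2 / (24 * \<beta>)"
  define q where "q = p / 2"
  have M: "0 < M" using a b0 p N0 by (simp add: M_def)
  have v: "1 < v" using b b0 by (simp add: v_def)
  have c0: "0 < c0" using a b0 p by (simp add: c0_def)
  have q: "0 < q" "q \<le> 1 / 2" using p by (auto simp: q_def)
  obtain n1 where n1: "\<And>n. n1 \<le> n \<Longrightarrow> p \<le> PB n \<alpha> \<beta> (\<lambda>\<omega>. of_bool (M * (\<beta> / real N) ^ n \<le> card (C n \<omega>)))"
    using H M unfolding spread_def by meson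
  have "filterlim (\<lambda>n. v ^ n) at_top sequentially" using v by real_asymp
  then have "eventually (\<lambda>n. 1 / c0 \<le> v ^ n) sequentially" by (simp add: filterlim_at_top)
  then obtain n2 where n2: "\<And>n. n2 \<le> n \<Longrightarrow> 1 / c0 \<le> v ^ n" by (auto simp: eventually_sequentially)
  have step: "prob_not_big \<alpha> \<beta> (Suc n) (q * real N ^ n / 3) \<le> 1 - q\<^sup>2 / 2" if n: "max n1 n2 \<le> n" for n
  proof -
    let ?L = "M * (\<beta> / real N) ^ n" and ?w = "p / 2 * real N ^ n"
    have L: "0 < ?L" using M b0 N0 by simp
    have w: "0 < ?w" using p N0 by simp
    have "q \<le> PB n \<alpha> \<beta> (\<lambda>\<omega>. of_bool (?w \<le> cnt (B n) ?L \<omega>))"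
      unfolding q_def by (rule prob_dense[OF a0 b0]) (use p n1[of n] n in auto)
    moreover have "exp (real N ^ Suc n / ?L - \<alpha> * (?w\<^sup>2 / 3 / \<beta> ^ Suc n)) \<le> 1 / 2"
    proof -
      have vn: "v ^ n = real N ^ n * real N ^ n / \<beta> ^ n"
        by (simp add: v_def power_divide power2_eq_square power_mult_distrib)
      have "real N ^ Suc n / ?L = (real N / M) * v ^ n"
        unfolding vn using N0 by (simp add: power_divide)
      also have "real N / M = c0" using N0 b0 a p by (simp add: M_def c0_def)
      finally have 1: "real N ^ Suc n / ?L = c0 * v ^ n" .
      have 2: "\<alpha> * (?w\<^sup>2 / 3 / \<beta> ^ Suc n) = 2 * c0 * v ^ n"
        unfolding vn c0_def by (simp add: power2_eq_square mult_ac)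
      have "real N ^ Suc n / ?L - \<alpha> * (?w\<^sup>2 / 3 / \<beta> ^ Suc n) = - (c0 * v ^ n)" unfolding 1 2 by simp
      also have "\<dots> \<le> - 1"
      proof -
        have "c0 * (1 / c0) \<le> c0 * v ^ n" using n2[of n] n c0 by (intro mult_left_mono) auto
        then show ?thesis using c0 by simp
      qed
      finally have "exp (real N ^ Suc n / ?L - \<alpha> * (?w\<^sup>2 / 3 / \<beta> ^ Suc n)) \<le> exp (- 1)" by simp
      also have "\<dots> \<le> 1 / 2"
      proof -
        have "(2::real) \<le> exp 1" using exp_ge_add_one_self[of 1] by simp
        then show ?thesis by (simp add: exp_minus field_simps)
      qed
      finally show ?thesis .
    qed
    ultimately have "prob_not_big \<alpha> \<beta> (Suc n) (?w / 3) \<le> 1 - q\<^sup>2 / 2"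
      using prob_not_big_Suc_le_of_dense[OF a0 b(1) L w less_imp_le[OF q(1)]] by blast
    then show ?thesis by (simp add: q_def)
  qed
  define r where "r = 1 - q\<^sup>2 / 2"
  have r: "0 < r" "r < 1"
  proof -
    have "q\<^sup>2 \<le> (1 / 2)\<^sup>2" using q by (intro power_mono) auto
    then show "0 < r" by (simp add: r_def power2_eq_square)
    show "r < 1" using q by (simp add: r_def)
  qed
  have "(\<lambda>k. r ^ k) \<longlonglongrightarrow> 0" using r by (intro LIMSEQ_power_zero) auto
  then have "eventually (\<lambda>k. r ^ k < \<delta>) sequentially" by (rule order_tendstoD) (rule d)
  then obtain k where k: "r ^ k < \<delta>" by (auto simp: eventually_sequentially)
  \<comment> \<open>Climbing \<open>k\<close> levels divides the density by \<open>N ^ k\<close> and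
    raises the failure bound \<open>r\<close> to the power \<open>2 ^ k\<close>; one more factor
    \<open>N\<close> stems from \<open>Suc m\<close> in \<open>step\<close>, the 3 from the balanced
    splitting.\<close>
  define c where "c = q / (3 * real N ^ Suc k)"
  have "prob_not_big \<alpha> \<beta> n (c * real N ^ n) < \<delta>" if n: "max n1 n2 + Suc k \<le> n" for n
  proof -
    define m where "m = n - Suc k"
    have m: "n = Suc m + k" "max n1 n2 \<le> m" using n by (auto simp: m_def)
    have "real N ^ n = real N ^ Suc k * real N ^ m" unfolding m(1) by (simp add: power_add)
    then have s: "c * real N ^ n = q * real N ^ m / 3" using N0 by (simp add: c_def)
    have "prob_not_big \<alpha> \<beta> n (c * real N ^ n) \<le> prob_not_big \<alpha> \<beta> (Suc m) (q * real N ^ m / 3) ^ (2 ^ k)"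
      unfolding s unfolding m(1) by (rule prob_not_big_add_le_power[OF a0 b0])
    also have "\<dots> \<le> r ^ (2 ^ k)"
      using step[OF m(2)] prob_not_big_bounds[OF a0 b0] by (intro power_mono) (auto simp: r_def)
    also have "\<dots> \<le> r ^ k" using r less_exp[of k] by (intro power_decreasing) auto
    finally show ?thesis using k by simp
  qed
  moreover have "0 < c" using q N0 by (simp add: c_def)
  ultimately show ?thesis by blast
qed

end

section \<open>Sharpness of the transition\<close>

text \<open>The exterior of a finite set of vertices is contracted to a ghost vertex. The singleton \<open>{x}\<close>
  stands for the edge from \<open>x\<close> to the ghost; in \<open>cl\<close> it is a loop and has no effect.\<close>

definition gedges :: "'v set \<Rightarrow> 'v set set" where
  "gedges V = edges V \<union> (\<lambda>x. {x}) ` V"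

text \<open>Paths never run through the ghost: two vertices joined only by way of it remain in
  different clusters.\<close>

definition touch :: "'v set set \<Rightarrow> 'v \<Rightarrow> bool" where
  "touch \<omega> x \<longleftrightarrow> (\<exists>y\<in>cl \<omega> x. {y} \<in> \<omega>)"

lemma finite_gedges: "finite V \<Longrightarrow> finite (gedges V)"
  by (simp add: gedges_def finite_edges)

lemma gedges_subset_Pow: "gedges V \<subseteq> Pow V"
  using edges_subset_Pow by (auto simp: gedges_def)

lemma singleton_notin_edges [simp]: "{x} \<notin> edges V"
  by (auto simp: edges_def doubleton_eq_iff singleton_insert_inj_eq)

lemma singleton_in_gedges [simp]: "{x} \<in> gedges V \<longleftrightarrow> x \<in> V"
  by (auto simp: gedges_def)

lemma doubleton_in_gedges [simp]: "{x, y} \<in> gedges V \<longleftrightarrow> x \<in> V \<and> y \<in> V"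
  by (cases "x = y") (auto simp: gedges_def singleton_insert_inj_eq)

lemma edges_subset_gedges: "edges V \<subseteq> gedges V"
  by (auto simp: gedges_def)

lemma touch_mono: "\<omega> \<subseteq> \<omega>' \<Longrightarrow> touch \<omega> x \<Longrightarrow> touch \<omega>' x"
  unfolding touch_def using cl_mono[of \<omega> \<omega>' x] by blast

lemma touch_cl: "y \<in> cl \<omega> x \<Longrightarrow> touch \<omega> y \<longleftrightarrow> touch \<omega> x"
  unfolding touch_def by (simp add: cl_eq)

lemma cl_remove_loops:
  assumes "\<And>u v. u \<noteq> v \<Longrightarrow> {u, v} \<in> \<omega> \<longleftrightarrow> {u, v} \<in> \<omega>'"
  shows "cl \<omega> x = cl \<omega>' x"
proof
  show "cl \<omega> x \<subseteq> cl \<omega>' x"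
  proof (rule cl_subset_closed)
    fix u v assume "u \<in> cl \<omega>' x" "{u, v} \<in> \<omega>"
    then show "v \<in> cl \<omega>' x" using assms[of u v] cl_step[of u \<omega>' x v] by (cases "u = v") auto
  qed simp
  show "cl \<omega>' x \<subseteq> cl \<omega> x"
  proof (rule cl_subset_closed)
    fix u v assume "u \<in> cl \<omega> x" "{u, v} \<in> \<omega>'"
    then show "v \<in> cl \<omega> x" using assms[of u v] cl_step[of u \<omega> x v] by (cases "u = v") auto
  qed simp
qed

lemma EE_indep3:
  assumes "finite E" "A1 \<inter> A2 = {}" "A1 \<inter> A3 = {}" "A2 \<inter> A3 = {}"
  shows "EE E p (\<lambda>\<omega>. F (\<omega> \<inter> A1) * (G (\<omega> \<inter> A2) * H (\<omega> \<inter> A3)))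
    = EE E p (\<lambda>\<omega>. F (\<omega> \<inter> A1)) * (EE E p (\<lambda>\<omega>. G (\<omega> \<inter> A2)) * EE E p (\<lambda>\<omega>. H (\<omega> \<inter> A3)))"
proof -
  have int: "\<omega> \<inter> (A2 \<union> A3) \<inter> A2 = \<omega> \<inter> A2" "\<omega> \<inter> (A2 \<union> A3) \<inter> A3 = \<omega> \<inter> A3" for \<omega> by auto
  have "A1 \<inter> (A2 \<union> A3) = {}" using assms by auto
  from EE_indep[OF assms(1) this, of p F "\<lambda>a. G (a \<inter> A2) * H (a \<inter> A3)"]
  show ?thesis unfolding int EE_indep[OF assms(1,4)] .
qed

abbreviation pr :: "('e \<Rightarrow> real) \<Rightarrow> real \<Rightarrow> 'e \<Rightarrow> real" where
  "pr J \<alpha> \<equiv> (\<lambda>e. 1 - exp (- \<alpha> * J e))"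

definition unreached :: "'v set \<Rightarrow> 'v set set \<Rightarrow> 'v set" where
  "unreached V \<omega> = {x \<in> V. \<not> touch \<omega> x}"

text \<open>A path to the ghost avoids the unreached set altogether, so edges with both ends in
  \<open>S\<close> neither help nor matter for the event that \<open>S\<close> is this set. It is
  therefore independent of the connections inside \<open>S\<close>.\<close>

lemma unreached_diff_edges:
  assumes w: "\<omega> \<subseteq> gedges V" and S: "S \<subseteq> V"
  shows "unreached V (\<omega> - edges S) = S \<longleftrightarrow> unreached V \<omega> = S"
proof
  let ?w = "\<omega> - edges S"
  assume *: "unreached V \<omega> = S"
  have "touch ?w x" if x: "x \<in> V" "touch \<omega> x" for x
  proof -
    have out: "u \<notin> S" if "u \<in> cl \<omega> x" for u
      using touch_cl[OF that] x(2) * by (auto simp: unreached_def)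
    have "cl ?w x = cl \<omega> x"
      by (rule cl_eqI) (use out in auto)
    then show ?thesis using x(2) by (auto simp: touch_def)
  qed
  moreover have "touch \<omega> x" if "touch ?w x" for x using touch_mono[OF _ that] by auto
  ultimately have "unreached V ?w = unreached V \<omega>" by (auto simp: unreached_def)
  then show "unreached V ?w = S" using * by simp
next
  let ?w = "\<omega> - edges S"
  assume *: "unreached V ?w = S"
  have "\<not> touch \<omega> x" if x: "x \<in> S" for x
  proof
    assume "touch \<omega> x"
    then obtain z where z: "z \<in> cl \<omega> x" "{z} \<in> \<omega>" by (auto simp: touch_def)
    have "cl \<omega> x \<subseteq> S"
    proof (rule cl_subset_closed[OF x])
      fix u v assume u: "u \<in> S" and uv: "{u, v} \<in> \<omega>"
      show "v \<in> S"
      proof (cases "{u, v} \<in> edges S")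
        case False
        then have "v \<in> cl ?w u" using uv cl_step[OF cl_refl, of u v ?w] by auto
        then have "touch ?w v \<longleftrightarrow> touch ?w u" by (rule touch_cl)
        moreover have "\<not> touch ?w u" using u * by (auto simp: unreached_def)
        moreover have "v \<in> V" using uv w gedges_subset_Pow by blast
        ultimately show ?thesis using * by (auto simp: unreached_def)
      qed auto
    qed
    then have "z \<in> S" using z by auto
    moreover have "touch ?w z" unfolding touch_def using z(2) by (intro bexI[of _ z]) auto
    ultimately show False using * by (auto simp: unreached_def)
  qed
  moreover have "touch \<omega> x" if "touch ?w x" for x using touch_mono[OF _ that] by auto
  ultimately show "unreached V \<omega> = S" using * S by (auto simp: unreached_def)
qed

text \<open>The ghost counts as a vertex outside \<open>S\<close>, hence the term
  \<open>J {x}\<close>.\<close>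

definition outJ :: "('v set \<Rightarrow> real) \<Rightarrow> 'v set \<Rightarrow> 'v set \<Rightarrow> 'v \<Rightarrow> real" where
  "outJ J V S x = J {x} + (\<Sum>y\<in>V - S. J {x, y})"

text \<open>If \<open>x0\<close> misses the ghost, only \<open>S = unreached V \<omega>\<close>
  contributes on the left. Opening an edge from the cluster of \<open>x0\<close> to the complement
  of this set, or to the ghost, connects \<open>x0\<close> to the ghost. The bound is pointwise, so
  expectations can be taken afterwards.\<close>

lemma pivotal_sum_ge:
  assumes fV: "finite V" and x0: "x0 \<in> V" and J: "\<And>e. 0 \<le> J e" and w: "\<omega> \<subseteq> gedges V"
  defines "F \<equiv> \<lambda>\<omega>. of_bool (touch \<omega> x0) :: real"
  shows "(\<Sum>S\<in>{S. S \<subseteq> V \<and> x0 \<in> S}. \<Sum>x\<in>S. outJ J V S x * (of_bool (unreached V \<omega> = S) * of_bool (x \<in> cl (\<omega> \<inter> edges S) x0)))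
    \<le> (\<Sum>e\<in>gedges V. J e * (F (insert e \<omega>) - F \<omega>))"
proof -
  let ?II = "{S. S \<subseteq> V \<and> x0 \<in> S}"
  have fII: "finite ?II" by (rule finite_subset[of _ "Pow V"]) (use fV in auto)
  have Finc: "0 \<le> J e * (F (insert e \<omega>) - F \<omega>)" for e
    using J[of e] touch_mono[of \<omega> "insert e \<omega>" x0] by (auto simp: F_def)
  show ?thesis
  proof (cases "touch \<omega> x0")
    case True
    then have "(\<Sum>S\<in>?II. \<Sum>x\<in>S. outJ J V S x * (of_bool (unreached V \<omega> = S) * of_bool (x \<in> cl (\<omega> \<inter> edges S) x0))) = 0"
      by (intro sum.neutral ballI) (auto simp: unreached_def)
    then show ?thesis using Finc by (simp add: sum_nonneg)
  next
    case False
    let ?S = "unreached V \<omega>" and ?C = "cl \<omega> x0"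
    have SV: "?S \<subseteq> V" by (auto simp: unreached_def)
    have SI: "?S \<in> ?II" using x0 False by (auto simp: unreached_def)
    have CV: "?C \<subseteq> V" by (rule cl_subset) (use w gedges_subset_Pow x0 in auto)
    have CS: "?C \<subseteq> ?S" using CV touch_cl[of _ \<omega> x0] False by (auto simp: unreached_def)
    have fC: "finite ?C" using CV fV by (rule finite_subset)
    have fS: "finite ?S" using SV fV by (rule finite_subset)
    have pos: "0 \<le> outJ J V S x" for S x using J by (simp add: outJ_def sum_nonneg)
    have "(\<Sum>S\<in>?II. \<Sum>x\<in>S. outJ J V S x * (of_bool (unreached V \<omega> = S) * of_bool (x \<in> cl (\<omega> \<inter> edges S) x0)))
      = (\<Sum>S\<in>?II. if S = ?S then (\<Sum>x\<in>S. outJ J V S x * of_bool (x \<in> cl (\<omega> \<inter> edges S) x0)) else 0)"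
      by (intro sum.cong refl) auto
    also have "\<dots> = (\<Sum>x\<in>?S. outJ J V ?S x * of_bool (x \<in> cl (\<omega> \<inter> edges ?S) x0))"
      using fII SI by (simp add: sum.delta)
    also have "\<dots> \<le> (\<Sum>x\<in>?S. outJ J V ?S x * of_bool (x \<in> ?C))"
    proof (intro sum_mono mult_left_mono pos)
      fix x
      have "cl (\<omega> \<inter> edges ?S) x0 \<subseteq> ?C" by (rule cl_mono) auto
      then show "(of_bool (x \<in> cl (\<omega> \<inter> edges ?S) x0) :: real) \<le> of_bool (x \<in> ?C)" by auto
    qed
    also have "\<dots> = (\<Sum>x\<in>?C. outJ J V ?S x)"
      using CS fS by (intro sum.mono_neutral_cong_right) auto
    also have "\<dots> = (\<Sum>e\<in>(\<lambda>x. {x}) ` ?C. J e) + (\<Sum>e\<in>between ?C (V - ?S). J e)"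
    proof -
      have d: "?C \<inter> (V - ?S) = {}" using CS by auto
      have "(\<Sum>e\<in>between ?C (V - ?S). J e) = (\<Sum>x\<in>?C. \<Sum>y\<in>V - ?S. J {x, y})"
        unfolding between_def sum.reindex[OF inj_on_between[OF d]]
        by (simp add: sum.cartesian_product case_prod_beta o_def)
      moreover have "(\<Sum>e\<in>(\<lambda>x. {x}) ` ?C. J e) = (\<Sum>x\<in>?C. J {x})"
        by (subst sum.reindex) (auto simp: inj_on_def)
      ultimately show ?thesis by (simp add: outJ_def sum.distrib)
    qed
    also have "\<dots> = (\<Sum>e\<in>(\<lambda>x. {x}) ` ?C \<union> between ?C (V - ?S). J e)"
    proof (rule sum.union_disjoint[symmetric])
      show "(\<lambda>x. {x}) ` ?C \<inter> between ?C (V - ?S) = {}"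
        using CS by (auto simp: between_def)
    qed (use fC fV in \<open>auto intro: finite_between\<close>)
    also have "\<dots> = (\<Sum>e\<in>(\<lambda>x. {x}) ` ?C \<union> between ?C (V - ?S). J e * (F (insert e \<omega>) - F \<omega>))"
    proof (intro sum.cong refl)
      fix e assume "e \<in> (\<lambda>x. {x}) ` ?C \<union> between ?C (V - ?S)"
      then consider x where "x \<in> ?C" "e = {x}" | x y where "x \<in> ?C" "y \<in> V - ?S" "e = {x, y}"
        by (auto simp: between_def)
      then have "touch (insert e \<omega>) x0"
      proof cases
        case 1
        have "x \<in> cl (insert e \<omega>) x0" using 1(1) cl_mono[of \<omega> "insert e \<omega>" x0] by auto
        then show ?thesis unfolding touch_def using 1(2) by auto
      next
        case 2
        have x: "x \<in> cl (insert e \<omega>) x0" using 2(1) cl_mono[of \<omega> "insert e \<omega>" x0] by auto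
        have y: "y \<in> cl (insert e \<omega>) x0" by (rule cl_step[OF x]) (use 2(3) in simp)
        have "touch \<omega> y" using 2(2) by (auto simp: unreached_def)
        then have "touch (insert e \<omega>) y" by (rule touch_mono[rotated]) auto
        then show ?thesis using touch_cl[OF y] by simp
      qed
      then show "J e = J e * (F (insert e \<omega>) - F \<omega>)" using False by (simp add: F_def)
    qed
    also have "\<dots> \<le> (\<Sum>e\<in>gedges V. J e * (F (insert e \<omega>) - F \<omega>))"
    proof (rule sum_mono2[OF finite_gedges[OF fV]])
      have "between ?C (V - ?S) \<subseteq> edges V" by (rule between_subset_edges) (use CS CV in auto)
      then show "(\<lambda>x. {x}) ` ?C \<union> between ?C (V - ?S) \<subseteq> gedges V" using CV by (auto simp: gedges_def)
    qed (rule Finc)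
    finally show ?thesis .
  qed
qed

text \<open>The set \<open>S\<close> of vertices not connected to the ghost is independent of the edges inside \<open>S\<close>, and
  every edge from the cluster of \<open>x0\<close> within \<open>S\<close> to the complement of \<open>S\<close> is pivotal; with Russo's
  formula this gives the differential inequality of Duminil-Copin and Tassion.\<close>

lemma touch_prob_ge:
  assumes fV: "finite V" and x0: "x0 \<in> V" and J: "\<And>e. 0 \<le> J e" and a0: "0 < a0" and aa: "a0 \<le> a1"
    and phi: "\<And>S. S \<subseteq> V \<Longrightarrow> x0 \<in> S \<Longrightarrow>
      1 \<le> a0 * (\<Sum>x\<in>S. outJ J V S x * EE (edges S) (pr J a0) (\<lambda>\<omega>. of_bool (x \<in> cl \<omega> x0)))"
  shows "1 - exp (- (a1 - a0) / a0) \<le> EE (gedges V) (pr J a1) (\<lambda>\<omega>. of_bool (touch \<omega> x0))"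
proof -
  define F :: "'a set set \<Rightarrow> real" where "F = (\<lambda>\<omega>. of_bool (touch \<omega> x0))"
  define f where "f = (\<lambda>a. EE (gedges V) (pr J a) F)"
  define f' where "f' = (\<lambda>a. EE (gedges V) (pr J a) (\<lambda>\<omega>. \<Sum>e\<in>gedges V. J e * (F (insert e \<omega>) - F \<omega>)))"
  let ?II = "{S. S \<subseteq> V \<and> x0 \<in> S}"
  have fE: "finite (gedges V)" by (rule finite_gedges[OF fV])
  have fII: "finite ?II" by (rule finite_subset[of _ "Pow V"]) (use fV in auto)
  have p: "0 \<le> pr J a e \<and> pr J a e \<le> 1" if "0 \<le> a" for a e using that J[of e] by simp
  have der: "(f has_real_derivative f' a) (at a)" for a
    unfolding f_def f'_def by (rule EE_has_derivative[OF fE])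
  have f'_ge: "(1 - f a) / a0 \<le> f' a" if a: "a0 \<le> a" for a
  proof -
    have an: "0 \<le> a" using a a0 by simp
    have "1 - f a = EE (gedges V) (pr J a) (\<lambda>\<omega>. 1 - F \<omega>)"
      using fE by (simp add: f_def EE_diff EE_const)
    \<comment> \<open>The values of \<open>unreached V \<omega>\<close> that contain
      \<open>x0\<close> partition the event that \<open>x0\<close> misses the ghost.\<close>
    also have "\<dots> = EE (gedges V) (pr J a) (\<lambda>\<omega>. \<Sum>S\<in>?II. of_bool (unreached V \<omega> = S))"
    proof (intro EE_cong refl)
      fix \<omega>
      have "(\<Sum>S\<in>?II. of_bool (unreached V \<omega> = S)) = (\<Sum>S\<in>?II. if S = unreached V \<omega> then 1 else (0::real))"
        by (intro sum.cong refl) auto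
      also have "\<dots> = of_bool (unreached V \<omega> \<in> ?II)" using fII by (simp add: sum.delta)
      also have "\<dots> = 1 - F \<omega>" using x0 by (auto simp: unreached_def F_def)
      finally show "1 - F \<omega> = (\<Sum>S\<in>?II. of_bool (unreached V \<omega> = S))" ..
    qed
    also have "\<dots> = (\<Sum>S\<in>?II. EE (gedges V) (pr J a) (\<lambda>\<omega>. of_bool (unreached V \<omega> = S)))" by (rule EE_sum)
    finally have 1: "1 - f a = (\<Sum>S\<in>?II. EE (gedges V) (pr J a) (\<lambda>\<omega>. of_bool (unreached V \<omega> = S)))" .
    have "(1 - f a) / a0 = (\<Sum>S\<in>?II. EE (gedges V) (pr J a) (\<lambda>\<omega>. of_bool (unreached V \<omega> = S)) / a0)"
      unfolding 1 sum_divide_distrib ..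
    also have "\<dots> \<le> (\<Sum>S\<in>?II. \<Sum>x\<in>S. outJ J V S x * (EE (gedges V) (pr J a) (\<lambda>\<omega>. of_bool (unreached V \<omega> = S) * of_bool (x \<in> cl (\<omega> \<inter> edges S) x0))))"
    proof (rule sum_mono)
      fix S assume S: "S \<in> ?II"
      let ?P = "EE (gedges V) (pr J a) (\<lambda>\<omega>. of_bool (unreached V \<omega> = S))"
      have sub: "edges S \<subseteq> gedges V" using S edges_mono[of S V] edges_subset_gedges[of V] by auto
      have indep: "EE (gedges V) (pr J a) (\<lambda>\<omega>. of_bool (unreached V \<omega> = S) * of_bool (x \<in> cl (\<omega> \<inter> edges S) x0))
        = ?P * EE (edges S) (pr J a) (\<lambda>\<omega>. of_bool (x \<in> cl \<omega> x0))" for x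
      proof -
        have n: "of_bool (unreached V \<omega> = S) = (of_bool (unreached V (\<omega> \<inter> - edges S) = S) :: real)" if "\<omega> \<subseteq> gedges V" for \<omega>
          using unreached_diff_edges[OF that, of S] S by (simp add: Diff_eq)
        have "EE (gedges V) (pr J a) (\<lambda>\<omega>. of_bool (unreached V \<omega> = S) * of_bool (x \<in> cl (\<omega> \<inter> edges S) x0))
          = EE (gedges V) (pr J a) (\<lambda>\<omega>. of_bool (unreached V (\<omega> \<inter> - edges S) = S) * of_bool (x \<in> cl (\<omega> \<inter> edges S) x0))"
          by (intro EE_cong refl) (simp only: n)
        also have "\<dots> = EE (gedges V) (pr J a) (\<lambda>\<omega>. of_bool (unreached V (\<omega> \<inter> - edges S) = S))
          * EE (gedges V) (pr J a) (\<lambda>\<omega>. of_bool (x \<in> cl (\<omega> \<inter> edges S) x0))"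
          by (rule EE_indep[OF fE]) auto
        also have "EE (gedges V) (pr J a) (\<lambda>\<omega>. of_bool (unreached V (\<omega> \<inter> - edges S) = S)) = ?P"
          by (intro EE_cong refl) (simp only: n)
        also have "EE (gedges V) (pr J a) (\<lambda>\<omega>. of_bool (x \<in> cl (\<omega> \<inter> edges S) x0))
          = EE (edges S) (pr J a) (\<lambda>\<omega>. of_bool (x \<in> cl \<omega> x0))"
          by (rule EE_marginal[OF fE sub])
        finally show ?thesis .
      qed
      have fS: "finite (edges S)" by (rule finite_subset[OF sub fE])
      \<comment> \<open>Connection inside \<open>S\<close> is increasing in the parameter, so the
        hypothesis at \<open>a0\<close> serves every \<open>a \<ge> a0\<close>.\<close>
      have mono: "EE (edges S) (pr J a0) (\<lambda>\<omega>. of_bool (x \<in> cl \<omega> x0)) \<le> EE (edges S) (pr J a) (\<lambda>\<omega>. of_bool (x \<in> cl \<omega> x0))" for x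
      proof (rule EE_mono_prob[OF fS])
        fix e
        show "0 \<le> pr J a0 e \<and> pr J a0 e \<le> pr J a e \<and> pr J a e \<le> 1"
          using J[of e] a a0 by (auto intro!: mult_right_mono)
      next
        fix \<omega> \<omega>' :: "'a set set" assume "\<omega> \<subseteq> \<omega>'"
        then show "(of_bool (x \<in> cl \<omega> x0) :: real) \<le> of_bool (x \<in> cl \<omega>' x0)" using cl_mono[of \<omega> \<omega>' x0] by auto
      qed
      have pos: "0 \<le> outJ J V S x" for x using J by (simp add: outJ_def sum_nonneg)
      have "1 / a0 \<le> (\<Sum>x\<in>S. outJ J V S x * EE (edges S) (pr J a0) (\<lambda>\<omega>. of_bool (x \<in> cl \<omega> x0)))"
        using phi[of S] S a0 by (simp add: pos_divide_le_eq mult.commute)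
      also have "\<dots> \<le> (\<Sum>x\<in>S. outJ J V S x * EE (edges S) (pr J a) (\<lambda>\<omega>. of_bool (x \<in> cl \<omega> x0)))"
        by (intro sum_mono mult_left_mono mono pos)
      finally have q: "1 / a0 \<le> (\<Sum>x\<in>S. outJ J V S x * EE (edges S) (pr J a) (\<lambda>\<omega>. of_bool (x \<in> cl \<omega> x0)))" .
      have "0 \<le> ?P" using p[OF an] by (intro EE_nonneg) auto
      then have "?P * (1 / a0) \<le> ?P * (\<Sum>x\<in>S. outJ J V S x * EE (edges S) (pr J a) (\<lambda>\<omega>. of_bool (x \<in> cl \<omega> x0)))"
        using q by (rule mult_left_mono[rotated])
      then show "?P / a0 \<le> (\<Sum>x\<in>S. outJ J V S x * (EE (gedges V) (pr J a) (\<lambda>\<omega>. of_bool (unreached V \<omega> = S) * of_bool (x \<in> cl (\<omega> \<inter> edges S) x0))))"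
        unfolding indep by (simp add: sum_distrib_left mult_ac)
    qed
    also have "\<dots> = EE (gedges V) (pr J a) (\<lambda>\<omega>. \<Sum>S\<in>?II. \<Sum>x\<in>S. outJ J V S x * (of_bool (unreached V \<omega> = S) * of_bool (x \<in> cl (\<omega> \<inter> edges S) x0)))"
      unfolding EE_sum EE_cmult ..
    also have "\<dots> \<le> f' a"
      unfolding f'_def F_def by (rule EE_mono[OF p[OF an]]) (rule pivotal_sum_ge[OF fV x0 J])
    finally show ?thesis .
  qed
  \<comment> \<open>An integrating factor: \<open>f' \<ge> (1 - f) / a0\<close> says that this
    product does not increase.\<close>
  define h where "h = (\<lambda>a. (1 - f a) * exp (a / a0))"
  have "h a1 \<le> h a0"
  proof (rule DERIV_nonpos_imp_nonincreasing[OF aa])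
    fix a assume a: "a0 \<le> a" "a \<le> a1"
    have "(h has_real_derivative ((1 - f a) / a0 - f' a) * exp (a / a0)) (at a)"
      unfolding h_def by (rule derivative_eq_intros der refl | use a0 in \<open>simp add: field_simps\<close>)+
    moreover have "((1 - f a) / a0 - f' a) * exp (a / a0) \<le> 0"
      using f'_ge[OF a(1)] by (intro mult_nonpos_nonneg) auto
    ultimately show "\<exists>y. (h has_real_derivative y) (at a) \<and> y \<le> 0" by blast
  qed
  moreover have "0 \<le> f a0" unfolding f_def F_def using p[of a0] a0 by (intro EE_nonneg) auto
  then have "h a0 \<le> exp 1" using a0 by (simp add: h_def)
  ultimately have "(1 - f a1) * exp (a1 / a0) \<le> exp 1" by (simp add: h_def)
  then have "1 - f a1 \<le> exp 1 / exp (a1 / a0)" by (simp add: pos_le_divide_eq)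
  also have "\<dots> = exp (- (a1 - a0) / a0)" using a0 by (simp add: exp_diff[symmetric] diff_divide_distrib)
  finally show ?thesis unfolding f_def F_def by simp
qed

section \<open>The hierarchical lattice with a ghost, parameter comparison and percolation from
  phi\<close>

context hierarchical
begin

text \<open>A ghost edge, recognized by cardinality 1, carries the total weight of all edges from
  its vertex to the complement of \<open>B n\<close>.\<close>

definition ghost_weight :: "real \<Rightarrow> nat \<Rightarrow> (nat \<Rightarrow> nat) set \<Rightarrow> real" where
  "ghost_weight \<beta> n e = (if card e = 1 then rho \<beta> n else 1 / \<beta> ^ pair_dist e)"

lemma ghost_weight_singleton [simp]: "ghost_weight \<beta> n {x} = rho \<beta> n"
  by (simp add: ghost_weight_def)

lemma ghost_weight_doubleton: "x \<noteq> y \<Longrightarrow> ghost_weight \<beta> n {x, y} = 1 / \<beta> ^ hdist x y"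
  by (simp add: ghost_weight_def pair_dist_doubleton)

lemma ghost_weight_nonneg: "real N < \<beta> \<Longrightarrow> 0 \<le> ghost_weight \<beta> n e"
  using rho_pos[of \<beta> n] by (auto simp: ghost_weight_def)

lemma pr_ghost_weight_eq_edge_prob:
  assumes "e \<in> edges V"
  shows "pr (ghost_weight \<beta> n) \<alpha> e = edge_prob \<alpha> \<beta> e"
proof -
  obtain x y where e: "e = {x, y}" "x \<noteq> y" using assms by (auto simp: edges_def)
  show ?thesis unfolding e(1) ghost_weight_doubleton[OF e(2)] by (simp add: edge_prob_def pair_dist_doubleton)
qed

text \<open>Bundling independent edges into one with the sum of their weights preserves the
  probability that all are closed. An arbitrary \<open>x\<close> is allowed because
  \<open>escape_prob_le_phi\<close> restarts from the far end of an exit edge.\<close>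

lemma ghost_escape_prob:
  assumes x: "x \<in> B n"
  shows "EE (gedges (B n)) (pr (ghost_weight \<beta> n) \<alpha>) (\<lambda>\<omega>. of_bool (touch \<omega> x)) = escape_prob \<alpha> \<beta> n"
proof -
  let ?E = "gedges (B n)" and ?J = "edges (B n)" and ?p = "pr (ghost_weight \<beta> n) \<alpha>"
  have fE: "finite ?E" by (rule finite_gedges[OF finite_B])
  have "EE ?E ?p (\<lambda>\<omega>. of_bool (touch \<omega> x)) = EE ?J ?p (\<lambda>a. EE (?E - ?J) ?p (\<lambda>b. of_bool (touch (a \<union> b) x)))"
    by (rule EE_split[OF fE edges_subset_gedges])
  also have "\<dots> = PB n \<alpha> \<beta> (\<lambda>a. 1 - exp (- \<alpha> * rho \<beta> n * card (cl (a \<inter> ?J) x)))"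
  proof (rule EE_cong[OF pr_ghost_weight_eq_edge_prob])
    fix a assume a: "a \<subseteq> ?J"
    have aJ: "a \<inter> ?J = a" using a by auto
    have aP: "a \<subseteq> Pow (B n)" using a edges_subset_Pow by blast
    have cB: "cl a x \<subseteq> B n" by (rule cl_subset[OF aP x])
    let ?T = "(\<lambda>y. {y}) ` cl a x"
    have T: "?T \<subseteq> ?E - ?J" using cB by auto
    have "EE (?E - ?J) ?p (\<lambda>b. of_bool (touch (a \<union> b) x)) = EE (?E - ?J) ?p (\<lambda>b. 1 - of_bool (b \<inter> ?T = {}))"
    proof (intro EE_cong refl)
      fix b assume b: "b \<subseteq> ?E - ?J"
      have "cl (a \<union> b) x = cl a x"
      proof (rule cl_remove_loops)
        fix u v :: "nat \<Rightarrow> nat" assume "u \<noteq> v"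
        then have "{u, v} \<notin> b" using b by auto
        then show "{u, v} \<in> a \<union> b \<longleftrightarrow> {u, v} \<in> a" by simp
      qed
      moreover have "{y} \<notin> a" for y using a by auto
      ultimately have "touch (a \<union> b) x \<longleftrightarrow> b \<inter> ?T \<noteq> {}" unfolding touch_def by auto
      then show "of_bool (touch (a \<union> b) x) = (1 - of_bool (b \<inter> ?T = {}) :: real)" by simp
    qed
    also have "\<dots> = 1 - (\<Prod>e\<in>?T. 1 - ?p e)"
      using fE EE_all_closed[of "?E - ?J" ?T ?p] T by (simp add: EE_diff EE_const)
    also have "(\<Prod>e\<in>?T. 1 - ?p e) = exp (- \<alpha> * rho \<beta> n) ^ card (cl a x)"
      by (subst prod.reindex) (auto simp: inj_on_def)
    also have "\<dots> = exp (- \<alpha> * rho \<beta> n * card (cl a x))"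
      by (simp add: exp_of_nat_mult[symmetric] mult_ac)
    finally show "EE (?E - ?J) ?p (\<lambda>b. of_bool (touch (a \<union> b) x)) = 1 - exp (- \<alpha> * rho \<beta> n * card (cl (a \<inter> ?J) x))"
      unfolding aJ .
  qed
  also have "\<dots> = escape_prob \<alpha> \<beta> n"
    unfolding escape_prob_def
    using EE_cluster_translate[OF x, of \<alpha> \<beta> "\<lambda>k. exp (- \<alpha> * rho \<beta> n * real k)"]
    by (simp add: EE_diff EE_const)
  finally show ?thesis .
qed

text \<open>With the ghost, \<alpha> and \<beta> enter only through the edge weights, so two pairs
  of parameters can be compared edge by edge.\<close>

lemma escape_prob_mono:
  assumes a: "0 \<le> \<alpha>1" "0 \<le> \<alpha>2" and b: "real N < \<beta>1" "real N < \<beta>2"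
    and J: "\<And>k. 1 \<le> k \<Longrightarrow> \<alpha>2 / \<beta>2 ^ k \<le> \<alpha>1 / \<beta>1 ^ k" and r: "\<alpha>2 * rho \<beta>2 n \<le> \<alpha>1 * rho \<beta>1 n"
  shows "escape_prob \<alpha>2 \<beta>2 n \<le> escape_prob \<alpha>1 \<beta>1 n"
proof -
  have "EE (gedges (B n)) (pr (ghost_weight \<beta>2 n) \<alpha>2) (\<lambda>\<omega>. of_bool (touch \<omega> (\<lambda>_. 0)))
    \<le> EE (gedges (B n)) (pr (ghost_weight \<beta>1 n) \<alpha>1) (\<lambda>\<omega>. of_bool (touch \<omega> (\<lambda>_. 0)) :: real)"
  proof (rule EE_mono_prob[OF finite_gedges[OF finite_B]])
    fix e assume "e \<in> gedges (B n)"
    then have "\<alpha>2 * ghost_weight \<beta>2 n e \<le> \<alpha>1 * ghost_weight \<beta>1 n e"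
      unfolding gedges_def
    proof
      assume "e \<in> edges (B n)"
      then obtain x y where e: "x \<in> B n" "y \<in> B n" "x \<noteq> y" "e = {x, y}" by (auto simp: edges_def)
      then have "1 \<le> hdist x y" using hdist_pos[of x N y] hball_subset by blast
      from J[OF this] show ?thesis unfolding e(4) ghost_weight_doubleton[OF e(3)] by simp
    qed (use r in auto)
    then show "0 \<le> pr (ghost_weight \<beta>2 n) \<alpha>2 e \<and> pr (ghost_weight \<beta>2 n) \<alpha>2 e \<le> pr (ghost_weight \<beta>1 n) \<alpha>1 e \<and> pr (ghost_weight \<beta>1 n) \<alpha>1 e \<le> 1"
      using a ghost_weight_nonneg[OF b(1), of n e] ghost_weight_nonneg[OF b(2), of n e] by simp
  next
    fix \<omega> \<omega>' :: "(nat \<Rightarrow> nat) set set" assume "\<omega> \<subseteq> \<omega>'"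
    then show "(of_bool (touch \<omega> (\<lambda>_. 0)) :: real) \<le> of_bool (touch \<omega>' (\<lambda>_. 0))" using touch_mono by auto
  qed
  then show ?thesis by (simp only: ghost_escape_prob[OF zero_in_B])
qed

lemma theta_mono:
  assumes "0 \<le> \<alpha>2" "\<alpha>2 \<le> \<alpha>1" "real N < \<beta>"
  shows "theta N \<alpha>2 \<beta> \<le> theta N \<alpha>1 \<beta>"
proof -
  have b: "0 < \<beta>" and a: "0 \<le> \<alpha>1" using assms N2 by auto
  have "escape_prob \<alpha>2 \<beta> n \<le> escape_prob \<alpha>1 \<beta> n" for n
    using assms a b rho_pos[OF assms(3), of n] by (intro escape_prob_mono) (auto intro: divide_right_mono mult_right_mono)
  then show ?thesis
    by (intro LIMSEQ_le[OF escape_prob_LIMSEQ_theta[OF assms(1,3)] escape_prob_LIMSEQ_theta[OF a assms(3)]]) auto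
qed

lemma theta_ratio:
  assumes a: "0 \<le> \<alpha>" and b: "real N < \<beta>1" "\<beta>1 \<le> \<beta>2"
  shows "theta N \<alpha> \<beta>2 \<le> theta N (\<alpha> * \<beta>1 / \<beta>2) \<beta>1"
proof -
  have b0: "0 < \<beta>1" "0 < \<beta>2" and b2: "real N < \<beta>2" using b N2 by auto
  let ?a = "\<alpha> * \<beta>1 / \<beta>2"
  have a1: "0 \<le> ?a" using a b0 by simp
  have "escape_prob \<alpha> \<beta>2 n \<le> escape_prob ?a \<beta>1 n" for n
  proof (rule escape_prob_mono[OF a1 a b(1) b2])
    fix k :: nat assume "1 \<le> k"
    then obtain j where k: "k = Suc j" by (cases k) auto
    have "\<beta>1 ^ j \<le> \<beta>2 ^ j" using b b0 by (intro power_mono) auto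
    then have "\<alpha> / \<beta>2 / \<beta>2 ^ j \<le> \<alpha> / \<beta>2 / \<beta>1 ^ j" using a b0 by (intro divide_left_mono) auto
    then show "\<alpha> / \<beta>2 ^ k \<le> ?a / \<beta>1 ^ k" unfolding k using b0 by simp
  next
    have 1: "(real N / \<beta>2) ^ n \<le> (real N / \<beta>1) ^ n"
      using b b0 by (intro power_mono divide_left_mono) auto
    \<comment> \<open>After clearing denominators this is
      \<open>N * \<beta>1 \<le> N * \<beta>2\<close>.\<close>
    have 2: "1 / (\<beta>2 - real N) \<le> \<beta>1 / \<beta>2 / (\<beta>1 - real N)"
    proof -
      have "real N * \<beta>1 \<le> real N * \<beta>2" using b by (intro mult_left_mono) auto
      then have "\<beta>2 * (\<beta>1 - real N) \<le> \<beta>1 * (\<beta>2 - real N)" by (simp add: algebra_simps)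
      then show ?thesis using b b2 b0 by (simp add: field_simps)
    qed
    have "\<alpha> * rho \<beta>2 n = \<alpha> * (real N - 1) * (1 / (\<beta>2 - real N) * (real N / \<beta>2) ^ n)"
      by (simp add: rho_def)
    also have "\<dots> \<le> \<alpha> * (real N - 1) * (\<beta>1 / \<beta>2 / (\<beta>1 - real N) * (real N / \<beta>1) ^ n)"
      using 1 2 a b b0 N2 by (intro mult_left_mono mult_mono) auto
    also have "\<dots> = ?a * rho \<beta>1 n" by (simp add: rho_def)
    finally show "\<alpha> * rho \<beta>2 n \<le> ?a * rho \<beta>1 n" .
  qed
  then show ?thesis
    by (intro LIMSEQ_le[OF escape_prob_LIMSEQ_theta[OF a b2] escape_prob_LIMSEQ_theta[OF a1 b(1)]]) auto
qed

lemma sum_ball_J: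
  assumes x: "x \<in> B n"
  shows "(\<Sum>y\<in>B n - {x}. 1 / \<beta> ^ hdist x y) = shell_weight \<beta> 0 n"
proof -
  have xh: "x \<in> hlattice N" using x hball_subset by blast
  have im: "shift N x ` B n = B n" using shift_image_B[OF xh] hball_eq[OF x] by simp
  have B0: "B 0 = {\<lambda>_. 0}" using N2 by (auto simp: hball_def hlattice_iff)
  have inj: "inj_on (shift N x) (B n - {\<lambda>_. 0})" by (rule inj_on_subset[OF inj_shift_B]) auto
  have im2: "shift N x ` (B n - {\<lambda>_. 0}) = B n - {x}"
    using inj_on_image_set_diff[OF inj_shift_B[of x n], of "B n" "{\<lambda>_. 0}"] im shift_zero[OF xh] by auto
  have "(\<Sum>y\<in>B n - {x}. 1 / \<beta> ^ hdist x y) = (\<Sum>y\<in>B n - {\<lambda>_. 0}. 1 / \<beta> ^ hdist x (shift N x y))"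
    unfolding im2[symmetric] by (subst sum.reindex[OF inj]) simp
  also have "\<dots> = (\<Sum>y\<in>B n - {\<lambda>_. 0}. 1 / \<beta> ^ hdist (\<lambda>_. 0) y)"
  proof (intro sum.cong refl)
    fix y assume "y \<in> B n - {\<lambda>_. 0}"
    then have "y \<in> hlattice N" using hball_subset by blast
    then have "hdist (shift N x (\<lambda>_. 0)) (shift N x y) = hdist (\<lambda>_. 0) y" by (intro hdist_shift) auto
    then show "1 / \<beta> ^ hdist x (shift N x y) = 1 / \<beta> ^ hdist (\<lambda>_. 0) y" by (simp add: shift_zero[OF xh])
  qed
  also have "\<dots> = shell_weight \<beta> 0 n"
    using sum_shells[OF zero_in_B, of 0 n \<beta>] by (simp add: B0)
  finally show ?thesis .
qed

text \<open>\<open>rho \<beta> 0\<close> is the total weight of all edges at a vertex; what remains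
  is the weight from \<open>x\<close> to the complement of \<open>S\<close> in the whole lattice,
  with no reference to a ball around \<open>S\<close>.\<close>

definition out_weight :: "real \<Rightarrow> (nat \<Rightarrow> nat) set \<Rightarrow> (nat \<Rightarrow> nat) \<Rightarrow> real" where
  "out_weight \<beta> S x = rho \<beta> 0 - (\<Sum>y\<in>S - {x}. 1 / \<beta> ^ hdist x y)"

text \<open>The weights \<open>\<alpha> * J\<close> stand in place of the edge probabilities
  \<open>1 - exp (- \<alpha> * J)\<close>; this is the form that the derivative with respect to
  \<alpha> produces.\<close>

definition phi :: "real \<Rightarrow> real \<Rightarrow> (nat \<Rightarrow> nat) set \<Rightarrow> real" where
  "phi \<alpha> \<beta> S = \<alpha> * (\<Sum>x\<in>S. out_weight \<beta> S x * EE (edges S) (edge_prob \<alpha> \<beta>) (\<lambda>\<omega>. of_bool (x \<in> cl \<omega> (\<lambda>_. 0))))"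

lemma out_weight_eq:
  assumes b: "real N < \<beta>" and S: "S \<subseteq> B n" and x: "x \<in> S"
  shows "out_weight \<beta> S x = rho \<beta> n + (\<Sum>y\<in>B n - S. 1 / \<beta> ^ hdist x y)"
proof -
  have xB: "x \<in> B n" using x S by auto
  have fS: "finite S" by (rule finite_sub_B[OF S])
  have "B n - {x} = (B n - S) \<union> (S - {x})" using S x by auto
  then have "(\<Sum>y\<in>B n - {x}. 1 / \<beta> ^ hdist x y) = (\<Sum>y\<in>B n - S. 1 / \<beta> ^ hdist x y) + (\<Sum>y\<in>S - {x}. 1 / \<beta> ^ hdist x y)"
    using fS by (simp only:, subst sum.union_disjoint) auto
  then show ?thesis
    using sum_ball_J[OF xB, of \<beta>] shell_weight_eq_rho[OF b, of 0 n] by (simp add: out_weight_def)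
qed

lemma outJ_eq_out_weight:
  assumes b: "real N < \<beta>" and S: "S \<subseteq> B n" and x: "x \<in> S"
  shows "outJ (ghost_weight \<beta> n) (B n) S x = out_weight \<beta> S x"
proof -
  have "(\<Sum>y\<in>B n - S. ghost_weight \<beta> n {x, y}) = (\<Sum>y\<in>B n - S. 1 / \<beta> ^ hdist x y)"
    by (intro sum.cong refl ghost_weight_doubleton) (use x in auto)
  then show ?thesis using out_weight_eq[OF assms] by (simp add: outJ_def)
qed

text \<open>The lower bound of \<open>touch_prob_ge\<close> depends on \<open>a0\<close> and
  \<open>a1\<close> but not on the ball, so it survives the limit.\<close>

lemma theta_pos_of_phi:
  assumes b: "real N < \<beta>" and a: "0 < a0" "a0 < a1"
    and phi: "\<And>S. finite S \<Longrightarrow> S \<subseteq> hlattice N \<Longrightarrow> (\<lambda>_. 0) \<in> S \<Longrightarrow> 1 \<le> phi a0 \<beta> S"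
  shows "0 < theta N a1 \<beta>"
proof -
  have "1 - exp (- (a1 - a0) / a0) \<le> escape_prob a1 \<beta> n" for n
    unfolding ghost_escape_prob[OF zero_in_B, symmetric]
  proof (rule touch_prob_ge[OF finite_B zero_in_B ghost_weight_nonneg[OF b] a(1) less_imp_le[OF a(2)]])
    fix S assume S: "S \<subseteq> B n" "(\<lambda>_. 0) \<in> S"
    have "1 \<le> phi a0 \<beta> S"
      using S finite_sub_B[OF S(1)] hball_subset by (intro phi) blast+
    also have "phi a0 \<beta> S = a0 * (\<Sum>x\<in>S. outJ (ghost_weight \<beta> n) (B n) S x * EE (edges S) (pr (ghost_weight \<beta> n) a0) (\<lambda>\<omega>. of_bool (x \<in> cl \<omega> (\<lambda>_. 0))))"
      unfolding phi_def
      by (intro arg_cong2[of _ _ _ _ "(*)"] sum.cong refl outJ_eq_out_weight[OF b S(1), symmetric] EE_cong pr_ghost_weight_eq_edge_prob[symmetric])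
    finally show "1 \<le> a0 * (\<Sum>x\<in>S. outJ (ghost_weight \<beta> n) (B n) S x * EE (edges S) (pr (ghost_weight \<beta> n) a0) (\<lambda>\<omega>. of_bool (x \<in> cl \<omega> (\<lambda>_. 0))))" .
  qed
  then have "1 - exp (- (a1 - a0) / a0) \<le> theta N a1 \<beta>"
    using a by (intro theta_ge[OF _ b]) auto
  moreover have "0 < 1 - exp (- (a1 - a0) / a0)" using a by (simp add: divide_neg_pos)
  ultimately show ?thesis by linarith
qed

end

section \<open>Absence of percolation from phi < 1\<close>

text \<open>A path from \<open>x0\<close> to the ghost leaves the cluster of \<open>x0\<close> within \<open>S\<close> for the last time through
  an edge with endpoint outside \<open>S\<close>, and from there on avoids that cluster.\<close>

lemma touch_decompose:
  assumes w: "\<omega> \<subseteq> gedges V" and S: "S \<subseteq> V" "x0 \<in> S" and t: "touch \<omega> x0"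
  defines "C \<equiv> cl (\<omega> \<inter> edges S) x0"
  shows "(\<exists>x\<in>C. {x} \<in> \<omega>) \<or> (\<exists>x\<in>C. \<exists>y\<in>V - S. {x, y} \<in> \<omega> \<and> touch (\<omega> \<inter> gedges (V - C)) y)"
proof (rule ccontr)
  assume no: "\<not> ?thesis"
  let ?w = "\<omega> \<inter> gedges (V - C)"
  have CS: "C \<subseteq> S" unfolding C_def by (rule cl_Int_edges_subset[OF S(2)])
  \<comment> \<open>If the claim fails, this set is closed: it consists of the cluster and of the
    vertices off it that cannot reach the ghost while avoiding it. No vertex of it has an open ghost
    edge.\<close>
  define Z where "Z = C \<union> {z \<in> V - C. \<not> touch ?w z}"
  have "cl \<omega> x0 \<subseteq> Z"
  proof (rule cl_subset_closed)
    show "x0 \<in> Z" by (simp add: Z_def C_def)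
    fix u v assume u: "u \<in> Z" and uv: "{u, v} \<in> \<omega>"
    have vV: "v \<in> V" using uv w gedges_subset_Pow by blast
    show "v \<in> Z"
    proof (cases "v \<in> C")
      case False
      show ?thesis
      proof (cases "u \<in> C")
        case True
        have "v \<notin> S"
        proof
          assume "v \<in> S"
          then have "{u, v} \<in> \<omega> \<inter> edges S" using uv True False CS by auto
          then show False using True False cl_step[of u "\<omega> \<inter> edges S" x0 v] by (simp add: C_def)
        qed
        then have "\<not> touch ?w v" using no True uv vV by blast
        then show ?thesis using False vV by (simp add: Z_def)
      next
        case uC: False
        then have uVC: "u \<in> V - C" "\<not> touch ?w u" using u by (auto simp: Z_def)
        then have "v \<in> cl ?w u" using uv vV False cl_step[OF cl_refl, of u v ?w] by auto
        then have "\<not> touch ?w v" using uVC(2) by (simp add: touch_cl)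
        then show ?thesis using False vV by (simp add: Z_def)
      qed
    qed (simp add: Z_def)
  qed
  moreover obtain z where z: "z \<in> cl \<omega> x0" "{z} \<in> \<omega>" using t by (auto simp: touch_def)
  ultimately have "z \<in> Z" by auto
  moreover have "z \<notin> C" using no z by auto
  ultimately have "z \<in> V - C" "\<not> touch ?w z" by (auto simp: Z_def)
  then show False using z(2) unfolding touch_def by auto
qed

text \<open>That the cluster is \<open>K\<close> depends only on edges of \<open>S\<close> meeting
  \<open>K\<close>; the exit edge and the edges avoiding \<open>K\<close> are disjoint from these
  and from each other. Summation over \<open>K\<close> thus takes the place of the van den
  Berg--Kesten inequality.\<close>

lemma EE_cluster_edge_touch_le:
  fixes V S K :: "'v set"
  assumes fV: "finite V" and S: "S \<subseteq> V" and K: "K \<subseteq> S" and x: "x \<in> K" and y: "y \<in> V - S"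
    and p: "\<And>e. 0 \<le> p e \<and> p e \<le> 1"
  shows "EE (gedges V) p (\<lambda>\<omega>. of_bool (cl (\<omega> \<inter> edges S) x0 = K) * (of_bool ({x, y} \<in> \<omega>) * of_bool (touch (\<omega> \<inter> gedges (V - K)) y)))
    \<le> EE (gedges V) p (\<lambda>\<omega>. of_bool (cl (\<omega> \<inter> edges S) x0 = K)) * (p {x, y} * EE (gedges V) p (\<lambda>\<omega>. of_bool (touch \<omega> y)))"
proof -
  define A1 where "A1 = {e \<in> edges S. e \<inter> K \<noteq> {}}"
  have fE: "finite (gedges V)" by (rule finite_gedges[OF fV])
  have iff: "cl (\<omega> \<inter> edges S) x0 = K \<longleftrightarrow> cl (\<omega> \<inter> A1) x0 = K" for \<omega>
  proof
    assume *: "cl (\<omega> \<inter> edges S) x0 = K"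
    have "cl (\<omega> \<inter> A1) x0 = cl (\<omega> \<inter> edges S) x0"
      by (rule cl_eqI) (use * in \<open>auto simp: A1_def\<close>)
    then show "cl (\<omega> \<inter> A1) x0 = K" using * by simp
  next
    assume *: "cl (\<omega> \<inter> A1) x0 = K"
    have "cl (\<omega> \<inter> edges S) x0 = cl (\<omega> \<inter> A1) x0"
      by (rule cl_eqI) (use * in \<open>auto simp: A1_def\<close>)
    then show "cl (\<omega> \<inter> edges S) x0 = K" using * by simp
  qed
  have d: "A1 \<inter> {{x, y}} = {}" "A1 \<inter> gedges (V - K) = {}" "{{x, y}} \<inter> gedges (V - K) = {}"
    using y x gedges_subset_Pow[of "V - K"] by (auto simp: A1_def)
  have "EE (gedges V) p (\<lambda>\<omega>. of_bool (cl (\<omega> \<inter> edges S) x0 = K) * (of_bool ({x, y} \<in> \<omega>) * of_bool (touch (\<omega> \<inter> gedges (V - K)) y)))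
    = EE (gedges V) p (\<lambda>\<omega>. of_bool (cl (\<omega> \<inter> A1) x0 = K) * (of_bool ({x, y} \<in> \<omega> \<inter> {{x, y}}) * of_bool (touch (\<omega> \<inter> gedges (V - K)) y)))"
    unfolding iff by simp
  also have "\<dots> = EE (gedges V) p (\<lambda>\<omega>. of_bool (cl (\<omega> \<inter> A1) x0 = K))
     * (EE (gedges V) p (\<lambda>\<omega>. of_bool ({x, y} \<in> \<omega> \<inter> {{x, y}})) * EE (gedges V) p (\<lambda>\<omega>. of_bool (touch (\<omega> \<inter> gedges (V - K)) y)))"
    by (rule EE_indep3[OF fE d])
  also have "EE (gedges V) p (\<lambda>\<omega>. of_bool ({x, y} \<in> \<omega> \<inter> {{x, y}})) = p {x, y}"
    using EE_edge_open[OF fE, of "{x, y}" p] x y K S by auto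
  also have "EE (gedges V) p (\<lambda>\<omega>. of_bool (cl (\<omega> \<inter> A1) x0 = K)) * (p {x, y} * EE (gedges V) p (\<lambda>\<omega>. of_bool (touch (\<omega> \<inter> gedges (V - K)) y)))
    \<le> EE (gedges V) p (\<lambda>\<omega>. of_bool (cl (\<omega> \<inter> A1) x0 = K)) * (p {x, y} * EE (gedges V) p (\<lambda>\<omega>. of_bool (touch \<omega> y)))"
  proof (intro mult_left_mono EE_mono EE_nonneg p)
    fix \<omega> :: "'v set set"
    show "(of_bool (touch (\<omega> \<inter> gedges (V - K)) y) :: real) \<le> of_bool (touch \<omega> y)"
      using touch_mono[of "\<omega> \<inter> gedges (V - K)" \<omega> y] by auto
  qed (use p in auto)
  finally show ?thesis unfolding iff .
qed

context hierarchical
begin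

text \<open>Either a vertex of \<open>S\<close> has an open ghost edge, or a last edge leaves the
  cluster within \<open>S\<close>; from its far end the escape probability is again
  \<open>escape_prob \<alpha> \<beta> n\<close>, by homogeneity of the ball.\<close>

lemma escape_prob_le_phi:
  assumes a: "0 \<le> \<alpha>" and b: "real N < \<beta>" and S: "S \<subseteq> B n" "(\<lambda>_. 0) \<in> S"
  shows "escape_prob \<alpha> \<beta> n \<le> real (card S) * (\<alpha> * rho \<beta> n) + phi \<alpha> \<beta> S * escape_prob \<alpha> \<beta> n"
proof -
  let ?V = "B n" and ?E = "gedges (B n)" and ?p = "pr (ghost_weight \<beta> n) \<alpha>" and ?z = "\<lambda>_::nat. 0::nat"
  let ?c = "\<lambda>\<omega>. cl (\<omega> \<inter> edges S) ?z"
  define PS where "PS = (\<lambda>x. EE (edges S) (edge_prob \<alpha> \<beta>) (\<lambda>\<omega>. of_bool (x \<in> cl \<omega> ?z)))"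
  have fE: "finite ?E" by (rule finite_gedges[OF finite_B])
  have fS: "finite S" by (rule finite_sub_B[OF S(1)])
  have b0: "0 < \<beta>" using b N2 by simp
  have p: "0 \<le> ?p e \<and> ?p e \<le> 1" for e using ghost_weight_nonneg[OF b, of n e] a by simp
  have p_le: "?p e \<le> \<alpha> * ghost_weight \<beta> n e" for e
    using exp_ge_add_one_self[of "- \<alpha> * ghost_weight \<beta> n e"] by simp
  have subE: "edges S \<subseteq> ?E" using edges_mono[OF S(1)] edges_subset_gedges by blast
  have PS: "EE ?E ?p (\<lambda>\<omega>. of_bool (x \<in> ?c \<omega>)) = PS x" for x
    unfolding PS_def EE_marginal[OF fE subE, of ?p "\<lambda>\<omega>. of_bool (x \<in> cl \<omega> ?z)"]
    by (intro EE_cong refl pr_ghost_weight_eq_edge_prob)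
  have PS01: "0 \<le> PS x" for x
    unfolding PS_def using edge_prob_bounds[OF a b0] by (intro EE_nonneg) auto
  have f0: "0 \<le> escape_prob \<alpha> \<beta> n" by (rule escape_prob_bounds[OF a b])
  have "escape_prob \<alpha> \<beta> n = EE ?E ?p (\<lambda>\<omega>. of_bool (touch \<omega> ?z))" by (rule ghost_escape_prob[OF zero_in_B, symmetric])
  also have "\<dots> \<le> EE ?E ?p (\<lambda>\<omega>. (\<Sum>x\<in>S. of_bool ({x} \<in> \<omega>)) +
     (\<Sum>x\<in>S. \<Sum>y\<in>?V - S. \<Sum>K\<in>{K. K \<subseteq> S \<and> x \<in> K}. of_bool (?c \<omega> = K) * (of_bool ({x, y} \<in> \<omega>) * of_bool (touch (\<omega> \<inter> gedges (?V - K)) y))))"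
  proof (rule EE_mono[OF p])
    fix \<omega> assume w: "\<omega> \<subseteq> ?E"
    let ?R1 = "(\<Sum>x\<in>S. of_bool ({x} \<in> \<omega>)) :: real"
    let ?h = "\<lambda>x y K. of_bool (?c \<omega> = K) * (of_bool ({x, y} \<in> \<omega>) * of_bool (touch (\<omega> \<inter> gedges (?V - K)) y)) :: real"
    let ?R2 = "(\<Sum>x\<in>S. \<Sum>y\<in>?V - S. \<Sum>K\<in>{K. K \<subseteq> S \<and> x \<in> K}. ?h x y K)"
    have cS: "?c \<omega> \<subseteq> S" by (rule cl_Int_edges_subset[OF S(2)])
    have nn: "0 \<le> ?R1" "0 \<le> ?R2" by (intro sum_nonneg; simp)+
    show "of_bool (touch \<omega> ?z) \<le> ?R1 + ?R2"
    proof (cases "touch \<omega> ?z")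
      case True
      from touch_decompose[OF w S True] show ?thesis
      proof (elim disjE bexE conjE)
        fix x assume x: "x \<in> ?c \<omega>" "{x} \<in> \<omega>"
        then have "of_bool ({x} \<in> \<omega>) \<le> ?R1" using cS fS by (intro member_le_sum) auto
        then show ?thesis using x nn True by simp
      next
        fix x y assume x: "x \<in> ?c \<omega>" and y: "y \<in> ?V - S" and e: "{x, y} \<in> \<omega>"
          and t: "touch (\<omega> \<inter> gedges (?V - ?c \<omega>)) y"
        have xS: "x \<in> S" using x cS by auto
        have fK: "finite {K. K \<subseteq> S \<and> x \<in> K}" by (rule finite_subset[of _ "Pow S"]) (use fS in auto)
        have "1 = ?h x y (?c \<omega>)" using e t by simp
        also have "\<dots> \<le> (\<Sum>K\<in>{K. K \<subseteq> S \<and> x \<in> K}. ?h x y K)"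
          using x cS by (intro member_le_sum fK) auto
        also have "\<dots> \<le> (\<Sum>y\<in>?V - S. \<Sum>K\<in>{K. K \<subseteq> S \<and> x \<in> K}. ?h x y K)"
          by (rule member_le_sum[OF y]) (auto intro: sum_nonneg)
        also have "\<dots> \<le> ?R2"
          by (rule member_le_sum[OF xS]) (auto intro!: sum_nonneg fS)
        finally show ?thesis using nn True by simp
      qed
    qed (use nn in simp)
  qed
  also have "\<dots> = (\<Sum>x\<in>S. EE ?E ?p (\<lambda>\<omega>. of_bool ({x} \<in> \<omega>))) +
     (\<Sum>x\<in>S. \<Sum>y\<in>?V - S. \<Sum>K\<in>{K. K \<subseteq> S \<and> x \<in> K}. EE ?E ?p (\<lambda>\<omega>. of_bool (?c \<omega> = K) * (of_bool ({x, y} \<in> \<omega>) * of_bool (touch (\<omega> \<inter> gedges (?V - K)) y))))"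
    unfolding EE_add EE_sum ..
  also have "(\<Sum>x\<in>S. EE ?E ?p (\<lambda>\<omega>. of_bool ({x} \<in> \<omega>))) \<le> (\<Sum>x\<in>S. \<alpha> * rho \<beta> n)"
  proof (rule sum_mono)
    fix x assume "x \<in> S"
    then have "EE ?E ?p (\<lambda>\<omega>. of_bool ({x} \<in> \<omega>)) = ?p {x}" using S by (intro EE_edge_open fE) auto
    then show "EE ?E ?p (\<lambda>\<omega>. of_bool ({x} \<in> \<omega>)) \<le> \<alpha> * rho \<beta> n" using p_le[of "{x}"] by simp
  qed
  also have "(\<Sum>x\<in>S. \<Sum>y\<in>?V - S. \<Sum>K\<in>{K. K \<subseteq> S \<and> x \<in> K}. EE ?E ?p (\<lambda>\<omega>. of_bool (?c \<omega> = K) * (of_bool ({x, y} \<in> \<omega>) * of_bool (touch (\<omega> \<inter> gedges (?V - K)) y))))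
    \<le> (\<Sum>x\<in>S. \<Sum>y\<in>?V - S. PS x * (\<alpha> * (1 / \<beta> ^ hdist x y) * escape_prob \<alpha> \<beta> n))"
  proof (intro sum_mono)
    fix x y assume x: "x \<in> S" and y: "y \<in> ?V - S"
    let ?KK = "{K. K \<subseteq> S \<and> x \<in> K}"
    have fK: "finite ?KK" by (rule finite_subset[of _ "Pow S"]) (use fS in auto)
    have yB: "y \<in> B n" using y by simp
    have "(\<Sum>K\<in>?KK. EE ?E ?p (\<lambda>\<omega>. of_bool (?c \<omega> = K) * (of_bool ({x, y} \<in> \<omega>) * of_bool (touch (\<omega> \<inter> gedges (?V - K)) y))))
      \<le> (\<Sum>K\<in>?KK. EE ?E ?p (\<lambda>\<omega>. of_bool (?c \<omega> = K)) * (?p {x, y} * escape_prob \<alpha> \<beta> n))"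
    proof (rule sum_mono)
      fix K assume "K \<in> ?KK"
      then have K: "K \<subseteq> S" "x \<in> K" by auto
      from EE_cluster_edge_touch_le[where ?x0.0 = ?z and p = ?p, OF finite_B S(1) K y p]
      show "EE ?E ?p (\<lambda>\<omega>. of_bool (?c \<omega> = K) * (of_bool ({x, y} \<in> \<omega>) * of_bool (touch (\<omega> \<inter> gedges (?V - K)) y)))
        \<le> EE ?E ?p (\<lambda>\<omega>. of_bool (?c \<omega> = K)) * (?p {x, y} * escape_prob \<alpha> \<beta> n)"
        unfolding ghost_escape_prob[OF yB] .
    qed
    also have "\<dots> = EE ?E ?p (\<lambda>\<omega>. \<Sum>K\<in>?KK. of_bool (?c \<omega> = K)) * (?p {x, y} * escape_prob \<alpha> \<beta> n)"
      unfolding EE_sum sum_distrib_right ..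
    also have "EE ?E ?p (\<lambda>\<omega>. \<Sum>K\<in>?KK. of_bool (?c \<omega> = K)) = PS x"
      unfolding PS[symmetric]
    proof (intro EE_cong refl)
      fix \<omega>
      have "(\<Sum>K\<in>?KK. of_bool (?c \<omega> = K)) = (\<Sum>K\<in>?KK. if K = ?c \<omega> then 1 else (0::real))"
        by (intro sum.cong refl) auto
      also have "\<dots> = of_bool (?c \<omega> \<in> ?KK)" using fK by (simp add: sum.delta)
      also have "\<dots> = of_bool (x \<in> ?c \<omega>)" using cl_Int_edges_subset[OF S(2)] by auto
      finally show "(\<Sum>K\<in>?KK. of_bool (?c \<omega> = K)) = (of_bool (x \<in> ?c \<omega>) :: real)" .
    qed
    also have "PS x * (?p {x, y} * escape_prob \<alpha> \<beta> n) \<le> PS x * (\<alpha> * (1 / \<beta> ^ hdist x y) * escape_prob \<alpha> \<beta> n)"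
    proof (intro mult_left_mono mult_right_mono PS01 f0)
      have "x \<noteq> y" using x y by auto
      from ghost_weight_doubleton[OF this] show "?p {x, y} \<le> \<alpha> * (1 / \<beta> ^ hdist x y)"
        using p_le[of "{x, y}"] by metis
    qed
    finally show "(\<Sum>K\<in>?KK. EE ?E ?p (\<lambda>\<omega>. of_bool (?c \<omega> = K) * (of_bool ({x, y} \<in> \<omega>) * of_bool (touch (\<omega> \<inter> gedges (?V - K)) y))))
      \<le> PS x * (\<alpha> * (1 / \<beta> ^ hdist x y) * escape_prob \<alpha> \<beta> n)" .
  qed
  also have "(\<Sum>x\<in>S. \<Sum>y\<in>?V - S. PS x * (\<alpha> * (1 / \<beta> ^ hdist x y) * escape_prob \<alpha> \<beta> n))
    = (\<Sum>x\<in>S. \<alpha> * escape_prob \<alpha> \<beta> n * (PS x * (\<Sum>y\<in>?V - S. 1 / \<beta> ^ hdist x y)))"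
    unfolding sum_distrib_left by (intro sum.cong refl) (simp only: mult_ac)
  \<comment> \<open>Adding the ghost part \<open>rho \<beta> n\<close> of \<open>out_weight\<close>
    makes the coefficient independent of \<open>n\<close>.\<close>
  also have "\<dots> \<le> (\<Sum>x\<in>S. \<alpha> * escape_prob \<alpha> \<beta> n * (PS x * out_weight \<beta> S x))"
  proof (intro sum_mono mult_left_mono PS01)
    fix x assume "x \<in> S"
    from out_weight_eq[OF b S(1) this] rho_pos[OF b, of n]
    show "(\<Sum>y\<in>?V - S. 1 / \<beta> ^ hdist x y) \<le> out_weight \<beta> S x" by linarith
  qed (use a f0 in auto)
  also have "\<dots> = phi \<alpha> \<beta> S * escape_prob \<alpha> \<beta> n"
  proof -
    have "phi \<alpha> \<beta> S = \<alpha> * (\<Sum>x\<in>S. out_weight \<beta> S x * PS x)" by (simp add: phi_def PS_def)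
    then show ?thesis
      unfolding sum_distrib_left sum_distrib_right by (simp only: sum_distrib_right) (intro sum.cong refl, simp only: mult_ac)
  qed
  finally show ?thesis by simp
qed

text \<open>In the limit the ghost edges of the finite set \<open>S\<close> drop out, which leaves
  \<open>theta \<le> phi * theta\<close>.\<close>

lemma theta_zero_of_phi:
  assumes a: "0 \<le> \<alpha>" and b: "real N < \<beta>" and S: "finite S" "S \<subseteq> hlattice N" "(\<lambda>_. 0) \<in> S"
    and phi: "phi \<alpha> \<beta> S < 1"
  shows "theta N \<alpha> \<beta> = 0"
proof -
  obtain m where m: "S \<subseteq> B m" using finite_subset_B[OF S(1,2)] by blast
  have "theta N \<alpha> \<beta> \<le> real (card S) * (\<alpha> * 0) + phi \<alpha> \<beta> S * theta N \<alpha> \<beta>"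
  proof (rule LIMSEQ_le[OF escape_prob_LIMSEQ_theta[OF a b]])
    show "(\<lambda>n. real (card S) * (\<alpha> * rho \<beta> n) + phi \<alpha> \<beta> S * escape_prob \<alpha> \<beta> n)
      \<longlonglongrightarrow> real (card S) * (\<alpha> * 0) + phi \<alpha> \<beta> S * theta N \<alpha> \<beta>"
      by (intro tendsto_intros rho_tendsto_0[OF b] escape_prob_LIMSEQ_theta[OF a b])
    have "S \<subseteq> B n" if "m \<le> n" for n using m B_mono[OF that] by (rule subset_trans)
    then show "\<exists>M. \<forall>n\<ge>M. escape_prob \<alpha> \<beta> n \<le> real (card S) * (\<alpha> * rho \<beta> n) + phi \<alpha> \<beta> S * escape_prob \<alpha> \<beta> n"
      using escape_prob_le_phi[OF a b _ S(3)] by blast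
  qed
  then have "(1 - phi \<alpha> \<beta> S) * theta N \<alpha> \<beta> \<le> 0" by (simp add: algebra_simps)
  then have "theta N \<alpha> \<beta> \<le> 0" using phi by (simp add: mult_le_0_iff)
  moreover have "0 \<le> theta N \<alpha> \<beta>" by (simp add: theta_def)
  ultimately show ?thesis by simp
qed

end

section \<open>The critical value\<close>

lemma alpha_c_le: "0 \<le> \<alpha> \<Longrightarrow> 0 < theta N \<alpha> \<beta> \<Longrightarrow> alpha_c N \<beta> \<le> ereal \<alpha>"
  unfolding alpha_c_def by (rule Inf_lower) blast

lemma alpha_c_ge: "(\<And>\<alpha>. 0 \<le> \<alpha> \<Longrightarrow> 0 < theta N \<alpha> \<beta> \<Longrightarrow> c \<le> ereal \<alpha>) \<Longrightarrow> c \<le> alpha_c N \<beta>"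
  unfolding alpha_c_def by (rule Inf_greatest) blast

lemma alpha_c_less: "alpha_c N \<beta> < c \<Longrightarrow> \<exists>\<alpha>\<ge>0. 0 < theta N \<alpha> \<beta> \<and> ereal \<alpha> < c"
  unfolding alpha_c_def Inf_less_iff by blast

lemma alpha_c_nonneg: "0 \<le> alpha_c N \<beta>"
  by (rule alpha_c_ge) simp

context hierarchical
begin

lemma theta_0:
  assumes "real N < \<beta>"
  shows "theta N 0 \<beta> = 0"
proof -
  have "escape_prob 0 \<beta> n = 0" for n by (simp add: escape_prob_def EE_const)
  then have "theta N 0 \<beta> \<le> 0" using theta_le_escape_prob[of 0 \<beta> 0] assms by simp
  moreover have "0 \<le> theta N 0 \<beta>" by (simp add: theta_def)
  ultimately show ?thesis by simp
qed

lemma alpha_c_low: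
  assumes "0 < \<beta>" "\<beta> \<le> real N"
  shows "alpha_c N \<beta> = 0"
proof (rule antisym)
  show "alpha_c N \<beta> \<le> 0"
  proof (rule ereal_le_epsilon2)
    fix e :: real assume "0 < e"
    then show "alpha_c N \<beta> \<le> 0 + ereal e"
      using alpha_c_le[of e N \<beta>] theta_eq_1[of e \<beta>] assms by simp
  qed
qed (rule alpha_c_nonneg)

lemma alpha_c_ratio:
  assumes b: "real N < \<beta>1" "\<beta>1 \<le> \<beta>2" and r: "ereal r \<le> alpha_c N \<beta>1"
  shows "ereal (r * \<beta>2 / \<beta>1) \<le> alpha_c N \<beta>2"
proof (rule alpha_c_ge)
  fix \<alpha> assume a: "0 \<le> \<alpha>" "0 < theta N \<alpha> \<beta>2"
  have b0: "0 < \<beta>1" "0 < \<beta>2" using b N2 by auto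
  have "alpha_c N \<beta>1 \<le> ereal (\<alpha> * \<beta>1 / \<beta>2)"
    using theta_ratio[OF a(1) b] a b0 by (intro alpha_c_le) auto
  then have "ereal r \<le> ereal (\<alpha> * \<beta>1 / \<beta>2)" by (rule order_trans[OF r])
  then have "r * \<beta>2 \<le> \<alpha> * \<beta>1" using b0 by (simp add: pos_le_divide_eq)
  then show "ereal (r * \<beta>2 / \<beta>1) \<le> ereal \<alpha>" using b0 by (simp add: pos_divide_le_eq)
qed

text \<open>The singleton of 0 already serves as \<open>S\<close>: its \<open>phi\<close> is
  \<open>\<alpha> * rho \<beta> 0\<close>, an upper bound for the mean degree, as in a comparison
  with a branching process.\<close>

lemma alpha_c_pos:
  assumes b: "real N < \<beta>"
  shows "0 < alpha_c N \<beta>"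
proof -
  have r: "0 < rho \<beta> 0" by (rule rho_pos[OF b])
  have "ereal (1 / rho \<beta> 0) \<le> alpha_c N \<beta>"
  proof (rule alpha_c_ge)
    fix \<alpha> assume a: "0 \<le> \<alpha>" "0 < theta N \<alpha> \<beta>"
    have E: "edges {\<lambda>_::nat. 0::nat} = {}" by (auto simp: edges_def)
    have "phi \<alpha> \<beta> {\<lambda>_. 0} = \<alpha> * rho \<beta> 0" by (simp add: phi_def E out_weight_def)
    then have "\<not> \<alpha> * rho \<beta> 0 < 1" using theta_zero_of_phi[OF a(1) b, of "{\<lambda>_. 0}"] a(2) by auto
    then show "ereal (1 / rho \<beta> 0) \<le> ereal \<alpha>" using r by (simp add: pos_divide_le_eq)
  qed
  moreover have "0 < ereal (1 / rho \<beta> 0)" using r by simp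
  ultimately show ?thesis by (rule less_le_trans[rotated])
qed

lemma ex_block:
  assumes "real N \<le> \<beta>" "\<beta> < (real N)\<^sup>2"
  shows "\<exists>K\<ge>3. 2 * \<beta> \<le> ((real N)\<^sup>2 / \<beta>) ^ K"
proof -
  have "0 < \<beta>" using assms N2 by simp
  then have v: "1 < (real N)\<^sup>2 / \<beta>" using assms by simp
  then obtain K where K: "2 * \<beta> < ((real N)\<^sup>2 / \<beta>) ^ K" using real_arch_pow by blast
  have "((real N)\<^sup>2 / \<beta>) ^ K \<le> ((real N)\<^sup>2 / \<beta>) ^ (max 3 K)" using v by (intro power_increasing) auto
  then show ?thesis using K by (intro exI[of _ "max 3 K"]) auto
qed

text \<open>The renormalization is started at radius 0, where a single vertex is a cluster of size 1
  and failure is impossible; only \<alpha> has to be large.\<close>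

lemma alpha_c_finite:
  assumes b: "real N < \<beta>" "\<beta> < (real N)\<^sup>2"
  shows "alpha_c N \<beta> < \<infinity>"
proof -
  have b0: "0 < \<beta>" using b N2 by simp
  obtain K where K: "3 \<le> K" "2 * \<beta> \<le> ((real N)\<^sup>2 / \<beta>) ^ K" using ex_block[of \<beta>] b by auto
  define \<alpha> where "\<alpha> = 32 * real K * ln N * \<beta> ^ (0 + K)"
  have lnN: "0 < ln (real N)" using N2 by simp
  have a: "0 < \<alpha>" unfolding \<alpha>_def using K b0 lnN by simp
  have "big (B 0) 1 \<omega>" for \<omega>
  proof -
    have "1 \<le> card (C 0 \<omega>)" by (rule card_C_pos)
    then show ?thesis unfolding big_def by (intro bexI[of _ "\<lambda>_. 0"]) auto
  qed
  then have "prob_not_big \<alpha> \<beta> 0 1 = 0" by (simp add: prob_not_big_def EE_const)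
  then have "0 < theta N \<alpha> \<beta>"
    using theta_pos[OF a b(1) zero_less_one K, of 0] by (simp add: \<alpha>_def)
  then have "alpha_c N \<beta> \<le> ereal \<alpha>" using a by (intro alpha_c_le) auto
  also have "\<dots> < \<infinity>" by simp
  finally show ?thesis .
qed

section \<open>Continuity and monotonicity of the critical value\<close>

lemma edge_prob_tendsto:
  assumes "0 < \<beta>0"
  shows "((\<lambda>\<beta>. edge_prob \<alpha> \<beta> e) \<longlongrightarrow> edge_prob \<alpha> \<beta>0 e) (at \<beta>0 within X)"
  unfolding edge_prob_def using assms by (intro tendsto_intros) auto

text \<open>The hypotheses of \<open>theta_pos\<close> are open conditions on \<open>\<beta>\<close> in a fixed finite ball.\<close>

lemma eventually_theta_pos_right:
  assumes a: "0 < \<alpha>" and b: "real N \<le> \<beta>0" "\<beta>0 < (real N)\<^sup>2" and p: "0 < p" "p \<le> 1" and H: "spread \<alpha> \<beta>0 p"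
  shows "eventually (\<lambda>\<beta>. 0 < theta N \<alpha> \<beta>) (at_right \<beta>0)"
proof -
  have N1: "1 < real N" using N2 by simp
  have b0: "0 < \<beta>0" "1 \<le> \<beta>0" using b N1 by auto
  \<comment> \<open>Fixing \<beta>1 first makes \<open>K\<close>, \<delta> and the ball uniform for
    all \<beta> between \<beta>0 and \<beta>1.\<close>
  define \<beta>1 where "\<beta>1 = (\<beta>0 + (real N)\<^sup>2) / 2"
  have b1: "\<beta>0 < \<beta>1" "\<beta>1 < (real N)\<^sup>2" using b by (auto simp: \<beta>1_def)
  then have b10: "0 < \<beta>1" using b0 by simp
  obtain K where K: "3 \<le> K" "2 * \<beta>1 \<le> ((real N)\<^sup>2 / \<beta>1) ^ K" using ex_block[of \<beta>1] b b1 by auto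
  define \<delta> where "\<delta> = 1 / real N ^ (4 * K)"
  have d: "0 < \<delta>" using N1 by (simp add: \<delta>_def)
  obtain c n1 where c: "0 < c" and n1: "\<And>n. n1 \<le> n \<Longrightarrow> prob_not_big \<alpha> \<beta>0 n (c * real N ^ n) < \<delta>"
    using prob_not_big_small_of_spread[OF a b0(2) b(2) p H d] by blast
  define v where "v = (real N)\<^sup>2 / \<beta>1"
  have v: "1 < v" using b1 b10 by (simp add: v_def)
  \<comment> \<open>\<open>D \<le> v ^ n\<close> is the numerical hypothesis of
    \<open>theta_pos\<close> at \<beta>1 with \<open>s0 = c * N ^ n\<close>, solved for
    \<open>v ^ n\<close>.\<close>
  define D where "D = 32 * real K * ln N * \<beta>1 ^ K / (\<alpha> * c\<^sup>2)"
  obtain n2 where n2: "D < v ^ n2" using real_arch_pow[OF v] by blast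
  define n where "n = max n1 n2"
  let ?s = "c * real N ^ n"
  have s: "0 < ?s" using c N1 by simp
  have "v ^ n2 \<le> v ^ n" unfolding n_def using v by (intro power_increasing) auto
  then have "D * \<beta>1 ^ n \<le> v ^ n * \<beta>1 ^ n" using n2 b10 by (intro mult_right_mono) auto
  also have "\<dots> = (real N ^ n)\<^sup>2"
    using b10 by (simp add: v_def power_divide power2_eq_square power_mult_distrib)
  finally have "(\<alpha> * c\<^sup>2) * (D * \<beta>1 ^ n) \<le> (\<alpha> * c\<^sup>2) * (real N ^ n)\<^sup>2"
    using a by (intro mult_left_mono) auto
  then have A: "32 * real K * ln N * \<beta>1 ^ (n + K) \<le> \<alpha> * ?s\<^sup>2"
    using a c by (simp add: D_def power_add power_mult_distrib mult_ac)
  have "((\<lambda>\<beta>. prob_not_big \<alpha> \<beta> n ?s) \<longlongrightarrow> prob_not_big \<alpha> \<beta>0 n ?s) (at_right \<beta>0)"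
    unfolding prob_not_big_def by (intro EE_tendsto edge_prob_tendsto b0)
  then have "eventually (\<lambda>\<beta>. prob_not_big \<alpha> \<beta> n ?s < \<delta>) (at_right \<beta>0)"
    by (rule order_tendstoD) (use n1 in \<open>simp add: n_def\<close>)
  moreover have "eventually (\<lambda>\<beta>. \<beta> \<in> {\<beta>0<..<\<beta>1}) (at_right \<beta>0)" using b1(1) by (rule eventually_at_right_real)
  ultimately show ?thesis
  proof eventually_elim
    case (elim \<beta>)
    then have be: "\<beta>0 < \<beta>" "\<beta> < \<beta>1" by auto
    have bp: "0 < \<beta>" using be b0 by simp
    have "((real N)\<^sup>2 / \<beta>1) ^ K \<le> ((real N)\<^sup>2 / \<beta>) ^ K"
      using be bp b10 by (intro power_mono divide_left_mono) auto
    then have u: "2 * \<beta> \<le> ((real N)\<^sup>2 / \<beta>) ^ K" using K(2) be by linarith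
    have "\<beta> ^ (n + K) \<le> \<beta>1 ^ (n + K)" using be bp by (intro power_mono) auto
    then have "32 * real K * ln N * \<beta> ^ (n + K) \<le> 32 * real K * ln N * \<beta>1 ^ (n + K)"
      using N1 by (intro mult_left_mono) auto
    then have A': "32 * real K * ln N * \<beta> ^ (n + K) \<le> \<alpha> * ?s\<^sup>2" using A by linarith
    show ?case
      by (rule theta_pos[OF a _ s K(1) u A']) (use elim be b in \<open>auto simp: \<delta>_def\<close>)
  qed
qed

text \<open>Above N the input is a positive theta at \<beta>0. At \<beta>0 = N every small \<alpha>
  has to percolate slightly above N as well, and \<open>spread_at_N\<close> supplies the
  input.\<close>

lemma alpha_c_right:
  assumes b: "real N \<le> \<beta>0" "\<beta>0 < (real N)\<^sup>2" and c: "alpha_c N \<beta>0 < c"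
  shows "eventually (\<lambda>\<beta>. alpha_c N \<beta> < c) (at_right \<beta>0)"
proof -
  have "\<exists>\<alpha> p. 0 < \<alpha> \<and> ereal \<alpha> < c \<and> 0 < p \<and> p \<le> 1 \<and> spread \<alpha> \<beta>0 p"
  proof (cases "\<beta>0 = real N")
    case True
    have "0 < c" using c alpha_c_nonneg[of N \<beta>0] by (rule le_less_trans[rotated])
    then obtain \<alpha> where "0 < ereal \<alpha>" "ereal \<alpha> < c" using ereal_dense2 by blast
    then show ?thesis using spread_at_N[of \<alpha>] True by (intro exI[of _ \<alpha>] exI[of _ "1 / 2"]) auto
  next
    case False
    then have b': "real N < \<beta>0" using b by simp
    obtain \<alpha> where a: "0 \<le> \<alpha>" "0 < theta N \<alpha> \<beta>0" "ereal \<alpha> < c" using alpha_c_less[OF c] by blast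
    have "\<alpha> \<noteq> 0" using a(2) theta_0[OF b'] by auto
    moreover have "theta N \<alpha> \<beta>0 \<le> 1"
      using theta_le_escape_prob[OF a(1) b', of 0] escape_prob_bounds(2)[OF a(1) b', of 0] by simp
    ultimately show ?thesis
      using spread_of_theta_pos[OF a(1) b' a(2)] a by (intro exI[of _ \<alpha>] exI[of _ "theta N \<alpha> \<beta>0 / 2"]) auto
  qed
  then obtain \<alpha> p where a: "0 < \<alpha>" "ereal \<alpha> < c" and p: "0 < p" "p \<le> 1" "spread \<alpha> \<beta>0 p" by blast
  from eventually_theta_pos_right[OF a(1) b p] show ?thesis
  proof eventually_elim
    case (elim \<beta>)
    then have "alpha_c N \<beta> \<le> ereal \<alpha>" using a by (intro alpha_c_le) auto
    then show ?case using a(2) by (rule le_less_trans)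
  qed
qed

lemma rho_tendsto:
  assumes "real N < \<beta>0"
  shows "((\<lambda>\<beta>. rho \<beta> n) \<longlongrightarrow> rho \<beta>0 n) (at \<beta>0 within X)"
  unfolding rho_def using assms N2 by (intro tendsto_intros) auto

lemma phi_tendsto:
  assumes "real N < \<beta>0"
  shows "((\<lambda>\<beta>. phi \<alpha> \<beta> S) \<longlongrightarrow> phi \<alpha> \<beta>0 S) (at \<beta>0 within X)"
proof -
  have b0: "0 < \<beta>0" using assms N2 by simp
  have "((\<lambda>\<beta>. out_weight \<beta> S x) \<longlongrightarrow> out_weight \<beta>0 S x) (at \<beta>0 within X)" for x
    unfolding out_weight_def using b0 by (intro tendsto_intros rho_tendsto assms) auto
  then show ?thesis
    unfolding phi_def by (intro tendsto_intros EE_tendsto edge_prob_tendsto b0)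
qed

text \<open>A witness \<open>S\<close> is finite, so \<open>phi a0 \<beta> S < 1\<close> persists
  for \<beta> near \<beta>0. Two values below the critical one are taken because the witness at
  \<open>a0\<close> comes from theta vanishing at a larger \<open>a1\<close>. At \<beta>0 = N^2,
  where the critical value is infinite, this is the divergence.\<close>

lemma alpha_c_lower:
  assumes b: "real N < \<beta>0" and c: "c < alpha_c N \<beta>0"
  shows "eventually (\<lambda>\<beta>. c < alpha_c N \<beta>) (at \<beta>0)"
proof (cases "c < 0")
  case True
  then show ?thesis using alpha_c_nonneg less_le_trans by (intro always_eventually allI) blast
next
  case False
  obtain a0 where a0: "c < ereal a0" "ereal a0 < alpha_c N \<beta>0" using ereal_dense2[OF c] by blast
  obtain a1 where a1: "ereal a0 < ereal a1" "ereal a1 < alpha_c N \<beta>0" using ereal_dense2[OF a0(2)] by blast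
  have "0 < ereal a0" using False a0(1) by (meson le_less_trans not_less)
  then have a: "0 < a0" "a0 < a1" using a1 by auto
  have "\<not> 0 < theta N a1 \<beta>0"
    using alpha_c_le[of a1 N \<beta>0] a a1(2) by (auto simp: not_le[symmetric])
  then obtain S where S: "finite S" "S \<subseteq> hlattice N" "(\<lambda>_. 0) \<in> S" "phi a0 \<beta>0 S < 1"
    using theta_pos_of_phi[OF b a] by (meson not_less)
  have "eventually (\<lambda>\<beta>. phi a0 \<beta> S < 1) (at \<beta>0)"
    using phi_tendsto[OF b] S(4) by (rule order_tendstoD)
  moreover have "eventually (\<lambda>\<beta>. real N < \<beta>) (at \<beta>0)"
    using tendsto_ident_at b by (rule order_tendstoD)
  ultimately show ?thesis
  proof eventually_elim
    case (elim \<beta>)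
    have z: "theta N a0 \<beta> = 0"
      by (rule theta_zero_of_phi[OF less_imp_le[OF a(1)] elim(2) S(1-3) elim(1)])
    have "ereal a0 \<le> alpha_c N \<beta>"
    proof (rule alpha_c_ge)
      fix \<alpha> assume al: "0 \<le> \<alpha>" "0 < theta N \<alpha> \<beta>"
      have "a0 \<le> \<alpha>"
      proof (rule ccontr)
        assume "\<not> a0 \<le> \<alpha>"
        then have "theta N \<alpha> \<beta> \<le> theta N a0 \<beta>" by (intro theta_mono al elim) simp
        then show False using al z by simp
      qed
      then show "ereal a0 \<le> ereal \<alpha>" by simp
    qed
    then show ?case using a0(1) by (rule less_le_trans[rotated])
  qed
qed

lemma alpha_c_N2: "alpha_c N ((real N)\<^sup>2) = \<infinity>"
proof -
  have "\<infinity> \<le> alpha_c N ((real N)\<^sup>2)" by (rule alpha_c_ge) (simp add: theta_N2)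
  then show ?thesis by simp
qed

text \<open>Multiplication by \<beta>2/\<beta>1 > 1 is strict on a positive finite value; at
  \<beta>1 = N the value is 0 and positivity above N takes over.\<close>

lemma alpha_c_strict_mono:
  assumes "real N \<le> \<beta>1" "\<beta>1 < \<beta>2" "\<beta>2 < (real N)\<^sup>2"
  shows "alpha_c N \<beta>1 < alpha_c N \<beta>2"
proof (cases "\<beta>1 = real N")
  case True
  then show ?thesis using alpha_c_low[of \<beta>1] alpha_c_pos[of \<beta>2] assms N2 by simp
next
  case False
  then have b: "real N < \<beta>1" using assms by simp
  have "alpha_c N \<beta>1 < \<infinity>" "0 < alpha_c N \<beta>1"
    using alpha_c_finite[of \<beta>1] alpha_c_pos[of \<beta>1] b assms by auto
  then obtain r where r: "alpha_c N \<beta>1 = ereal r" "0 < r" by (cases "alpha_c N \<beta>1") auto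
  have "r < r * \<beta>2 / \<beta>1" using r assms b N2 by (simp add: field_simps)
  then have "ereal r < ereal (r * \<beta>2 / \<beta>1)" by simp
  also have "\<dots> \<le> alpha_c N \<beta>2" using alpha_c_ratio[OF b, of \<beta>2 r] assms r by simp
  finally show ?thesis using r by simp
qed

lemma alpha_c_tendsto:
  assumes b: "0 < \<beta>0" "\<beta>0 < (real N)\<^sup>2"
  shows "(alpha_c N \<longlongrightarrow> alpha_c N \<beta>0) (at \<beta>0)"
proof (rule order_tendstoI)
  fix c assume c: "c < alpha_c N \<beta>0"
  show "eventually (\<lambda>\<beta>. c < alpha_c N \<beta>) (at \<beta>0)"
  proof (cases "real N < \<beta>0")
    case True then show ?thesis using c by (rule alpha_c_lower)
  next
    case False
    then have "c < 0" using c alpha_c_low[of \<beta>0] b by simp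
    then show ?thesis using alpha_c_nonneg less_le_trans by (intro always_eventually allI) blast
  qed
next
  fix c assume c: "alpha_c N \<beta>0 < c"
  \<comment> \<open>From the left monotonicity suffices; only the right side needs the finite-ball
    condition.\<close>
  have left: "eventually (\<lambda>\<beta>. alpha_c N \<beta> < c) (at_left \<beta>0)"
  proof -
    have "eventually (\<lambda>\<beta>. \<beta> \<in> {0<..<\<beta>0}) (at_left \<beta>0)" using b(1) by (rule eventually_at_left_real)
    then show ?thesis
    proof eventually_elim
      case (elim \<beta>)
      have "alpha_c N \<beta> \<le> alpha_c N \<beta>0"
      proof (cases "\<beta> \<le> real N")
        case True then show ?thesis using elim alpha_c_low[of \<beta>] alpha_c_nonneg by simp
      next
        case False then show ?thesis using elim b alpha_c_strict_mono[of \<beta> \<beta>0] by simp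
      qed
      then show ?case using c by (rule le_less_trans)
    qed
  qed
  have right: "eventually (\<lambda>\<beta>. alpha_c N \<beta> < c) (at_right \<beta>0)"
  proof (cases "real N \<le> \<beta>0")
    case True then show ?thesis using b(2) c by (rule alpha_c_right)
  next
    case False
    then have "eventually (\<lambda>\<beta>. \<beta> \<in> {\<beta>0<..<real N}) (at_right \<beta>0)" by (intro eventually_at_right_real) simp
    then show ?thesis
    proof eventually_elim
      case (elim \<beta>)
      then show ?case using c b alpha_c_low[of \<beta>] alpha_c_low[of \<beta>0] by simp
    qed
  qed
  show "eventually (\<lambda>\<beta>. alpha_c N \<beta> < c) (at \<beta>0)"
    using left right by (simp add: eventually_at_split)
qed

end

theorem theorem4:
  fixes N :: nat
  assumes "N \<ge> 2"
  shows "continuous_on {0<..<(real N)\<^sup>2} (alpha_c N)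
    \<and> strict_mono_on {real N..<(real N)\<^sup>2} (alpha_c N)
    \<and> (alpha_c N \<longlongrightarrow> \<infinity>) (at_left ((real N)\<^sup>2))"
proof -
  interpret hierarchical N by unfold_locales (rule assms)
  have "continuous_on {0<..<(real N)\<^sup>2} (alpha_c N)"
    using alpha_c_tendsto by (auto simp: continuous_on_eq_continuous_at isCont_def)
  moreover have "strict_mono_on {real N..<(real N)\<^sup>2} (alpha_c N)"
    by (rule strict_mono_onI) (use alpha_c_strict_mono in auto)
  moreover have "(alpha_c N \<longlongrightarrow> \<infinity>) (at_left ((real N)\<^sup>2))"
  proof (rule tendsto_PInfty[THEN iffD2], intro allI)
    fix r
    have "real N < (real N)\<^sup>2" using assms by (simp add: power2_eq_square)
    then have "eventually (\<lambda>\<beta>. ereal r < alpha_c N \<beta>) (at ((real N)\<^sup>2))"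
      by (rule alpha_c_lower) (simp add: alpha_c_N2)
    then show "eventually (\<lambda>\<beta>. ereal r < alpha_c N \<beta>) (at_left ((real N)\<^sup>2))"
      by (simp add: eventually_at_split)
  qed
  ultimately show ?thesis by blast
qed

end
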